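(* Let $\mathcal{M}\subset\mathbb{R}^d$ be a compact subset with nonempty $C^\infty$ boundary, let $t_F>0$, and let $\mathcal{T}\subset[0,t_F]$ be a finite set of times with $0\in\mathcal{T}$ and $|\mathcal{T}|>1$. For each $t\in\mathcal{T}$ let $\Phi^t:\mathcal{M}\to\Phi^t(\mathcal{M})\subset\mathbb{R}^d$ be a $C^\infty$ diffeomorphism, with $\Phi^0=\mathrm{id}$. Define the dynamic (Dirichlet) Cheeger constant $$\mathbf{h}_d:=\inf_{A}\ \frac{\frac{1}{|\mathcal{T}|}\sum_{t\in\mathcal{T}}\ell_{d-1}(\Phi^t(\partial A))}{\ell(A)},$$ where the infimum is over all nonempty open submanifolds $A$ of $\mathrm{int}(\mathcal{M})$ with compact closure contained in $\mathrm{int}(\mathcal{M})$ and with $C^\infty$ boundary $\partial A$, and define the dynamic (Dirichlet) Sobolev constant $$\mathbf{s}_d:=\inf_{f\in C^\infty_c(\mathcal{M},\mathbb{R})}\ \frac{\frac{1}{|\mathcal{T}|}\sum_{t\in\mathcal{T}}\|\nabla(\Phi^t_*f)\|_1}{\|f\|_1}.$$ Then $\mathbf{h}_d=\mathbf{s}_d$.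
   Context: $\mathcal{M}$ is regarded as a $d$-dimensional compact manifold with boundary (a compact smooth domain) in $\mathbb{R}^d$. $\ell$ denotes $d$-dimensional Lebesgue measure and $\ell_{d-1}$ denotes $(d-1)$-dimensional (hypersurface) volume. $C^\infty_c(\mathcal{M},\mathbb{R})$ denotes the set of non-identically-vanishing, $C^\infty$, real-valued functions with compact support in $\mathrm{int}(\mathcal{M})$. The pushforward is $\Phi^t_*f:=f\circ(\Phi^t)^{-1}$, a function on $\Phi^t(\mathcal{M})$. $\|\nabla(\Phi^t_*f)\|_1=\int_{\Phi^t(\mathcal{M})}|\nabla(\Phi^t_*f)|\,d\ell$ with $|\cdot|$ the Euclidean norm, and $\|f\|_1=\int_{\mathcal{M}}|f|\,d\ell$. *)

theory Defs
  imports "HOL-Analysis.Analysis"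
begin

text \<open>
  In finite dimension, a function is \<open>C\<^sup>k\<^sup>+\<^sup>1\<close> on an open set iff it is differentiable there and all its
  directional derivatives are \<open>C\<^sup>k\<close>. The first two predicates are meant for open sets only.
\<close>

primrec C_k_on :: "nat \<Rightarrow> ('a::euclidean_space \<Rightarrow> 'b::euclidean_space) \<Rightarrow> 'a set \<Rightarrow> bool" where
  "C_k_on 0 f U \<longleftrightarrow> continuous_on U f"
| "C_k_on (Suc k) f U \<longleftrightarrow>
     (\<forall>x\<in>U. f differentiable (at x)) \<and> (\<forall>v. C_k_on k (\<lambda>x. frechet_derivative f (at x) v) U)"

definition smooth_on :: "('a::euclidean_space \<Rightarrow> 'b::euclidean_space) \<Rightarrow> 'a set \<Rightarrow> bool" where
  "smooth_on f U \<longleftrightarrow> (\<forall>k. C_k_on k f U)"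

text \<open>On an arbitrary set, smoothness means the existence of local smooth extensions; for a domain
  with smooth boundary this is smoothness up to the boundary.\<close>

definition smooth_map :: "'a set \<Rightarrow> ('a::euclidean_space \<Rightarrow> 'b::euclidean_space) \<Rightarrow> bool" where
  "smooth_map S f \<longleftrightarrow>
     (\<forall>x\<in>S. \<exists>U F. open U \<and> x \<in> U \<and> smooth_on F U \<and> (\<forall>y\<in>S \<inter> U. F y = f y))"

definition smooth_diffeo_onto_image :: "'a set \<Rightarrow> ('a::euclidean_space \<Rightarrow> 'b::euclidean_space) \<Rightarrow> bool" where
  "smooth_diffeo_onto_image S f \<longleftrightarrow>
     inj_on f S \<and> smooth_map S f \<and> smooth_map (f ` S) (inv_into S f)"

definition gradient_within :: "(real^'n) set \<Rightarrow> (real^'n \<Rightarrow> real) \<Rightarrow> real^'n \<Rightarrow> real^'n" where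
  "gradient_within S f x = (\<chi> i. frechet_derivative f (at x within S) (axis i 1))"

text \<open>
  Near each of its boundary points the set lies on one side of a smooth hypersurface, given by a
  defining function with nonvanishing gradient. For an open set \<open>S\<close> this says \<open>S \<inter> U = {g < 0}\<close>,
  for a closed one \<open>S \<inter> U = {g \<le> 0}\<close>.
\<close>

definition smooth_boundary :: "(real^'n) set \<Rightarrow> bool" where
  "smooth_boundary S \<longleftrightarrow>
     (\<forall>p\<in>frontier S. \<exists>U g. open U \<and> p \<in> U \<and> smooth_on g U \<and>
        (\<forall>x\<in>U. gradient_within UNIV g x \<noteq> 0) \<and>
        interior S \<inter> U = {x\<in>U. g x < 0} \<and> frontier S \<inter> U = {x\<in>U. g x = 0})"

text \<open>
  Hypersurface volume is the Riemannian volume of the metric induced from the ambient space. The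
  coordinate hyperplane \<open>{x. x $ k = 0}\<close>, equipped with its \<open>(n - 1)\<close>-dimensional Lebesgue measure,
  plays the role of \<open>\<real>\<^sup>n\<^sup>-\<^sup>1\<close>; for \<open>n = 1\<close> this measure is the unit mass at the origin.
\<close>

definition coord_hyperplane :: "'n \<Rightarrow> (real^'n) set" where
  "coord_hyperplane k = {x. x $ k = 0}"

definition hyperplane_lborel :: "'n \<Rightarrow> (real^'n) measure" where
  "hyperplane_lborel k =
     distr (\<Pi>\<^sub>M i\<in>UNIV - {k}. lborel) borel (\<lambda>y. \<chi> i. if i = k then 0 else y i)"

text \<open>The map \<open>\<psi>\<close> is defined on an open set \<open>W\<close> of the ambient space, but only its restriction to
  the hyperplane matters; smooth maps on relatively open subsets of the hyperplane extend in this way.\<close>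

definition local_parametrization ::
    "(real^'n) set \<Rightarrow> 'n \<Rightarrow> (real^'n) set \<Rightarrow> (real^'n \<Rightarrow> real^'n) \<Rightarrow> bool" where
  "local_parametrization \<Sigma> k W \<psi> \<longleftrightarrow>
     open W \<and> smooth_on \<psi> W \<and>
     (\<exists>V \<phi>. open V \<and> homeomorphism (W \<inter> coord_hyperplane k) (V \<inter> \<Sigma>) \<psi> \<phi>) \<and>
     (\<forall>x\<in>W \<inter> coord_hyperplane k. inj_on (frechet_derivative \<psi> (at x)) (coord_hyperplane k))"

text \<open>The square root of the Gram determinant of the \<open>n - 1\<close> tangent vectors \<open>\<partial>\<^sub>i\<psi>\<close>, \<open>i \<noteq> k\<close>. Row and
  column \<open>k\<close> of the matrix are those of the identity, so they do not affect the determinant.\<close>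

definition volume_density :: "'n \<Rightarrow> (real^'n \<Rightarrow> real^'n) \<Rightarrow> real^'n \<Rightarrow> real" where
  "volume_density k \<psi> x = sqrt (det (\<chi> i j.
     if i = k \<or> j = k then (if i = j then 1 else 0)
     else frechet_derivative \<psi> (at x) (axis i 1) \<bullet> frechet_derivative \<psi> (at x) (axis j 1)))"

text \<open>The Riemannian volume measure of a closed smooth hypersurface \<open>\<Sigma>\<close>, extended by zero to the
  ambient space. For such \<open>\<Sigma>\<close> it exists, by invariance of the local formula under changes of
  parametrization, and it is unique because countably many parametrizations cover \<open>\<Sigma>\<close>.\<close>

definition surface_measure :: "(real^'n) set \<Rightarrow> (real^'n) measure" where
  "surface_measure \<Sigma> = (THE \<mu>. sets \<mu> = sets borel \<and> emeasure \<mu> (UNIV - \<Sigma>) = 0 \<and>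
     (\<forall>k W \<psi> C. local_parametrization \<Sigma> k W \<psi> \<longrightarrow> C \<in> sets borel \<longrightarrow>
        C \<subseteq> \<psi> ` (W \<inter> coord_hyperplane k) \<longrightarrow>
        emeasure \<mu> C =
          (\<integral>\<^sup>+x\<in>W \<inter> coord_hyperplane k \<inter> \<psi> -` C. ennreal (volume_density k \<psi> x)
             \<partial>hyperplane_lborel k)))"

definition hypersurface_volume :: "(real^'n) set \<Rightarrow> ennreal" where
  "hypersurface_volume \<Sigma> = emeasure (surface_measure \<Sigma>) \<Sigma>"

definition admissible_sets :: "(real^'n) set \<Rightarrow> (real^'n) set set" where
  "admissible_sets M = {A. A \<noteq> {} \<and> open A \<and> compact (closure A) \<and> closure A \<subseteq> interior M \<and>
     smooth_boundary A}"

text \<open>Functions on \<open>M\<close> with compact support in \<open>interior M\<close> are identified with their extensions by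
  zero to the whole space.\<close>

definition test_functions :: "(real^'n) set \<Rightarrow> (real^'n \<Rightarrow> real) set" where
  "test_functions M = {f. smooth_on f UNIV \<and> (\<exists>x. f x \<noteq> 0) \<and>
     compact (closure {x. f x \<noteq> 0}) \<and> closure {x. f x \<noteq> 0} \<subseteq> interior M}"

definition pushforward :: "'a set \<Rightarrow> ('a \<Rightarrow> 'b) \<Rightarrow> ('a \<Rightarrow> 'c) \<Rightarrow> 'b \<Rightarrow> 'c" where
  "pushforward M \<Phi> f = (\<lambda>y. f (inv_into M \<Phi> y))"

definition L1_norm_on :: "(real^'n) set \<Rightarrow> (real^'n \<Rightarrow> 'b::real_normed_vector) \<Rightarrow> ennreal" where
  "L1_norm_on S f = (\<integral>\<^sup>+x\<in>S. ennreal (norm (f x)) \<partial>lborel)"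

text \<open>Both constants take values in \<open>[0, \<infinity>]\<close>, so that the infima are taken in a complete lattice.\<close>

definition dynamic_cheeger ::
    "(real^'n) set \<Rightarrow> real set \<Rightarrow> (real \<Rightarrow> real^'n \<Rightarrow> real^'n) \<Rightarrow> ennreal" where
  "dynamic_cheeger M T \<Phi> =
     (INF A\<in>admissible_sets M.
        (1 / of_nat (card T) * (\<Sum>t\<in>T. hypersurface_volume (\<Phi> t ` frontier A)))
          / emeasure lborel A)"

definition dynamic_sobolev ::
    "(real^'n) set \<Rightarrow> real set \<Rightarrow> (real \<Rightarrow> real^'n \<Rightarrow> real^'n) \<Rightarrow> ennreal" where
  "dynamic_sobolev M T \<Phi> =
     (INF f\<in>test_functions M.
        (1 / of_nat (card T) *
          (\<Sum>t\<in>T. L1_norm_on (\<Phi> t ` M) (gradient_within (\<Phi> t ` M) (pushforward M (\<Phi> t) f))))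
          / L1_norm_on M f)"

end

theory Submission
  imports Defs
begin

text \<open>
  The proof follows Federer and Fleming. Both inequalities rest on the coarea formula
  \<open>\<integral> \<phi>(g) |\<nabla>g| = \<integral> \<phi>(s) area {g = s} ds\<close> for a smooth \<open>g\<close> without critical points, applied for every \<open>t \<in> T\<close>
  to the transported function \<open>f \<circ> (\<Phi> t)\<^sup>-\<^sup>1\<close>; the level sets of the latter are the images of those of \<open>f\<close>.

  If \<open>A\<close> is admissible, write \<open>A = {\<rho> < 0}\<close> with \<open>\<rho>\<close> smooth and \<open>\<nabla>\<rho> \<noteq> 0\<close> on the boundary, and let \<open>f\<^sub>n = \<eta>(n\<rho>)\<close>
  for a smooth step \<open>\<eta>\<close>. Then \<open>f\<^sub>n\<close> increases to the indicator of \<open>A\<close>, while the \<open>L\<^sup>1\<close> norm of the gradient of the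
  transported \<open>f\<^sub>n\<close> is a weighted mean of the areas of level sets that converge to the image of the boundary.

  Conversely, let \<open>f\<close> be a test function. For small generic \<open>a\<close>, all critical points of \<open>f\<^sub>a(x) = f x + a \<bullet> x\<close> are
  nondegenerate, so there are only countably many critical values. For all other \<open>s > |a| sup |x|\<close> the set
  \<open>{f > 0, f\<^sub>a > s}\<close> is empty or admissible. Integrate the Cheeger inequality for these sets over \<open>s\<close>,
  let \<open>a\<close> tend to \<open>0\<close>, and add the results for \<open>f\<close> and \<open>-f\<close>.
\<close>

subsection \<open>Calculus of smooth functions\<close>

text \<open>Two obstacles shape the proof. First, \<open>surface_measure\<close> is a definite
  description over all local parametrizations, so no area can be computed before existence and
  uniqueness are established. Both are shown for level sets without critical points, by gluing
  integrals over graphs; this is why the coarea formula comes in that generality.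

  Second, the level sets of a test function are smooth only at regular values. Sard's theorem for
  scalar functions uses derivatives of high order; adding a linear function reduces the question to
  the gradient map, whose source and target have equal dimension. Linear perturbations also
  transport well: the gradient of \<open>a \<bullet> P y\<close>, with \<open>P\<close> the inverse
  of the diffeomorphism, is bounded on compact sets by \<open>norm a\<close> times a constant
  independent of \<open>a\<close>, so one small \<open>a\<close> serves the finitely many times
  simultaneously. The price is that \<open>f x + a \<bullet> x\<close> is no longer compactly
  supported. The condition \<open>f > 0\<close> and the lower bound on the levels restore
  compactness.\<close>

lemma frechet_derivative_eqI:
  "(f has_derivative f') (at x) \<Longrightarrow> frechet_derivative f (at x) = f'"
  using frechet_derivative_at by metis

lemma C_k_on_subset: "C_k_on k f U \<Longrightarrow> V \<subseteq> U \<Longrightarrow> C_k_on k f V"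
  by (induction k arbitrary: f) (auto intro: continuous_on_subset)

lemma C_k_on_cong:
  assumes "open U" "\<And>x. x \<in> U \<Longrightarrow> f x = g x" "C_k_on k f U"
  shows "C_k_on k g U"
  using assms(2,3)
proof (induction k arbitrary: f g)
  case 0
  then show ?case by (simp cong: continuous_on_cong)
next
  case (Suc k)
  have "g differentiable (at x)" if "x \<in> U" for x
    using Suc.prems that assms(1)
    by (auto simp: differentiable_def) (metis has_derivative_transform_within_open)
  moreover have eq: "frechet_derivative f (at x) = frechet_derivative g (at x)" if "x \<in> U" for x
    by (rule frechet_derivative_transform_within_open[of f _ U]) (use Suc.prems that assms(1) in auto)
  have "C_k_on k (\<lambda>x. frechet_derivative g (at x) v) U" for v
  proof (rule Suc.IH)
    show "C_k_on k (\<lambda>x. frechet_derivative f (at x) v) U"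
      using Suc.prems(2) by simp
  qed (simp add: eq)
  ultimately show ?case by simp
qed

text \<open>Admits any formula for the derivative in place of \<open>frechet_derivative\<close>.
  Openness of \<open>U\<close> matters because the higher derivatives at a point depend on a whole
  neighbourhood.\<close>

lemma C_k_on_SucI:
  assumes "open U" "\<And>x. x \<in> U \<Longrightarrow> (f has_derivative f' x) (at x)"
    and "\<And>v. C_k_on k (\<lambda>x. f' x v) U"
  shows "C_k_on (Suc k) f U"
proof -
  have "C_k_on k (\<lambda>x. frechet_derivative f (at x) v) U" for v
    by (rule C_k_on_cong[OF assms(1) _ assms(3)[of v]]) (simp add: frechet_derivative_eqI[OF assms(2)])
  then show ?thesis
    using assms(2) by (auto simp: differentiable_def)
qed

lemma C_k_on_Suc_has_derivative:
  "C_k_on (Suc k) f U \<Longrightarrow> x \<in> U \<Longrightarrow> (f has_derivative frechet_derivative f (at x)) (at x)"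
  by (simp add: frechet_derivative_works)

lemma C_k_on_SucD: "C_k_on (Suc k) f U \<Longrightarrow> C_k_on k f U"
proof (induction k arbitrary: f)
  case 0
  then show ?case
    by (auto intro!: differentiable_imp_continuous_on simp: differentiable_on_def)
      (metis differentiable_at_withinI)
qed auto

lemma C_k_on_const: "C_k_on k (\<lambda>x. c) U"
  by (induction k arbitrary: c) auto

lemma C_k_on_bounded_linear:
  assumes "bounded_linear L"
  shows "C_k_on k L U"
proof (cases k)
  case 0
  then show ?thesis
    using assms by (auto intro: linear_continuous_on)
next
  case (Suc m)
  have "frechet_derivative L (at x) = L" for x
    by (rule frechet_derivative_eqI) (rule bounded_linear_imp_has_derivative[OF assms])
  then show ?thesis
    using Suc assms by (auto simp: C_k_on_const bounded_linear_imp_differentiable)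
qed

lemma C_k_on_add:
  assumes "open U" "C_k_on k f U" "C_k_on k g U"
  shows "C_k_on k (\<lambda>x. f x + g x) U"
  using assms(2,3)
proof (induction k arbitrary: f g)
  case 0
  then show ?case by (auto intro: continuous_intros)
next
  case (Suc k)
  show ?case
  proof (rule C_k_on_SucI[OF assms(1)])
    show "((\<lambda>x. f x + g x) has_derivative (\<lambda>v. frechet_derivative f (at x) v + frechet_derivative g (at x) v)) (at x)"
      if "x \<in> U" for x
      using Suc.prems that by (intro has_derivative_add C_k_on_Suc_has_derivative)
  qed (use Suc in auto)
qed

lemma C_k_on_sum:
  assumes "open U" "\<And>i. i \<in> I \<Longrightarrow> C_k_on k (f i) U"
  shows "C_k_on k (\<lambda>x. \<Sum>i\<in>I. f i x) U"
  using assms(2)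
  by (induction I rule: infinite_finite_induct)
    (auto simp: C_k_on_const intro!: C_k_on_add[OF assms(1)])

lemma C_k_on_bilinear:
  fixes f :: "'a::euclidean_space \<Rightarrow> 'b::euclidean_space" and g :: "'a \<Rightarrow> 'c::euclidean_space"
    and prod :: "'b \<Rightarrow> 'c \<Rightarrow> 'd::euclidean_space"
  assumes "bounded_bilinear prod" and "open U" "C_k_on k f U" "C_k_on k g U"
  shows "C_k_on k (\<lambda>x. prod (f x) (g x)) U"
  using assms(3,4)
proof (induction k arbitrary: f g)
  case 0
  then show ?case using bounded_bilinear.continuous_on[OF assms(1)] by auto
next
  case (Suc k)
  show ?case
  proof (rule C_k_on_SucI[OF assms(2)])
    show "((\<lambda>x. prod (f x) (g x)) has_derivative
        (\<lambda>v. prod (f x) (frechet_derivative g (at x) v) + prod (frechet_derivative f (at x) v) (g x))) (at x)"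
      if "x \<in> U" for x
      using Suc.prems that by (intro bounded_bilinear.FDERIV[OF assms(1)] C_k_on_Suc_has_derivative)
    show "C_k_on k (\<lambda>x. prod (f x) (frechet_derivative g (at x) v) + prod (frechet_derivative f (at x) v) (g x)) U" for v
      by (intro C_k_on_add assms(2) Suc.IH C_k_on_SucD[OF Suc.prems(1)] C_k_on_SucD[OF Suc.prems(2)])
        (use Suc.prems in simp_all)
  qed
qed

lemma C_k_on_compose:
  fixes f :: "'b::euclidean_space \<Rightarrow> 'c::euclidean_space" and h :: "'a::euclidean_space \<Rightarrow> 'b"
  assumes "open U" "open V" "h ` U \<subseteq> V" "C_k_on k f V" "C_k_on k h U"
  shows "C_k_on k (\<lambda>x. f (h x)) U"
  using assms(4,5)
proof (induction k arbitrary: f)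
  case 0
  then show ?case
    using assms(3) by (auto intro: continuous_on_compose2)
next
  case (Suc k)
  show ?case
  proof (rule C_k_on_SucI[OF assms(1)])
    fix x assume x: "x \<in> U"
    have lin: "linear (frechet_derivative f (at (h x)))"
      using Suc.prems assms(3) x by (auto intro!: linear_frechet_derivative)
    \<comment> \<open>The induction hypothesis treats derivatives of \<open>f\<close> in a fixed
      direction only. Expanding the moving direction in the basis moves its dependence on
      \<open>x\<close> into scalar coefficients.\<close>
    have eq: "frechet_derivative f (at (h x)) (frechet_derivative h (at x) v)
        = (\<Sum>b\<in>Basis. (frechet_derivative h (at x) v \<bullet> b) *\<^sub>R frechet_derivative f (at (h x)) b)" for v
      by (subst euclidean_representation[of "frechet_derivative h (at x) v", symmetric])
        (simp add: linear_sum[OF lin] linear_scale[OF lin] del: euclidean_representation)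
    have "((\<lambda>x. f (h x)) has_derivative
       (\<lambda>v. frechet_derivative f (at (h x)) (frechet_derivative h (at x) v))) (at x)"
      using has_derivative_compose[OF C_k_on_Suc_has_derivative[OF Suc.prems(2) x]
          C_k_on_Suc_has_derivative[OF Suc.prems(1)]] x assms(3) by blast
    then show "((\<lambda>x. f (h x)) has_derivative
       (\<lambda>v. \<Sum>b\<in>Basis. (frechet_derivative h (at x) v \<bullet> b) *\<^sub>R frechet_derivative f (at (h x)) b)) (at x)"
      by (simp only: eq)
  next
    fix v
    show "C_k_on k (\<lambda>x. \<Sum>b\<in>Basis. (frechet_derivative h (at x) v \<bullet> b) *\<^sub>R frechet_derivative f (at (h x)) b) U"
    proof (intro C_k_on_sum[OF assms(1)] C_k_on_bilinear[OF bounded_bilinear_scaleR assms(1)]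
        C_k_on_bilinear[OF bounded_bilinear_inner assms(1)] C_k_on_const Suc.IH)
      show "C_k_on k (\<lambda>x. frechet_derivative h (at x) v) U"
        using Suc.prems by auto
      show "C_k_on k (\<lambda>x. frechet_derivative f (at x) b) V" for b
        using Suc.prems by auto
      show "C_k_on k h U"
        by (rule C_k_on_SucD) (rule Suc.prems)
    qed
  qed
qed

lemma C_k_on_inverse:
  fixes f :: "'a::euclidean_space \<Rightarrow> real"
  assumes "open U" "C_k_on k f U" "\<And>x. x \<in> U \<Longrightarrow> f x \<noteq> 0"
  shows "C_k_on k (\<lambda>x. inverse (f x)) U"
  using assms(2)
proof (induction k)
  case 0
  then show ?case using assms(3) by (auto intro!: continuous_intros)
next
  case (Suc k)
  show ?case
  proof (rule C_k_on_SucI[OF assms(1)])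
    show "((\<lambda>x. inverse (f x)) has_derivative
       (\<lambda>v. - (inverse (f x) * frechet_derivative f (at x) v * inverse (f x)))) (at x)" if "x \<in> U" for x
      using Suc.prems that assms(3) by (intro Deriv.has_derivative_inverse C_k_on_Suc_has_derivative) auto
    have C: "C_k_on k (\<lambda>x. inverse (f x)) U"
      by (rule Suc.IH[OF C_k_on_SucD[OF Suc.prems]])
    have "C_k_on k (\<lambda>x. (-1) * (inverse (f x) * frechet_derivative f (at x) v * inverse (f x))) U" for v
      using Suc.prems
      by (intro C_k_on_bilinear[OF bounded_bilinear_mult assms(1)] C_k_on_const C) auto
    then show "C_k_on k (\<lambda>x. - (inverse (f x) * frechet_derivative f (at x) v * inverse (f x))) U" for v
      by simp
  qed
qed

lemma smooth_on_subset: "smooth_on f U \<Longrightarrow> V \<subseteq> U \<Longrightarrow> smooth_on f V"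
  by (auto simp: smooth_on_def intro: C_k_on_subset)

lemma smooth_on_cong:
  "open U \<Longrightarrow> smooth_on f U \<Longrightarrow> (\<And>x. x \<in> U \<Longrightarrow> f x = g x) \<Longrightarrow> smooth_on g U"
  by (auto simp: smooth_on_def intro: C_k_on_cong)

lemma smooth_on_const: "smooth_on (\<lambda>x. c) U"
  by (simp add: smooth_on_def C_k_on_const)

lemma smooth_on_bounded_linear: "bounded_linear L \<Longrightarrow> smooth_on L U"
  by (simp add: smooth_on_def C_k_on_bounded_linear)

lemma smooth_on_add:
  "open U \<Longrightarrow> smooth_on f U \<Longrightarrow> smooth_on g U \<Longrightarrow> smooth_on (\<lambda>x. f x + g x) U"
  by (simp add: smooth_on_def C_k_on_add)

lemma smooth_on_sum:
  "open U \<Longrightarrow> (\<And>i. i \<in> I \<Longrightarrow> smooth_on (f i) U) \<Longrightarrow> smooth_on (\<lambda>x. \<Sum>i\<in>I. f i x) U"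
  by (simp add: smooth_on_def C_k_on_sum)

lemma smooth_on_mult:
  fixes f g :: "'a::euclidean_space \<Rightarrow> real"
  shows "open U \<Longrightarrow> smooth_on f U \<Longrightarrow> smooth_on g U \<Longrightarrow> smooth_on (\<lambda>x. f x * g x) U"
  by (simp add: smooth_on_def C_k_on_bilinear[OF bounded_bilinear_mult])

lemma smooth_on_scaleR:
  fixes f :: "'a::euclidean_space \<Rightarrow> real"
  shows "open U \<Longrightarrow> smooth_on f U \<Longrightarrow> smooth_on g U \<Longrightarrow> smooth_on (\<lambda>x. f x *\<^sub>R g x) U"
  by (simp add: smooth_on_def C_k_on_bilinear[OF bounded_bilinear_scaleR])

lemma smooth_on_inner:
  "open U \<Longrightarrow> smooth_on f U \<Longrightarrow> smooth_on g U \<Longrightarrow> smooth_on (\<lambda>x. f x \<bullet> g x) U"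
  by (simp add: smooth_on_def C_k_on_bilinear[OF bounded_bilinear_inner])

lemma smooth_on_compose:
  "open U \<Longrightarrow> open V \<Longrightarrow> h ` U \<subseteq> V \<Longrightarrow> smooth_on f V \<Longrightarrow> smooth_on h U \<Longrightarrow> smooth_on (\<lambda>x. f (h x)) U"
  by (simp add: smooth_on_def C_k_on_compose)

lemma smooth_on_inverse:
  fixes f :: "'a::euclidean_space \<Rightarrow> real"
  shows "open U \<Longrightarrow> smooth_on f U \<Longrightarrow> (\<And>x. x \<in> U \<Longrightarrow> f x \<noteq> 0) \<Longrightarrow> smooth_on (\<lambda>x. inverse (f x)) U"
  by (simp add: smooth_on_def C_k_on_inverse)

lemma smooth_on_minus:
  fixes f :: "'a::euclidean_space \<Rightarrow> real"
  assumes "open U" "smooth_on f U"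
  shows "smooth_on (\<lambda>x. - f x) U"
  using smooth_on_mult[OF assms(1) smooth_on_const[of "-1"] assms(2)] by simp

lemma smooth_on_differentiable: "smooth_on f U \<Longrightarrow> x \<in> U \<Longrightarrow> f differentiable (at x)"
  unfolding smooth_on_def using C_k_on.simps(2)[of 0 f U] by blast

lemma smooth_on_has_derivative:
  "smooth_on f U \<Longrightarrow> x \<in> U \<Longrightarrow> (f has_derivative frechet_derivative f (at x)) (at x)"
  by (simp add: frechet_derivative_works[symmetric] smooth_on_differentiable)

lemma smooth_on_frechet_derivative:
  "smooth_on f U \<Longrightarrow> smooth_on (\<lambda>x. frechet_derivative f (at x) v) U"
  unfolding smooth_on_def using C_k_on.simps(2)[of _ f U] by blast

lemma smooth_on_imp_continuous_on: "smooth_on f U \<Longrightarrow> continuous_on U f"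
  unfolding smooth_on_def using C_k_on.simps(1)[of f U] by blast

text \<open>Serves functions glued from pieces on overlapping open sets, and maps that are known
  only through local extensions.\<close>

lemma smooth_on_local:
  assumes "\<And>x. x \<in> U \<Longrightarrow> \<exists>V. open V \<and> x \<in> V \<and> smooth_on f V"
  shows "smooth_on f U"
proof -
  have loc: "C_k_on k g U" if "\<forall>x\<in>U. \<exists>V. open V \<and> x \<in> V \<and> C_k_on k g V" for k and g :: "'a \<Rightarrow> 'b"
    using that
  proof (induction k arbitrary: g)
    case 0
    have "isCont g x" if "x \<in> U" for x
      using 0 that by (force simp: continuous_on_eq_continuous_at)
    then show ?case
      by (simp add: continuous_at_imp_continuous_on)
  next
    case (Suc k)
    have "g differentiable at x" if "x \<in> U" for x
      using Suc.prems that by auto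
    moreover have "C_k_on k (\<lambda>x. frechet_derivative g (at x) v) U" for v
      using Suc.prems by (intro Suc.IH) fastforce
    ultimately show ?case by simp
  qed
  have "\<forall>x\<in>U. \<exists>V. open V \<and> x \<in> V \<and> C_k_on k f V" for k
    using assms unfolding smooth_on_def by blast
  then show ?thesis
    unfolding smooth_on_def by (blast intro: loc)
qed

subsection \<open>Bump functions\<close>

text \<open>The bump functions are built from \<open>x\<^sup>-\<^sup>m exp (-1/x)\<close>; the extra exponent makes the family closed
  under differentiation.\<close>

definition flat_exp :: "nat \<Rightarrow> real \<Rightarrow> real" where
  "flat_exp m x = (if x \<le> 0 then 0 else inverse x ^ m * exp (- inverse x))"

text \<open>With \<open>y = 1/x\<close> this is the decay of \<open>y ^ m / exp y\<close> at
  infinity; to the left of \<open>0\<close> the function vanishes identically.\<close>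

lemma flat_exp_tendsto_0: "(flat_exp m \<longlongrightarrow> 0) (at 0)"
proof -
  have "((\<lambda>x. inverse x ^ m * exp (- inverse x)) \<longlongrightarrow> 0) (at_right (0::real))"
  proof -
    have "((\<lambda>y. y ^ m / exp y) \<longlongrightarrow> 0) (at_top::real filter)"
      by (rule tendsto_power_div_exp_0)
    from filterlim_compose[OF this filterlim_inverse_at_top_right]
    show ?thesis by (simp add: exp_minus divide_inverse)
  qed
  then have "(flat_exp m \<longlongrightarrow> 0) (at_right 0)"
    by (rule Lim_transform_eventually)
      (auto simp: flat_exp_def eventually_at_filter)
  moreover have "(flat_exp m \<longlongrightarrow> 0) (at_left 0)"
    by (rule Lim_transform_eventually[OF tendsto_const])
      (auto simp: flat_exp_def eventually_at_filter)
  ultimately show ?thesis by (simp add: filterlim_split_at_real)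
qed

lemma flat_exp_has_real_derivative:
  "(flat_exp m has_real_derivative flat_exp (m + 2) x - real m * flat_exp (m + 1) x) (at x)"
proof -
  consider "x < 0" | "x > 0" | "x = 0" by linarith
  then show ?thesis
  proof cases
    case 1
    have "((\<lambda>x. 0) has_real_derivative 0) (at x)" by simp
    then have "(flat_exp m has_real_derivative 0) (at x)"
      by (rule has_field_derivative_transform_within_open[where S = "{..<0}"])
        (use 1 in \<open>auto simp: flat_exp_def\<close>)
    then show ?thesis using 1 by (simp add: flat_exp_def)
  next
    case 2
    \<comment> \<open>For \<open>m = 0\<close> the truncated exponent \<open>m - Suc 0\<close> is
      harmless, because the factor \<open>real m\<close> vanishes.\<close>
    have pw: "real m * inverse x ^ (m - Suc 0) * (inverse x * inverse x) = real m * inverse x ^ (m + 1)"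
      by (cases m) auto
    have "((\<lambda>x. inverse x ^ m * exp (- inverse x)) has_real_derivative
       inverse x ^ m * (exp (- inverse x) * (inverse x * inverse x))
       - real m * inverse x ^ (m - Suc 0) * (inverse x * inverse x) * exp (- inverse x)) (at x)"
      using 2 by (auto intro!: derivative_eq_intros)
    then have "((\<lambda>x. inverse x ^ m * exp (- inverse x)) has_real_derivative
       flat_exp (m + 2) x - real m * flat_exp (m + 1) x) (at x)"
      unfolding pw using 2 by (simp add: flat_exp_def algebra_simps)
    then show ?thesis
      by (rule has_field_derivative_transform_within_open[where S = "{0<..}"])
        (use 2 in \<open>auto simp: flat_exp_def\<close>)
  next
    case 3
    \<comment> \<open>The difference quotient at \<open>0\<close> is
      \<open>flat_exp (Suc m)\<close>, so its limit is known already.\<close>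
    have "((\<lambda>h. flat_exp m h / h) \<longlongrightarrow> 0) (at 0)"
      by (rule Lim_transform_eventually[OF flat_exp_tendsto_0[of "Suc m"]])
        (auto simp: flat_exp_def eventually_at_filter divide_inverse)
    then show ?thesis
      using 3 by (simp add: DERIV_def flat_exp_def)
  qed
qed

lemma smooth_on_flat_exp: "smooth_on (flat_exp m) U"
proof -
  have "C_k_on k (flat_exp m) UNIV" for k
  proof (induction k arbitrary: m)
    case 0
    then show ?case
      by (auto intro!: continuous_at_imp_continuous_on DERIV_isCont flat_exp_has_real_derivative)
  next
    case (Suc k)
    show ?case
    proof (rule C_k_on_SucI)
      show "(flat_exp m has_derivative (\<lambda>v. (flat_exp (m + 2) x + (- real m) * flat_exp (m + 1) x) * v)) (at x)" for x
        using flat_exp_has_real_derivative[of m x] by (simp add: has_field_derivative_def)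
      show "C_k_on k (\<lambda>x. (flat_exp (m + 2) x + (- real m) * flat_exp (m + 1) x) * v) UNIV" for v
        by (intro C_k_on_bilinear[OF bounded_bilinear_mult] C_k_on_add C_k_on_const Suc) auto
    qed auto
  qed
  then show ?thesis
    by (auto simp: smooth_on_def intro: C_k_on_subset)
qed

lemma flat_exp_0_pos_iff: "flat_exp 0 x > 0 \<longleftrightarrow> x > 0"
  and flat_exp_nonneg: "flat_exp m x \<ge> 0"
  by (auto simp: flat_exp_def)

lemma flat_exp_0_mono: "x \<le> y \<Longrightarrow> flat_exp 0 x \<le> flat_exp 0 y"
  by (auto simp: flat_exp_def)

text \<open>The squared distance is a polynomial, which avoids the singularity of the norm at
  \<open>p\<close>; positivity holds exactly on the open ball.\<close>

definition bump :: "'a::euclidean_space \<Rightarrow> real \<Rightarrow> 'a \<Rightarrow> real" where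
  "bump p r x = flat_exp 0 (r\<^sup>2 - (x - p) \<bullet> (x - p))"

lemma smooth_on_bump: "smooth_on (bump p r) UNIV"
proof -
  have sub: "smooth_on (\<lambda>x. x + (- p)) UNIV"
    by (intro smooth_on_add smooth_on_const smooth_on_bounded_linear bounded_linear_ident) auto
  have "smooth_on (\<lambda>x. r\<^sup>2 + (-1) * ((x + (- p)) \<bullet> (x + (- p)))) UNIV"
    by (intro smooth_on_add smooth_on_mult smooth_on_inner sub smooth_on_const) auto
  from smooth_on_compose[OF _ _ _ smooth_on_flat_exp[of 0 UNIV] this]
  show ?thesis by (simp add: bump_def[abs_def])
qed

lemma bump_nonneg: "bump p r x \<ge> 0"
  by (simp add: bump_def flat_exp_nonneg)

lemma bump_pos_iff: "r > 0 \<Longrightarrow> bump p r x > 0 \<longleftrightarrow> x \<in> ball p r"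
  unfolding bump_def flat_exp_0_pos_iff
  by (simp add: dist_norm norm_minus_commute power2_norm_eq_inner[symmetric] abs_le_square_iff[symmetric] not_le[symmetric])

lemma bump_eq_0_iff: "r > 0 \<Longrightarrow> bump p r x = 0 \<longleftrightarrow> x \<notin> ball p r"
  using bump_pos_iff[of r p x] bump_nonneg[of p r x] by (metis less_le)

text \<open>The usual quotient of flat exponentials, placed so that the descent from
  \<open>1\<close> to \<open>0\<close> takes place on \<open>[-1, 0]\<close>. Composed with a
  positive multiple of a defining function \<open>\<rho>\<close>, it is then nonzero exactly where
  \<open>\<rho> < 0\<close>.\<close>

definition smooth_step :: "real \<Rightarrow> real" where
  "smooth_step u = flat_exp 0 (- u) * inverse (flat_exp 0 (- u) + flat_exp 0 (1 + u))"

lemma smooth_step_denominator: "flat_exp 0 (- u) + flat_exp 0 (1 + u) > 0"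
proof -
  have "flat_exp 0 (- u) > 0 \<or> flat_exp 0 (1 + u) > 0"
    unfolding flat_exp_0_pos_iff by linarith
  then show ?thesis
    using flat_exp_nonneg[of 0 "-u"] flat_exp_nonneg[of 0 "1 + u"] by linarith
qed

lemma smooth_on_smooth_step: "smooth_on smooth_step UNIV"
proof -
  have 1: "smooth_on (\<lambda>u. flat_exp 0 (- u)) UNIV"
    by (rule smooth_on_compose[where V = UNIV])
      (auto intro!: smooth_on_flat_exp smooth_on_bounded_linear bounded_linear_minus bounded_linear_ident)
  have 2: "smooth_on (\<lambda>u. flat_exp 0 (1 + u)) UNIV"
    by (rule smooth_on_compose[where V = UNIV])
      (auto intro!: smooth_on_flat_exp smooth_on_add[OF _ smooth_on_const smooth_on_bounded_linear] bounded_linear_ident)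
  show ?thesis
    unfolding smooth_step_def[abs_def] using smooth_step_denominator
    by (intro smooth_on_mult smooth_on_inverse smooth_on_add 1 2) (auto simp: less_le)
qed

lemma smooth_step_eq_0: "u \<ge> 0 \<Longrightarrow> smooth_step u = 0"
  and smooth_step_eq_1: "u \<le> -1 \<Longrightarrow> smooth_step u = 1"
  by (auto simp: smooth_step_def flat_exp_def)

lemma smooth_step_nonneg: "smooth_step u \<ge> 0" and smooth_step_le_1: "smooth_step u \<le> 1"
  using smooth_step_denominator[of u] flat_exp_nonneg[of 0 "-u"] flat_exp_nonneg[of 0 "1+u"]
  by (auto simp: smooth_step_def divide_inverse[symmetric] divide_le_eq_1)

lemma smooth_step_antimono: "u \<le> v \<Longrightarrow> smooth_step v \<le> smooth_step u"
proof -
  assume uv: "u \<le> v"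
  define a b c d where abcd: "a = flat_exp 0 (- v)" "b = flat_exp 0 (1 + v)"
    "c = flat_exp 0 (- u)" "d = flat_exp 0 (1 + u)"
  have "a \<le> c" "d \<le> b" "a \<ge> 0" "b \<ge> 0" "c \<ge> 0" "d \<ge> 0"
    using uv by (auto simp: abcd intro!: flat_exp_0_mono flat_exp_nonneg)
  then have "a * d \<le> c * b" by (intro mult_mono)
  moreover have "a + b > 0" "c + d > 0"
    using smooth_step_denominator by (auto simp: abcd)
  ultimately have "a / (a + b) \<le> c / (c + d)"
    by (simp add: divide_le_eq pos_le_divide_eq algebra_simps)
  then show ?thesis by (simp add: smooth_step_def abcd divide_inverse)
qed

subsection \<open>Change of variables\<close>

text \<open>The library proves the change of variables formula and the easy case of Sard's theorem only for
  well-ordered index types. Every finite index type has a well-ordered copy, along which both are transported.\<close>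

typedef ('a::finite) idx = "{..<CARD('a)}"
  by (rule exI[of _ 0]) simp

instance idx :: (finite) finite
proof
  have "(UNIV :: 'a idx set) = Abs_idx ` {..<CARD('a)}"
    by (rule type_definition.Abs_image[OF type_definition_idx, symmetric])
  then show "finite (UNIV :: 'a idx set)" by (metis finite_imageI finite_lessThan)
qed

instantiation idx :: (finite) wellorder
begin

definition less_eq_idx :: "'a idx \<Rightarrow> 'a idx \<Rightarrow> bool" where
  "less_eq_idx x y \<longleftrightarrow> Rep_idx x \<le> Rep_idx y"

definition less_idx :: "'a idx \<Rightarrow> 'a idx \<Rightarrow> bool" where
  "less_idx x y \<longleftrightarrow> Rep_idx x < Rep_idx y"

instance
proof
  fix P :: "'a idx \<Rightarrow> bool" and a :: "'a idx"
  assume *: "\<And>x. (\<And>y. y < x \<Longrightarrow> P y) \<Longrightarrow> P x"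
  show "P a"
    by (induction a rule: measure_induct_rule[of Rep_idx]) (use * in \<open>auto simp: less_idx_def\<close>)
qed (auto simp: less_eq_idx_def less_idx_def Rep_idx_inject)

end

lemma ex_bij_idx: "\<exists>b. bij (b :: 'n::finite idx \<Rightarrow> 'n)"
proof -
  have "CARD('n idx) = CARD('n)"
    by (rule type_definition.card[OF type_definition_idx, unfolded card_lessThan])
  then show ?thesis
    using finite_same_card_bij[of "UNIV :: 'n idx set" "UNIV :: 'n set"] by auto
qed

text \<open>Conjugation by \<open>b\<close> is a sign-preserving bijection between the permutations
  of the two index sets and matches the terms of the Leibniz formula.\<close>

lemma det_reindex:
  fixes A :: "'a::comm_ring_1^'n^'n" and b :: "'m::finite \<Rightarrow> 'n"
  assumes "bij b"
  shows "det (\<chi> i j. A $ b i $ b j) = det A"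
proof -
  have inj: "inj b" and surj: "surj b" using assms by (auto simp: bij_def)
  have eq: "map_permutation UNIV b p = b \<circ> p \<circ> inv b" for p
    using surj by (auto simp: map_permutation_def restrict_id_def fun_eq_iff)
  show ?thesis
    unfolding det_def
  proof (rule sum.reindex_bij_witness[where i = "\<lambda>q. inv b \<circ> q \<circ> b" and j = "\<lambda>p. b \<circ> p \<circ> inv b"])
    fix p :: "'m \<Rightarrow> 'm" assume "p \<in> {p. p permutes UNIV}"
    then have p: "p permutes UNIV" by simp
    show "inv b \<circ> (b \<circ> p \<circ> inv b) \<circ> b = p"
      using inj by (auto simp: fun_eq_iff)
    show "b \<circ> p \<circ> inv b \<in> {p. p permutes UNIV}"
      using map_permutation_permutes[OF assms p] by (simp add: eq)
    have "sign (b \<circ> p \<circ> inv b) = sign p"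
      using sign_map_permutation[OF inj p] by (simp add: eq)
    moreover have "(\<Prod>i\<in>UNIV. A $ i $ (b \<circ> p \<circ> inv b) i) = (\<Prod>i\<in>UNIV. A $ b i $ b (p i))"
      using prod.reindex_bij_betw[OF assms, of "\<lambda>i. A $ i $ (b \<circ> p \<circ> inv b) i"] inj by simp
    ultimately show "of_int (sign (b \<circ> p \<circ> inv b)) * (\<Prod>i\<in>UNIV. A $ i $ (b \<circ> p \<circ> inv b) i) =
         of_int (sign p) * (\<Prod>i\<in>UNIV. (\<chi> i j. A $ b i $ b j) $ i $ p i)"
      by simp
  next
    fix q :: "'n \<Rightarrow> 'n" assume "q \<in> {q. q permutes UNIV}"
    then have q: "q permutes UNIV" by simp
    show "b \<circ> (inv b \<circ> q \<circ> b) \<circ> inv b = q"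
      using surj by (auto simp: fun_eq_iff surj_f_inv_f)
    show "inv b \<circ> q \<circ> b \<in> {p. p permutes UNIV}"
      using assms permutes_bij[OF q] by (auto intro!: bij_imp_permutes bij_comp bij_imp_bij_inv)
  qed
qed

section \<open>Lebesgue measure in coordinates\<close>

lemma borel_measurable_vec_lambda:
  assumes "\<And>i. (\<lambda>x. f x i) \<in> borel_measurable M"
  shows "(\<lambda>x. (\<chi> i. f x i) :: real^'n) \<in> borel_measurable M"
  by (subst borel_measurable_euclidean_space) (use assms in \<open>auto simp: Basis_vec_def inner_axis\<close>)

lemma prod_Basis_vec: "(\<Prod>b\<in>(Basis::(real^'n) set). F b) = (\<Prod>i\<in>UNIV. F (axis i 1))"
proof -
  have B: "(Basis::(real^'n) set) = (\<lambda>i. axis i 1) ` UNIV"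
    by (auto simp: Basis_vec_def)
  have "inj (\<lambda>i. axis i 1 :: real^'n)"
    by (auto simp: inj_on_def axis_eq_axis)
  then show ?thesis
    unfolding B by (subst prod.reindex) auto
qed

lemma lborel_vec_eqI:
  fixes M :: "(real^'n) measure"
  assumes "\<And>l u. (\<And>i. l $ i \<le> u $ i) \<Longrightarrow> emeasure M (box l u) = (\<Prod>i\<in>UNIV. u $ i - l $ i)"
    and "sets M = sets borel"
  shows "lborel = M"
proof (rule lborel_eqI)
  fix l u :: "real^'n" assume *: "\<And>b. b \<in> Basis \<Longrightarrow> l \<bullet> b \<le> u \<bullet> b"
  have "l $ i \<le> u $ i" for i
    using *[of "axis i 1"] by (auto simp: inner_axis Basis_vec_def)
  from assms(1)[OF this] show "emeasure M (box l u) = (\<Prod>b\<in>Basis. (u - l) \<bullet> b)"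
    by (simp add: prod_Basis_vec inner_axis)
qed fact

lemma emeasure_lborel_box_vec:
  fixes l u :: "real^'n"
  assumes "\<And>i. l $ i \<le> u $ i"
  shows "emeasure lborel (box l u) = (\<Prod>i\<in>UNIV. u $ i - l $ i)"
proof -
  have "emeasure lborel (box l u) = (\<Prod>b\<in>Basis. (u - l) \<bullet> b)"
    using assms by (intro emeasure_lborel_box) (auto simp: Basis_vec_def inner_axis)
  then show ?thesis by (simp add: prod_Basis_vec inner_axis)
qed

definition reindex :: "('m \<Rightarrow> 'n) \<Rightarrow> real^'n \<Rightarrow> real^'m" where
  "reindex b x = (\<chi> i. x $ b i)"

lemma reindex_inverse:
  assumes "bij b"
  shows "reindex (inv b) (reindex b x) = x" "reindex b (reindex (inv b) y) = y"
  using assms by (simp_all add: reindex_def bij_is_surj surj_f_inv_f bij_is_inj)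

lemma bounded_linear_reindex: "bounded_linear (reindex b :: real^'n \<Rightarrow> real^'m)"
  by (simp add: linear_conv_bounded_linear[symmetric] linear_iff reindex_def vec_eq_iff)

lemma lborel_reindex:
  fixes b :: "'m::finite \<Rightarrow> 'n::finite"
  assumes "bij b"
  shows "distr lborel borel (reindex b) = lborel"
proof (rule lborel_vec_eqI[symmetric])
  fix l u :: "real^'m" assume lu: "\<And>i. l $ i \<le> u $ i"
  have meas: "reindex b \<in> borel_measurable (borel :: (real^'n) measure)"
    by (intro borel_measurable_continuous_onI linear_continuous_on bounded_linear_reindex)
  have inv: "b (inv b i) = i" "inv b (b j) = j" for i j
    using assms by (simp_all add: bij_is_surj surj_f_inv_f bij_is_inj)
  have "reindex b -` box l u = box (reindex (inv b) l) (reindex (inv b) u)"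
    unfolding set_eq_iff mem_box_cart reindex_def vimage_def
    by simp (metis inv)
  then have "emeasure (distr lborel borel (reindex b)) (box l u) = (\<Prod>i\<in>UNIV. u $ inv b i - l $ inv b i)"
    using meas lu by (subst emeasure_distr) (auto simp: emeasure_lborel_box_vec reindex_def)
  also have "(\<Prod>i\<in>UNIV. u $ inv b i - l $ inv b i) = (\<Prod>i\<in>UNIV. u $ i - l $ i)"
    using prod.reindex_bij_betw[OF bij_imp_bij_inv[OF assms], of "\<lambda>i. u $ i - l $ i"] by simp
  finally show "emeasure (distr lborel borel (reindex b)) (box l u) = (\<Prod>i\<in>UNIV. u $ i - l $ i)" .
qed simp

text \<open>Both sides are integrals of \<open>q\<close> against a measure: Lebesgue measure on the
  image, and the push-forward under \<open>T\<close> of the density given by the Jacobian. The two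
  measures agree on Borel sets by the formula for the measure of a differentiable image.\<close>

lemma nn_integral_change_of_variables_wellorder:
  fixes T :: "real^'n::{finite,wellorder} \<Rightarrow> real^'n::_"
  assumes \<Omega>: "open \<Omega>" and der: "\<And>x. x \<in> \<Omega> \<Longrightarrow> (T has_derivative T' x) (at x)" and inj: "inj_on T \<Omega>"
    and cont: "continuous_on \<Omega> (\<lambda>x. det (matrix (T' x)))"
    and [measurable]: "q \<in> borel_measurable borel"
  shows "(\<integral>\<^sup>+x\<in>T ` \<Omega>. q x \<partial>lborel) = (\<integral>\<^sup>+x\<in>\<Omega>. ennreal \<bar>det (matrix (T' x))\<bar> * q (T x) \<partial>lborel)"
proof -
  have contT: "continuous_on \<Omega> T"
    using der by (auto intro!: continuous_at_imp_continuous_on has_derivative_continuous)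
  have openT: "open (T ` \<Omega>)"
    by (rule invariance_of_domain[OF contT \<Omega> inj])
  \<comment> \<open>Extension by zero makes \<open>T\<close> and the Jacobian Borel on the whole
    space. The arbitrary value of \<open>T1\<close> outside \<open>\<Omega>\<close> carries no mass,
    since \<open>d\<close> vanishes there.\<close>
  define T1 where "T1 x = indicator \<Omega> x *\<^sub>R T x" for x
  define d where "d x = indicator \<Omega> x *\<^sub>R \<bar>det (matrix (T' x))\<bar>" for x
  have T1[measurable]: "T1 \<in> borel_measurable borel"
    unfolding T1_def[abs_def] using \<Omega> by (intro borel_measurable_continuous_on_indicator contT) auto
  have d[measurable]: "d \<in> borel_measurable borel"
    unfolding d_def[abs_def] using \<Omega>
    by (intro borel_measurable_continuous_on_indicator continuous_intros cont) auto
  have [measurable]: "\<Omega> \<in> sets borel" "T ` \<Omega> \<in> sets borel"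
    using \<Omega> openT by auto
  have key: "emeasure lborel (T ` \<Omega> \<inter> X) = (\<integral>\<^sup>+x. ennreal (d x) * indicator X (T1 x) \<partial>lborel)"
    if [measurable]: "X \<in> sets borel" for X
  proof -
    define S where "S = \<Omega> \<inter> T1 -` X"
    have S[measurable]: "S \<in> sets borel"
      unfolding S_def using measurable_sets_borel[OF T1 that] by auto
    have SO: "S \<subseteq> \<Omega>" by (auto simp: S_def)
    have img: "T ` S = T ` \<Omega> \<inter> X"
      by (auto simp: S_def T1_def)
    have derS: "(T has_derivative T' x) (at x within S)" if "x \<in> S" for x
      using der that SO by (auto intro: has_derivative_at_withinI)
    have injS: "inj_on T S" using inj SO by (rule inj_on_subset)
    have SL: "S \<in> sets lebesgue" using S by simp
    have imgL: "T ` S \<in> sets lebesgue" "T ` S \<in> sets borel"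
      unfolding img using sets_completionI_sets[of "T ` \<Omega> \<inter> X" lborel] by simp_all
    define dS where "dS x = indicator S x * d x" for x
    have [measurable]: "dS \<in> borel_measurable borel"
      unfolding dS_def[abs_def] by measurable
    have dS0: "dS x \<ge> 0" for x by (auto simp: dS_def d_def)
    have int_eq: "(\<integral>\<^sup>+x. ennreal (d x) * indicator X (T1 x) \<partial>lborel) = (\<integral>\<^sup>+x. ennreal (dS x) \<partial>lborel)"
      by (intro nn_integral_cong) (auto simp: dS_def S_def d_def indicator_def)
    note img_iff = has_measure_differentiable_image[OF SL derS injS]
    have restr: "((\<lambda>x. \<bar>det (matrix (T' x))\<bar>) has_integral m) S \<longleftrightarrow> (dS has_integral m) UNIV" for m
    proof -
      have "dS = (\<lambda>x. if x \<in> S then \<bar>det (matrix (T' x))\<bar> else 0)"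
        using SO by (auto simp: dS_def d_def fun_eq_iff)
      then show ?thesis
        using has_integral_restrict_UNIV[of S "\<lambda>x. \<bar>det (matrix (T' x))\<bar>" m] by simp
    qed
    \<comment> \<open>The formula for the image relates finite measures to finite integrals only, so
      the infinite case is derived from it by contraposition.\<close>
    have "emeasure lebesgue (T ` S) = (\<integral>\<^sup>+x. ennreal (dS x) \<partial>lborel)"
    proof (cases "(\<integral>\<^sup>+x. ennreal (dS x) \<partial>lborel)" rule: ennreal_cases)
      case (real r)
      then have "(dS has_integral r) UNIV"
        by (intro nn_integral_has_integral dS0) auto
      then have "T ` S \<in> lmeasurable" "measure lebesgue (T ` S) = r"
        using img_iff restr by auto
      then show ?thesis using real by (simp add: emeasure_eq_measure2)
    next
      case top
      have "T ` S \<notin> lmeasurable"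
      proof
        assume "T ` S \<in> lmeasurable"
        then have "(dS has_integral measure lebesgue (T ` S)) UNIV"
          using img_iff restr by blast
        from nn_integral_has_integral_lborel[OF _ dS0 this] top show False by simp
      qed
      then show ?thesis using top imgL(1)
        by (auto simp: fmeasurable_def less_top[symmetric])
    qed
    then show ?thesis
      using imgL(2) by (simp add: img int_eq emeasure_completion)
  qed
  have "density lborel (indicator (T ` \<Omega>)) = distr (density lborel (\<lambda>x. ennreal (d x))) borel T1"
  proof (rule measure_eqI)
    fix X assume "X \<in> sets (density lborel (indicator (T ` \<Omega>)))"
    then have [measurable]: "X \<in> sets borel" by simp
    have "emeasure (density lborel (indicator (T ` \<Omega>))) X = emeasure lborel (T ` \<Omega> \<inter> X)"
      by (simp add: emeasure_density indicator_inter_arith[symmetric])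
    also have "\<dots> = emeasure (distr (density lborel (\<lambda>x. ennreal (d x))) borel T1) X"
    proof -
      have V: "T1 -` X \<in> sets borel" by (rule measurable_sets_borel[OF T1]) simp
      have "emeasure (distr (density lborel (\<lambda>x. ennreal (d x))) borel T1) X
          = (\<integral>\<^sup>+x. ennreal (d x) * indicator (T1 -` X) x \<partial>lborel)"
        using V by (simp add: emeasure_distr emeasure_density)
      also have "\<dots> = (\<integral>\<^sup>+x. ennreal (d x) * indicator X (T1 x) \<partial>lborel)"
        by (intro nn_integral_cong) (simp add: indicator_def)
      finally show ?thesis by (simp add: key)
    qed
    finally show "emeasure (density lborel (indicator (T ` \<Omega>))) X =
        emeasure (distr (density lborel (\<lambda>x. ennreal (d x))) borel T1) X" .
  qed simp
  then have "(\<integral>\<^sup>+x. q x \<partial>density lborel (indicator (T ` \<Omega>)))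
      = (\<integral>\<^sup>+x. q x \<partial>distr (density lborel (\<lambda>x. ennreal (d x))) borel T1)"
    by simp
  then have "(\<integral>\<^sup>+x\<in>T ` \<Omega>. q x \<partial>lborel) = (\<integral>\<^sup>+x. ennreal (d x) * q (T1 x) \<partial>lborel)"
    by (simp add: nn_integral_density nn_integral_distr mult.commute)
  also have "\<dots> = (\<integral>\<^sup>+x\<in>\<Omega>. ennreal \<bar>det (matrix (T' x))\<bar> * q (T x) \<partial>lborel)"
    by (intro nn_integral_cong) (auto simp: d_def T1_def indicator_def)
  finally show ?thesis .
qed

lemma matrix_reindex:
  assumes "bij b"
  shows "matrix (\<lambda>y. reindex b (L (reindex (inv b) y))) = (\<chi> i j. matrix L $ b i $ b j)"
proof -
  have "reindex (inv b) (axis j 1) = axis (b j) (1::real)" for j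
    using assms by (auto simp: reindex_def axis_def vec_eq_iff bij_is_surj surj_f_inv_f bij_is_inj inv_f_eq)
  then show ?thesis
    by (simp add: matrix_def reindex_def vec_eq_iff)
qed

text \<open>A permutation of the coordinates preserves Lebesgue measure as well as the Jacobian
  determinant, so conjugating \<open>T\<close> by it changes neither side.\<close>

theorem nn_integral_change_of_variables:
  fixes T :: "real^'n \<Rightarrow> real^'n"
  assumes \<Omega>: "open \<Omega>" and der: "\<And>x. x \<in> \<Omega> \<Longrightarrow> (T has_derivative T' x) (at x)" and inj: "inj_on T \<Omega>"
    and cont: "continuous_on \<Omega> (\<lambda>x. det (matrix (T' x)))"
    and [measurable]: "q \<in> borel_measurable borel"
  shows "(\<integral>\<^sup>+x\<in>T ` \<Omega>. q x \<partial>lborel) = (\<integral>\<^sup>+x\<in>\<Omega>. ennreal \<bar>det (matrix (T' x))\<bar> * q (T x) \<partial>lborel)"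
proof -
  obtain b :: "'n idx \<Rightarrow> 'n" where b: "bij b"
    using ex_bij_idx by blast
  define J K where "J = reindex b" and "K = reindex (inv b)"
  have JK: "J (K y) = y" "K (J x) = x" for x y
    using reindex_inverse[OF b] by (simp_all add: J_def K_def)
  have blJ: "bounded_linear J" and blK: "bounded_linear K"
    by (simp_all add: J_def K_def bounded_linear_reindex)
  have contK: "continuous_on A K" and contJ: "continuous_on B J" for A B
    using blJ blK by (auto intro: linear_continuous_on)
  have [measurable]: "K \<in> borel_measurable borel" "J \<in> borel_measurable borel"
    by (auto intro!: borel_measurable_continuous_onI contK contJ)
  have lbK: "lborel = distr lborel borel K"
    unfolding K_def using lborel_reindex[OF bij_imp_bij_inv[OF b]] by simp
  define S where "S y = J (T (K y))" for y
  define S' where "S' y = (\<lambda>v. J (T' (K y) (K v)))" for y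
  define U where "U = K -` \<Omega>"
  have openU: "open U"
    unfolding U_def using \<Omega> contK[of UNIV] by (simp add: continuous_on_open_vimage)
  have detS: "det (matrix (S' y)) = det (matrix (T' (K y)))" for y
    unfolding S'_def using matrix_reindex[OF b, of "T' (K y)"] det_reindex[OF b, of "matrix (T' (K y))"]
    by (simp add: J_def K_def)
  have derS: "(S has_derivative S' y) (at y)" if "y \<in> U" for y
  proof -
    have "(K has_derivative K) (at y)"
      by (rule bounded_linear_imp_has_derivative[OF blK])
    from has_derivative_compose[OF this der]
    have "((\<lambda>y. T (K y)) has_derivative (\<lambda>v. T' (K y) (K v))) (at y)"
      using that by (auto simp: U_def)
    from bounded_linear.has_derivative[OF blJ this] show ?thesis
      by (simp add: S_def[abs_def] S'_def)
  qed
  have injS: "inj_on S U"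
    using inj by (auto simp: inj_on_def S_def U_def) (metis JK)
  have contS: "continuous_on U (\<lambda>y. det (matrix (S' y)))"
    unfolding detS by (rule continuous_on_compose2[OF cont contK]) (auto simp: U_def)
  have mem: "K y \<in> T ` \<Omega> \<longleftrightarrow> y \<in> S ` U" for y
  proof
    assume "K y \<in> T ` \<Omega>"
    then obtain x where "x \<in> \<Omega>" "K y = T x" by auto
    then have "J x \<in> U" "y = S (J x)"
      by (auto simp: U_def S_def JK) (metis JK(1))
    then show "y \<in> S ` U" by blast
  qed (auto simp: S_def U_def JK)
  have mT: "T ` \<Omega> \<in> sets borel"
    by (intro borel_open invariance_of_domain[OF _ \<Omega> inj] continuous_at_imp_continuous_on)
      (use der in \<open>auto intro: has_derivative_continuous\<close>)
  have mD: "(\<lambda>x. ennreal \<bar>det (matrix (T' x))\<bar> * q (T x) * indicator \<Omega> x) \<in> borel_measurable borel"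
  proof -
    have 1: "(\<lambda>x. indicator \<Omega> x *\<^sub>R \<bar>det (matrix (T' x))\<bar>) \<in> borel_measurable borel"
      using \<Omega> by (intro borel_measurable_continuous_on_indicator continuous_intros cont) auto
    have 2: "(\<lambda>x. indicator \<Omega> x *\<^sub>R T x) \<in> borel_measurable borel"
      using \<Omega> der by (intro borel_measurable_continuous_on_indicator continuous_at_imp_continuous_on)
        (auto intro: has_derivative_continuous)
    have "(\<lambda>x. ennreal (indicator \<Omega> x *\<^sub>R \<bar>det (matrix (T' x))\<bar>) * q (indicator \<Omega> x *\<^sub>R T x)) \<in> borel_measurable borel"
      using 1 2 by measurable
    then show ?thesis
      by (rule back_subst[of "\<lambda>f. f \<in> _"]) (auto simp: indicator_def)
  qed
  have "(\<integral>\<^sup>+x\<in>T ` \<Omega>. q x \<partial>lborel) = (\<integral>\<^sup>+y\<in>S ` U. q (K y) \<partial>lborel)"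
    using mT by (subst lbK, subst nn_integral_distr) (auto simp: mem indicator_def intro!: nn_integral_cong)
  also have "\<dots> = (\<integral>\<^sup>+y\<in>U. ennreal \<bar>det (matrix (S' y))\<bar> * q (K (S y)) \<partial>lborel)"
    by (rule nn_integral_change_of_variables_wellorder[OF openU derS injS contS]) auto
  also have "\<dots> = (\<integral>\<^sup>+x\<in>\<Omega>. ennreal \<bar>det (matrix (T' x))\<bar> * q (T x) \<partial>lborel)"
    using mD by (subst lbK, subst nn_integral_distr)
      (auto simp: S_def JK detS U_def indicator_def intro!: nn_integral_cong)
  finally show ?thesis .
qed

text \<open>To be applied to a gradient map, whose critical points are the points with degenerate
  Hessian.\<close>

lemma negligible_critical_values:
  fixes f :: "real^'n \<Rightarrow> real^'n"
  assumes der: "\<And>x. x \<in> S \<Longrightarrow> (f has_derivative f' x) (at x)"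
    and crit: "\<And>x. x \<in> S \<Longrightarrow> det (matrix (f' x)) = 0"
  shows "negligible (f ` S)"
proof -
  obtain b :: "'n idx \<Rightarrow> 'n" where b: "bij b"
    using ex_bij_idx by blast
  define J K where "J = reindex b" and "K = reindex (inv b)"
  have JK: "J (K y) = y" "K (J x) = x" for x y
    using reindex_inverse[OF b] by (simp_all add: J_def K_def)
  have blJ: "bounded_linear J" and blK: "bounded_linear K"
    by (simp_all add: J_def K_def bounded_linear_reindex)
  define h where "h y = J (f (K y))" for y
  define h' where "h' y = (\<lambda>v. J (f' (K y) (K v)))" for y
  have "negligible (h ` (K -` S))"
  proof (rule baby_Sard)
    fix y assume y: "y \<in> K -` S"
    have "(K has_derivative K) (at y)"
      by (rule bounded_linear_imp_has_derivative[OF blK])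
    from has_derivative_compose[OF this der]
    have "((\<lambda>y. f (K y)) has_derivative (\<lambda>v. f' (K y) (K v))) (at y)"
      using y by auto
    from bounded_linear.has_derivative[OF blJ this]
    show "(h has_derivative h' y) (at y within K -` S)"
      by (auto simp: h_def[abs_def] h'_def intro: has_derivative_at_withinI)
    have "det (matrix (h' y)) = 0"
      unfolding h'_def using matrix_reindex[OF b, of "f' (K y)"] det_reindex[OF b, of "matrix (f' (K y))"] crit y
      by (simp add: J_def K_def)
    then show "rank (matrix (h' y)) < CARD('n idx)"
      by (simp add: less_rank_noninjective det_eq_0_rank)
  qed simp
  then have "negligible (K ` (h ` (K -` S)))"
    by (rule negligible_differentiable_image_negligible[rotated])
      (auto simp: differentiable_on_def blK intro!: bounded_linear_imp_differentiable
        card_eq_UNIV_imp_eq_UNIV simp: type_definition.card[OF type_definition_idx])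
  also have "K ` (h ` (K -` S)) = f ` (K ` (K -` S))"
    by (simp only: image_image h_def JK)
  also have "K ` (K -` S) = S"
    using JK(2) by (intro surj_image_vimage_eq) (metis surjI)
  finally show ?thesis .
qed


subsection \<open>Slicing by hyperplanes\<close>

text \<open>The hyperplane stays inside the ambient space, so the projection onto it is an
  endomorphism and can enter square Jacobian matrices.\<close>

definition drop_coord :: "'n \<Rightarrow> real^'n \<Rightarrow> real^'n" where
  "drop_coord k x = (\<chi> i. if i = k then 0 else x $ i)"

lemma drop_coord_nth: "drop_coord k x $ i = (if i = k then 0 else x $ i)"
  by (simp add: drop_coord_def)

lemma bounded_linear_drop_coord: "bounded_linear (drop_coord k)"
  by (simp add: linear_conv_bounded_linear[symmetric] linear_iff drop_coord_def vec_eq_iff)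

lemma drop_coord_decomp: "drop_coord k x + (x $ k) *\<^sub>R axis k 1 = x"
  by (auto simp: vec_eq_iff drop_coord_nth axis_def)

lemma drop_coord_mem: "drop_coord k x \<in> coord_hyperplane k"
  by (simp add: coord_hyperplane_def drop_coord_nth)

lemma drop_coord_id: "x \<in> coord_hyperplane k \<Longrightarrow> drop_coord k x = x"
  by (auto simp: coord_hyperplane_def drop_coord_nth vec_eq_iff)

lemma drop_coord_add_axis: "drop_coord k (x + s *\<^sub>R axis k 1) = drop_coord k x"
  by (auto simp: vec_eq_iff drop_coord_nth axis_def)

lemma drop_coord_drop_coord: "drop_coord k (drop_coord k x) = drop_coord k x"
  by (simp add: drop_coord_id drop_coord_mem)

lemma drop_coord_eq_iff: "x $ k = y $ k \<Longrightarrow> drop_coord k x = drop_coord k y \<Longrightarrow> x = y"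
  by (metis drop_coord_decomp)

lemma continuous_on_drop_coord: "continuous_on A (drop_coord k)"
  by (intro linear_continuous_on bounded_linear_drop_coord)

lemma borel_measurable_drop_coord[measurable]: "drop_coord k \<in> borel_measurable borel"
  by (intro borel_measurable_continuous_onI continuous_on_drop_coord)

interpretation lborel_product: product_sigma_finite "\<lambda>_. lborel :: real measure"
  by (rule product_sigma_finite.intro) (rule sigma_finite_lborel)

definition hyper_embed :: "'n \<Rightarrow> ('n \<Rightarrow> real) \<Rightarrow> real^'n" where
  "hyper_embed k y = (\<chi> i. if i = k then 0 else y i)"

lemma hyper_embed_measurable[measurable]:
  "hyper_embed k \<in> borel_measurable (\<Pi>\<^sub>M i\<in>UNIV - {k}. lborel)"
  unfolding hyper_embed_def[abs_def]
proof (rule borel_measurable_vec_lambda)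
  show "(\<lambda>y. if i = k then 0 else y i) \<in> borel_measurable (\<Pi>\<^sub>M i\<in>UNIV - {k}. lborel)" for i
    by (cases "i = k") (auto intro: measurable_component_singleton[THEN measurable_compose])
qed

lemma hyperplane_lborel_eq: "hyperplane_lborel k = distr (\<Pi>\<^sub>M i\<in>UNIV - {k}. lborel) borel (hyper_embed k)"
  by (simp add: hyperplane_lborel_def hyper_embed_def[abs_def])

lemma sets_hyperplane_lborel[simp, measurable_cong]: "sets (hyperplane_lborel k) = sets borel"
  and space_hyperplane_lborel[simp]: "space (hyperplane_lborel k) = UNIV"
  by (simp_all add: hyperplane_lborel_def)

lemma AE_hyperplane_lborel: "AE x in hyperplane_lborel k. x \<in> coord_hyperplane k"
  unfolding hyperplane_lborel_eq
proof (subst AE_distr_iff)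
  have "closed (coord_hyperplane k :: (real^'a) set)"
    unfolding coord_hyperplane_def by (intro closed_Collect_eq continuous_intros)
  then show "{x \<in> space borel. x \<in> coord_hyperplane k} \<in> sets borel" by simp
qed (auto simp: hyper_embed_def coord_hyperplane_def)

lemma vec_lambda_measurable:
  "(vec_lambda :: _ \<Rightarrow> real^'n) \<in> borel_measurable (\<Pi>\<^sub>M i\<in>UNIV. lborel)"
proof -
  have "(\<lambda>y. y i) \<in> borel_measurable (\<Pi>\<^sub>M i\<in>(UNIV::'n set). (lborel :: real measure))" for i
    by (rule measurable_component_singleton[THEN measurable_compose]) auto
  from borel_measurable_vec_lambda[where f = "\<lambda>y. y", OF this] show ?thesis by simp
qed

lemma lborel_vec_eq_PiM: "(lborel :: (real^'n) measure) = distr (\<Pi>\<^sub>M i\<in>UNIV. lborel) borel vec_lambda"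
proof (rule lborel_vec_eqI)
  have m: "(vec_lambda :: _ \<Rightarrow> real^'n) \<in> borel_measurable (\<Pi>\<^sub>M i\<in>UNIV. lborel)"
    by (rule vec_lambda_measurable)
  fix l u :: "real^'n" assume lu: "\<And>i. l $ i \<le> u $ i"
  have "vec_lambda -` box l u \<inter> space (\<Pi>\<^sub>M i\<in>UNIV. (lborel :: real measure)) = (\<Pi>\<^sub>E i\<in>UNIV. {l $ i <..< u $ i})"
    by (auto simp: mem_box_cart space_PiM PiE_iff)
  then have "emeasure (distr (\<Pi>\<^sub>M i\<in>UNIV. lborel) borel vec_lambda) (box l u)
      = (\<Prod>i\<in>UNIV. emeasure lborel {l $ i <..< u $ i})"
    using m by (simp add: emeasure_distr lborel_product.emeasure_PiM)
  then show "emeasure (distr (\<Pi>\<^sub>M i\<in>UNIV. lborel) borel vec_lambda) (box l u) = (\<Prod>i\<in>UNIV. u $ i - l $ i)"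
    using lu by (simp add: prod_ennreal)
qed simp

lemma nn_integral_lborel_hyperplane:
  fixes q :: "real^'n \<Rightarrow> ennreal"
  assumes q[measurable]: "q \<in> borel_measurable borel"
  shows "(\<integral>\<^sup>+x. q x \<partial>lborel) = (\<integral>\<^sup>+s. \<integral>\<^sup>+x. q (x + s *\<^sub>R axis k 1) \<partial>hyperplane_lborel k \<partial>lborel)"
proof -
  have m: "(vec_lambda :: _ \<Rightarrow> real^'n) \<in> borel_measurable (\<Pi>\<^sub>M i\<in>UNIV. lborel)"
    by (rule vec_lambda_measurable)
  have eq: "vec_lambda (y(k := s)) = hyper_embed k y + s *\<^sub>R axis k 1" for y :: "'n \<Rightarrow> real" and s
    by (auto simp: vec_eq_iff hyper_embed_def axis_def)
  have U: "insert k (UNIV - {k}) = (UNIV :: 'n set)" by auto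
  have "(\<integral>\<^sup>+x. q x \<partial>lborel) = (\<integral>\<^sup>+y. q (vec_lambda y) \<partial>(\<Pi>\<^sub>M i\<in>UNIV. lborel))"
    using m by (subst lborel_vec_eq_PiM, subst nn_integral_distr) auto
  also have "\<dots> = (\<integral>\<^sup>+s. \<integral>\<^sup>+y. q (vec_lambda (y(k := s))) \<partial>(\<Pi>\<^sub>M i\<in>UNIV - {k}. lborel) \<partial>lborel)"
    using lborel_product.product_nn_integral_insert_rev[of "UNIV - {k}" k "\<lambda>y. q (vec_lambda y)"] m
    by (simp add: U)
  also have "\<dots> = (\<integral>\<^sup>+s. \<integral>\<^sup>+x. q (x + s *\<^sub>R axis k 1) \<partial>hyperplane_lborel k \<partial>lborel)"
    unfolding hyperplane_lborel_eq eq by (subst nn_integral_distr) auto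
  finally show ?thesis .
qed

lemma hyperplane_lborel_cube:
  fixes m :: nat
  defines "A \<equiv> {x :: real^'n. \<forall>i. x $ i \<in> {- real m..real m}}"
  shows "A \<in> sets borel" "emeasure (hyperplane_lborel k) A < \<infinity>"
proof -
  have "closed A"
    unfolding A_def atLeastAtMost_iff
    by (intro closed_Collect_all closed_Collect_conj closed_Collect_le continuous_intros)
  then show meas: "A \<in> sets borel" by simp
  have "hyper_embed k -` A \<inter> space (\<Pi>\<^sub>M i\<in>UNIV - {k}. (lborel :: real measure))
      = (\<Pi>\<^sub>E i\<in>UNIV - {k}. {- real m..real m})"
  proof -
    have "hyper_embed k y \<in> A \<longleftrightarrow> (\<forall>i\<in>UNIV - {k}. y i \<in> {- real m..real m})" for y
    proof -
      have "hyper_embed k y \<in> A \<longleftrightarrow> (\<forall>i. (if i = k then 0 else y i) \<in> {- real m..real m})"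
        unfolding A_def hyper_embed_def by simp
      \<comment> \<open>The constraint on coordinate \<open>k\<close> holds automatically, since
        this coordinate is \<open>0\<close> on the hyperplane.\<close>
      moreover have "(0::real) \<in> {- real m..real m}" by simp
      ultimately show ?thesis by (metis DiffE DiffI UNIV_I singletonD singletonI)
    qed
    then show ?thesis
      by (simp add: set_eq_iff space_PiM PiE_iff del: atLeastAtMost_iff)
  qed
  then have "emeasure (hyperplane_lborel k) A = (\<Prod>i\<in>UNIV - {k}. emeasure lborel {- real m..real m})"
    using meas by (simp add: hyperplane_lborel_eq emeasure_distr lborel_product.emeasure_PiM)
  then show "emeasure (hyperplane_lborel k) A < \<infinity>"
    by (simp add: ennreal_power[symmetric] power_eq_top_ennreal less_top[symmetric])
qed

text \<open>Makes integrals over the hyperplane measurable in the level as a parameter.\<close>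

lemma sigma_finite_hyperplane_lborel: "sigma_finite_measure (hyperplane_lborel k)"
proof
  define A where "A m = {x :: real^'a. \<forall>i. x $ i \<in> {- real m..real m}}" for m
  have A: "A m \<in> sets borel" "emeasure (hyperplane_lborel k) (A m) \<noteq> \<infinity>" for m
    using hyperplane_lborel_cube(1)[of m] hyperplane_lborel_cube(2)[where k = k and m = m] by (auto simp: A_def less_top)
  have "\<exists>n. x \<in> A n" for x :: "real^'a"
  proof -
    obtain n where "norm x \<le> real n" using real_arch_simple by blast
    then have "\<bar>x $ i\<bar> \<le> real n" for i
      using component_le_norm_cart[of x i] by linarith
    then show ?thesis by (auto simp: A_def abs_le_iff minus_le_iff intro!: exI[of _ n])
  qed
  then have "(\<Union>n. A n) = UNIV" by auto
  then show "\<exists>A. countable A \<and> A \<subseteq> sets (hyperplane_lborel k) \<and> \<Union>A = space (hyperplane_lborel k) \<and>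
        (\<forall>a\<in>A. emeasure (hyperplane_lborel k) a \<noteq> \<infinity>)"
    using A by (intro exI[of _ "range A"]) auto
qed

text \<open>Thickening the hyperplane to a slab of height \<open>1\<close> turns an integral over it
  into a full-dimensional one, to which the change of variables formula applies.\<close>

lemma nn_integral_hyperplane_slab:
  fixes r :: "real^'n \<Rightarrow> ennreal"
  assumes [measurable]: "r \<in> borel_measurable borel"
  shows "(\<integral>\<^sup>+x. r x \<partial>hyperplane_lborel k) = (\<integral>\<^sup>+x. r (drop_coord k x) * indicator {x. 0 < x $ k \<and> x $ k < 1} x \<partial>lborel)"
proof -
  have "open {x :: real^'n. 0 < x $ k \<and> x $ k < 1}"
    by (intro open_Collect_conj open_Collect_less continuous_intros)
  then have [measurable]: "{x :: real^'n. 0 < x $ k \<and> x $ k < 1} \<in> sets borel" by simp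
  have "(\<integral>\<^sup>+x. r (drop_coord k x) * indicator {x. 0 < x $ k \<and> x $ k < 1} x \<partial>lborel)
    = (\<integral>\<^sup>+s. \<integral>\<^sup>+x. r (drop_coord k (x + s *\<^sub>R axis k 1)) * indicator {x. 0 < x $ k \<and> x $ k < 1} (x + s *\<^sub>R axis k 1)
        \<partial>hyperplane_lborel k \<partial>lborel)"
    by (rule nn_integral_lborel_hyperplane) measurable
  also have "\<dots> = (\<integral>\<^sup>+s. (\<integral>\<^sup>+x. r x \<partial>hyperplane_lborel k) * indicator {0<..<1::real} s \<partial>lborel)"
  proof (intro nn_integral_cong)
    fix s :: real
    have "(\<integral>\<^sup>+x. r (drop_coord k (x + s *\<^sub>R axis k 1)) * indicator {x. 0 < x $ k \<and> x $ k < 1} (x + s *\<^sub>R axis k 1)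
        \<partial>hyperplane_lborel k) = (\<integral>\<^sup>+x. r x * indicator {0<..<1::real} s \<partial>hyperplane_lborel k)"
      by (intro nn_integral_cong_AE eventually_mono[OF AE_hyperplane_lborel])
        (auto simp: drop_coord_add_axis drop_coord_id, auto simp: coord_hyperplane_def indicator_def)
    then show "(\<integral>\<^sup>+x. r (drop_coord k (x + s *\<^sub>R axis k 1)) * indicator {x. 0 < x $ k \<and> x $ k < 1} (x + s *\<^sub>R axis k 1)
        \<partial>hyperplane_lborel k) = (\<integral>\<^sup>+x. r x \<partial>hyperplane_lborel k) * indicator {0<..<1::real} s"
      by (simp add: nn_integral_multc)
  qed
  also have "\<dots> = (\<integral>\<^sup>+x. r x \<partial>hyperplane_lborel k)"
    by (simp add: nn_integral_cmult)
  finally show ?thesis by simp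
qed

subsection \<open>Determinants\<close>

text \<open>The matrix is the identity with row \<open>k\<close> replaced by \<open>a\<close>. For a
  gradient \<open>a\<close> this is the Jacobian of \<open>flatten\<close>.\<close>

lemma det_replace_row:
  fixes a :: "real^'n"
  shows "det (matrix (\<lambda>w. drop_coord k w + (a \<bullet> w) *\<^sub>R axis k 1)) = a $ k"
proof -
  have "matrix (\<lambda>w. drop_coord k w + (a \<bullet> w) *\<^sub>R axis k 1)
     = (\<chi> i. if i = k then (\<Sum>i\<in>UNIV. a $ i *s row i (mat 1 :: real^'n^'n)) else row i (mat 1))"
    by (auto simp: matrix_def vec_eq_iff drop_coord_nth axis_def inner_axis row_def mat_def
        if_distrib[of "\<lambda>x. _ * x"] cong: if_cong)
      (auto simp: inner_vec_def sum.delta if_distrib cong: if_cong)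
  then show ?thesis
    using cramer_lemma_transpose[of k a "mat 1 :: real^'n^'n"] by simp
qed

text \<open>With the unit normal as column \<open>k\<close> of a square matrix \<open>B\<close>, the
  product of the transpose of \<open>B\<close> with \<open>B\<close> is the Gram matrix whose row
  and column \<open>k\<close> are those of the identity. Area thus becomes an ordinary
  determinant.\<close>

lemma sqrt_det_gram:
  fixes v :: "'n \<Rightarrow> real^'n"
  assumes "\<nu> \<bullet> \<nu> = 1" "\<And>i. i \<noteq> k \<Longrightarrow> \<nu> \<bullet> v i = 0"
  shows "sqrt (det (\<chi> i j. if i = k \<or> j = k then (if i = j then 1 else 0) else v i \<bullet> v j))
     = \<bar>det (\<chi> r c. (if c = k then \<nu> else v c) $ r)\<bar>"
proof -
  define B where "B = (\<chi> r c. (if c = k then \<nu> else v c) $ r)"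
  have "(\<chi> i j. if i = k \<or> j = k then (if i = j then 1 else 0) else v i \<bullet> v j) = transpose B ** B"
    using assms unfolding B_def matrix_matrix_mult_def transpose_def
    by (auto simp: vec_eq_iff inner_vec_def mult.commute)
  then show ?thesis
    by (simp add: det_mul det_transpose B_def[symmetric] flip: power2_eq_square)
qed

text \<open>Cramer's rule replaces the unit normal by the \<open>k\<close>-th basis vector, and a shear then projects the
  tangent vectors without changing the determinant.\<close>

lemma det_projected_frame:
  fixes v :: "'n \<Rightarrow> real^'n"
  assumes \<nu>: "\<nu> \<bullet> \<nu> = 1" "\<And>i. i \<noteq> k1 \<Longrightarrow> \<nu> \<bullet> v i = 0"
    and k: "\<nu> $ k \<noteq> 0"
    and indep: "\<And>c. c $ k1 = 0 \<Longrightarrow> (\<Sum>i\<in>UNIV - {k1}. c $ i *\<^sub>R v i) = 0 \<Longrightarrow> c = (0::real^'n)"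
  shows "det (\<chi> r c. (if c = k1 then axis k 1 else drop_coord k (v c)) $ r)
     = \<nu> $ k * det (\<chi> r c. (if c = k1 then \<nu> else v c) $ r)"
proof -
  define B where "B = (\<chi> r c. (if c = k1 then \<nu> else v c) $ r)"
  define N where "N = (\<chi> r c. (if c = k1 then axis k 1 else v c) $ r)"
  define P where "P w = drop_coord k w + (((1 / \<nu> $ k) *\<^sub>R \<nu>) \<bullet> w) *\<^sub>R axis k 1" for w :: "real^'n"
  have linP: "linear P"
    unfolding P_def linear_conv_bounded_linear
    by (intro bounded_linear_add bounded_linear_drop_coord bounded_linear_scaleR_const
        bounded_linear_inner_right)
  have mul: "B *v c = c $ k1 *\<^sub>R \<nu> + (\<Sum>i\<in>UNIV - {k1}. c $ i *\<^sub>R v i)" for c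
  proof -
    have "B *v c = (\<Sum>i\<in>UNIV. c $ i *\<^sub>R (if i = k1 then \<nu> else v i))"
      by (auto simp: vec_eq_iff matrix_vector_mult_def B_def mult.commute)
    also have "\<dots> = c $ k1 *\<^sub>R \<nu> + (\<Sum>i\<in>UNIV - {k1}. c $ i *\<^sub>R (if i = k1 then \<nu> else v i))"
      by (subst sum.remove[of _ k1]) auto
    finally show ?thesis by simp
  qed
  have inner: "\<nu> \<bullet> (B *v c) = c $ k1" for c
    unfolding mul by (simp add: inner_add_right inner_sum_right \<nu>)
  have "c = 0" if "B *v c = 0" for c
  proof -
    have "c $ k1 = 0" using inner[of c] that by simp
    then show ?thesis using indep[of c] that mul[of c] by simp
  qed
  then have "invertible B"
    by (simp add: invertible_left_inverse matrix_left_invertible_ker)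
  then obtain C where C: "B ** C = mat 1"
    unfolding invertible_def by auto
  \<comment> \<open>The coordinates of \<open>axis k 1\<close> in the frame \<open>B\<close>.
    Pairing with \<open>\<nu>\<close> gives coordinate \<open>k1\<close>, the only one that Cramer's
    rule asks for.\<close>
  define x where "x = C *v axis k 1"
  have Bx: "B *v x = axis k 1"
    unfolding x_def by (simp add: matrix_vector_mul_assoc C)
  have xk: "x $ k1 = \<nu> $ k"
    using inner[of x] by (simp add: Bx inner_axis)
  have "N = (\<chi> i j. if j = k1 then (B *v x) $ i else B $ i $ j)"
    unfolding Bx by (auto simp: vec_eq_iff N_def B_def)
  then have detN: "det N = \<nu> $ k * det B"
    using cramer_lemma[of k1 B x] by (simp add: xk)
  have detP: "det (matrix P) = 1"
    unfolding P_def[abs_def] using det_replace_row[of k "(1 / \<nu> $ k) *\<^sub>R \<nu>"] k by simp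
  have "\<nu> \<bullet> axis k 1 = \<nu> $ k"
    by (simp add: inner_axis)
  then have "P (axis k 1) = axis k 1"
    using k by (auto simp: P_def vec_eq_iff drop_coord_nth axis_def)
  moreover have "P (v c) = drop_coord k (v c)" if "c \<noteq> k1" for c
    using \<nu>(2)[OF that] by (simp add: P_def)
  moreover have "matrix P ** N = (\<chi> r c. P (\<chi> i. N $ i $ c) $ r)"
    by (simp add: matrix_works[OF linP[folded linear_matrix_vector_mul_eq], symmetric] vec_eq_iff matrix_matrix_mult_def matrix_vector_mult_def)
  ultimately have "matrix P ** N = (\<chi> r c. (if c = k1 then axis k 1 else drop_coord k (v c)) $ r)"
    by (auto simp: vec_eq_iff N_def)
  then show ?thesis
    using detN detP by (metis B_def det_mul mult_1)
qed

subsection \<open>Charts straightening the level sets\<close>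

abbreviation grad :: "(real^'n \<Rightarrow> real) \<Rightarrow> real^'n \<Rightarrow> real^'n" where
  "grad g x \<equiv> gradient_within UNIV g x"

lemma has_derivative_eq_inner_gradient:
  fixes g :: "real^'n \<Rightarrow> real"
  assumes "(g has_derivative g') (at x within S)" "frechet_derivative g (at x within S) = g'"
  shows "g' v = gradient_within S g x \<bullet> v"
proof -
  have lin: "linear g'"
    using assms(1) by (rule has_derivative_linear)
  have "g' v = g' (\<Sum>i\<in>UNIV. v $ i *\<^sub>R axis i 1)"
    by (simp add: basis_expansion flip: scalar_mult_eq_scaleR)
  also have "\<dots> = gradient_within S g x \<bullet> v"
    by (simp add: linear_sum[OF lin] linear_scale[OF lin] gradient_within_def inner_vec_def assms(2) mult.commute)
  finally show ?thesis .
qed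

lemma frechet_derivative_eq_inner_grad:
  "g differentiable (at x) \<Longrightarrow> frechet_derivative g (at x) v = grad g x \<bullet> v"
  by (rule has_derivative_eq_inner_gradient) (simp_all add: frechet_derivative_works[symmetric])

lemma has_derivative_grad:
  "g differentiable (at x) \<Longrightarrow> (g has_derivative (\<lambda>v. grad g x \<bullet> v)) (at x)"
proof -
  assume d: "g differentiable (at x)"
  have "frechet_derivative g (at x) = (\<lambda>v. grad g x \<bullet> v)"
    by (rule ext) (rule frechet_derivative_eq_inner_grad[OF d])
  then show ?thesis using d unfolding frechet_derivative_works by simp
qed

lemma grad_eqI:
  assumes "(g has_derivative (\<lambda>v. a \<bullet> v)) (at x)"
  shows "grad g x = a"
  using frechet_derivative_eqI[OF assms] by (simp add: gradient_within_def vec_eq_iff inner_axis)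

lemma continuous_on_grad:
  assumes "smooth_on g U"
  shows "continuous_on U (grad g)"
proof -
  have "continuous_on U (\<lambda>x. \<chi> i. frechet_derivative g (at x) (axis i 1))"
    by (intro continuous_intros smooth_on_imp_continuous_on smooth_on_frechet_derivative assms)
  then show ?thesis by (simp add: gradient_within_def[abs_def])
qed

lemma borel_measurable_norm_grad:
  assumes "open U" "smooth_on g U"
  shows "(\<lambda>x. ennreal (norm (grad g x)) * indicator U x) \<in> borel_measurable borel"
proof -
  have [measurable]: "(\<lambda>x. indicator U x *\<^sub>R grad g x) \<in> borel_measurable borel"
    using assms(1) by (intro borel_measurable_continuous_on_indicator continuous_on_grad[OF assms(2)]) auto
  have "(\<lambda>x. ennreal (norm (indicator U x *\<^sub>R grad g x))) \<in> borel_measurable borel"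
    by measurable
  then show ?thesis
    by (rule back_subst[of "\<lambda>f. f \<in> _"]) (auto simp: indicator_def fun_eq_iff)
qed

lemma grad_along_line:
  assumes "g differentiable (at x)"
  shows "((\<lambda>t. g (x + t *\<^sub>R v)) has_real_derivative (grad g x \<bullet> v)) (at 0)"
proof -
  have line: "((\<lambda>t. x + t *\<^sub>R v) has_derivative (\<lambda>t. t *\<^sub>R v)) (at 0)"
    by (auto intro!: derivative_eq_intros)
  have "(g has_derivative (\<lambda>w. grad g x \<bullet> w)) (at (x + 0 *\<^sub>R v))"
    using has_derivative_grad[OF assms] by simp
  from has_derivative_compose[OF line this] show ?thesis
    by (simp add: has_field_derivative_def mult.commute[of _ "grad g x \<bullet> v"] fun_eq_iff)
qed

definition flatten :: "'n \<Rightarrow> (real^'n \<Rightarrow> real) \<Rightarrow> real^'n \<Rightarrow> real^'n" where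
  "flatten k g x = drop_coord k x + g x *\<^sub>R axis k 1"

text \<open>\<open>flatten k g\<close> straightens the levels: the part of \<open>{g = s}\<close> in
  \<open>B\<close> goes to the hyperplane at height \<open>s\<close> in direction \<open>k\<close>.
  Injectivity on all of \<open>B\<close> is demanded because the derivative condition yields it only
  locally.\<close>

definition level_chart :: "(real^'n \<Rightarrow> real) \<Rightarrow> 'n \<Rightarrow> (real^'n) set \<Rightarrow> bool" where
  "level_chart g k B \<longleftrightarrow> open B \<and> smooth_on g B \<and> (\<forall>x\<in>B. grad g x $ k \<noteq> 0) \<and> inj_on (flatten k g) B"

abbreviation unflatten :: "'n \<Rightarrow> (real^'n \<Rightarrow> real) \<Rightarrow> (real^'n) set \<Rightarrow> real^'n \<Rightarrow> real^'n" where
  "unflatten k g B \<equiv> inv_into B (flatten k g)"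

lemma flatten_has_derivative:
  assumes "g differentiable (at x)"
  shows "(flatten k g has_derivative (\<lambda>w. drop_coord k w + (grad g x \<bullet> w) *\<^sub>R axis k 1)) (at x)"
  unfolding flatten_def[abs_def]
  by (intro has_derivative_add has_derivative_scaleR_left bounded_linear_imp_has_derivative
      bounded_linear_drop_coord has_derivative_grad assms)

lemma level_chart_exists:
  assumes Q: "open Q" "smooth_on g Q" and p: "p \<in> Q" "grad g p \<noteq> 0"
  shows "\<exists>k r. r > 0 \<and> ball p r \<subseteq> Q \<and> level_chart g k (ball p r)"
proof -
  obtain k where k: "grad g p $ k \<noteq> 0"
    using p(2) by (auto simp: vec_eq_iff)
  define Q' where "Q' = Q \<inter> {x. grad g x $ k \<noteq> 0}"
  have contgrad: "continuous_on Q (\<lambda>x. grad g x $ k)"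
    by (intro continuous_intros continuous_on_grad Q)
  have openO': "open Q'"
  proof -
    have "open (Q \<inter> (\<lambda>x. grad g x $ k) -` (- {0}))"
      by (rule continuous_open_preimage[OF contgrad Q(1)]) auto
    then show ?thesis by (simp add: Q'_def vimage_def Collect_neg_eq[symmetric] Compl_eq)
  qed
  define D where "D x w = drop_coord k w + (grad g x \<bullet> w) *\<^sub>R axis k (1::real)" for x w
  \<comment> \<open>The inverse of \<open>D p\<close>, found by solving the equation in coordinate
    \<open>k\<close> for \<open>w $ k\<close>.\<close>
  define E where "E w = drop_coord k w + ((w $ k - grad g p \<bullet> drop_coord k w) / grad g p $ k) *\<^sub>R axis k 1" for w
  have blE: "bounded_linear E"
    unfolding E_def
    by (intro bounded_linear_add bounded_linear_drop_coord bounded_linear_scaleR_const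
        bounded_linear_divide[THEN bounded_linear_compose] bounded_linear_sub bounded_linear_vec_nth
        bounded_linear_inner_right[THEN bounded_linear_compose])
  have ED: "E \<circ> D p = id"
  proof
    fix w
    have "grad g p \<bullet> w = grad g p \<bullet> drop_coord k w + w $ k * grad g p $ k"
      by (subst drop_coord_decomp[of k w, symmetric]) (simp add: inner_add_right inner_axis drop_coord_drop_coord drop_coord_nth)
    then have "(grad g p \<bullet> w - grad g p \<bullet> drop_coord k w) / grad g p $ k = w $ k"
      using k by simp
    moreover have "drop_coord k (D p w) = drop_coord k w" "D p w $ k = grad g p \<bullet> w"
      by (simp_all add: D_def drop_coord_add_axis drop_coord_drop_coord drop_coord_nth)
    ultimately show "(E \<circ> D p) w = id w"
      by (simp add: E_def drop_coord_decomp)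
  qed
  have derD: "(flatten k g has_derivative D x) (at x)" if "x \<in> Q'" for x
    unfolding D_def using that Q by (intro flatten_has_derivative) (auto simp: Q'_def intro: smooth_on_differentiable)
  have on: "\<exists>d>0. \<forall>x. dist p x < d \<longrightarrow> onorm (\<lambda>v. D x v - D p v) < e" if e: "e > 0" for e
  proof -
    have "isCont (grad g) p"
      using continuous_on_grad[OF Q(2)] Q(1) p(1) by (simp add: continuous_on_eq_continuous_at)
    then obtain d where d: "d > 0" "\<And>x. dist p x < d \<Longrightarrow> norm (grad g x - grad g p) < e"
      using e unfolding continuous_at_eps_delta by (metis dist_commute dist_norm)
    \<comment> \<open>The two derivatives differ only in row \<open>k\<close>, hence by a map of
      rank at most one whose norm is controlled by the gradients.\<close>
    have "onorm (\<lambda>v. D x v - D p v) \<le> norm (grad g x - grad g p)" for x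
    proof (rule onorm_le)
      fix v
      have "D x v - D p v = ((grad g x - grad g p) \<bullet> v) *\<^sub>R axis k 1"
        by (simp add: D_def algebra_simps inner_diff_left)
      then show "norm (D x v - D p v) \<le> norm (grad g x - grad g p) * norm v"
        by (simp add: Cauchy_Schwarz_ineq2)
    qed
    then show ?thesis using d by (meson le_less_trans)
  qed
  have "p \<in> Q'" using p k by (simp add: Q'_def)
  from has_derivative_locally_injective[OF this openO' blE ED derD on]
  obtain r where r: "r > 0" "ball p r \<subseteq> Q'" "inj_on (flatten k g) (ball p r)"
    by blast
  then have "level_chart g k (ball p r)"
    using Q(2) by (auto simp: level_chart_def Q'_def intro: smooth_on_subset)
  then show ?thesis using r by (auto simp: Q'_def)
qed

context
  fixes g :: "real^'n \<Rightarrow> real" and k :: 'n and B :: "(real^'n) set"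
  assumes chart: "level_chart g k B"
begin

lemma chart_open: "open B" and chart_smooth: "smooth_on g B"
  and chart_grad: "x \<in> B \<Longrightarrow> grad g x $ k \<noteq> 0" and chart_inj: "inj_on (flatten k g) B"
  using chart by (auto simp: level_chart_def)

lemma chart_flatten_has_derivative:
  "x \<in> B \<Longrightarrow> (flatten k g has_derivative (\<lambda>w. drop_coord k w + (grad g x \<bullet> w) *\<^sub>R axis k 1)) (at x)"
  by (intro flatten_has_derivative smooth_on_differentiable[OF chart_smooth])

lemma chart_open_image: "open (flatten k g ` B)"
  by (intro invariance_of_domain chart_open chart_inj continuous_at_imp_continuous_on ballI
      has_derivative_continuous[OF chart_flatten_has_derivative])

lemma unflatten_flatten: "x \<in> B \<Longrightarrow> unflatten k g B (flatten k g x) = x"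
  using chart_inj by simp

lemma unflatten_mem: "y \<in> flatten k g ` B \<Longrightarrow> unflatten k g B y \<in> B"
  by (rule inv_into_into)

lemma flatten_unflatten: "y \<in> flatten k g ` B \<Longrightarrow> flatten k g (unflatten k g B y) = y"
  by (rule f_inv_into_f)

lemma g_unflatten: "y \<in> flatten k g ` B \<Longrightarrow> g (unflatten k g B y) = y $ k"
  using arg_cong[OF flatten_unflatten, of y "\<lambda>z. z $ k"] by (simp add: flatten_def drop_coord_nth)

lemma drop_unflatten: "y \<in> flatten k g ` B \<Longrightarrow> drop_coord k (unflatten k g B y) = drop_coord k y"
  using arg_cong[OF flatten_unflatten, of y "drop_coord k"]
  by (simp add: flatten_def drop_coord_add_axis drop_coord_drop_coord)

text \<open>Solving the \<open>k\<close>-th equation of the linearised chart gives the formula. It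
  is phrased by \<open>frechet_derivative\<close>, a factor \<open>-1\<close> and an
  \<open>inverse\<close>, so that the closure rules for \<open>C_k_on\<close> apply to it
  literally.\<close>

lemma unflatten_has_derivative:
  assumes y: "y \<in> flatten k g ` B"
  defines "x \<equiv> unflatten k g B y"
  shows "(unflatten k g B has_derivative
     (\<lambda>w. drop_coord k w + ((w $ k + (-1) * frechet_derivative g (at x) (drop_coord k w))
        * inverse (frechet_derivative g (at x) (axis k 1))) *\<^sub>R axis k 1)) (at y)"
    (is "(_ has_derivative ?D) _")
proof -
  have x: "x \<in> B" unfolding x_def using y by (rule unflatten_mem)
  have diff: "g differentiable (at x)" by (rule smooth_on_differentiable[OF chart_smooth x])
  have fd: "frechet_derivative g (at x) v = grad g x \<bullet> v" for v
    by (rule frechet_derivative_eq_inner_grad[OF diff])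
  have gk: "grad g x \<bullet> axis k 1 = grad g x $ k" by (simp add: inner_axis)
  have id: "(\<lambda>w. drop_coord k w + (grad g x \<bullet> w) *\<^sub>R axis k 1) \<circ> ?D = id"
  proof
    fix w
    have "drop_coord k (?D w) = drop_coord k w"
      by (simp add: drop_coord_add_axis drop_coord_drop_coord)
    moreover have "grad g x \<bullet> ?D w = w $ k"
      using chart_grad[OF x] unfolding fd gk inner_add_right inner_scaleR_right by (simp add: field_simps)
    ultimately show "((\<lambda>w. drop_coord k w + (grad g x \<bullet> w) *\<^sub>R axis k 1) \<circ> ?D) w = id w"
      by (simp add: drop_coord_decomp)
  qed
  have "(unflatten k g B has_derivative ?D) (at (flatten k g x))"
    by (rule has_derivative_inverse_strong[OF chart_open x _ unflatten_flatten
          chart_flatten_has_derivative[OF x] id])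
      (auto intro!: continuous_at_imp_continuous_on has_derivative_continuous[OF chart_flatten_has_derivative])
  then show ?thesis
    unfolding x_def flatten_unflatten[OF y] by simp
qed

text \<open>Bootstrapping: the derivative of the inverse is a smooth expression in the inverse
  itself, so each order of smoothness yields the next.\<close>

lemma smooth_on_unflatten: "smooth_on (unflatten k g B) (flatten k g ` B)"
proof -
  let ?V = "flatten k g ` B"
  have "C_k_on m (unflatten k g B) ?V" for m
  proof (induction m)
    case 0
    then show ?case
      by (auto intro!: continuous_at_imp_continuous_on has_derivative_continuous[OF unflatten_has_derivative])
  next
    case (Suc m)
    have comp: "C_k_on m (\<lambda>y. frechet_derivative g (at (unflatten k g B y)) v) ?V" for v
      by (rule C_k_on_compose[OF chart_open_image chart_open _ _ Suc])
        (use smooth_on_frechet_derivative[OF chart_smooth] in \<open>auto simp: smooth_on_def intro: unflatten_mem\<close>)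
    have nz: "frechet_derivative g (at (unflatten k g B y)) (axis k 1) \<noteq> 0" if "y \<in> ?V" for y
      using chart_grad[OF unflatten_mem[OF that]] by (simp add: gradient_within_def)
    show ?case
      by (rule C_k_on_SucI[OF chart_open_image unflatten_has_derivative], assumption,
          intro C_k_on_add C_k_on_bilinear[OF bounded_bilinear_scaleR]
          C_k_on_bilinear[OF bounded_bilinear_mult] C_k_on_inverse C_k_on_const comp chart_open_image nz)
  qed
  then show ?thesis by (simp add: smooth_on_def)
qed

lemma continuous_on_unflatten: "continuous_on (flatten k g ` B) (unflatten k g B)"
  by (rule smooth_on_imp_continuous_on[OF smooth_on_unflatten])

text \<open>The level set \<open>{g = s}\<close> is a graph over the \<open>k\<close>-th coordinate hyperplane with area density
  \<open>|\<nabla>g| / |\<partial>\<^sub>k g|\<close>. \<open>slice_integrand u y\<close> is \<open>u\<close> times this density at the point of the level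
  \<open>s = y\<^sub>k\<close> above the remaining coordinates of \<open>y\<close>.\<close>

definition slice_integrand :: "(real^'n \<Rightarrow> ennreal) \<Rightarrow> real^'n \<Rightarrow> ennreal" where
  "slice_integrand u y = (if y \<in> flatten k g ` B then
     u (unflatten k g B y) * ennreal (norm (grad g (unflatten k g B y)) / \<bar>grad g (unflatten k g B y) $ k\<bar>) else 0)"

lemma slice_integrand_measurable[measurable]:
  assumes [measurable]: "u \<in> borel_measurable borel"
  shows "slice_integrand u \<in> borel_measurable borel"
proof -
  let ?V = "flatten k g ` B"
  have 1[measurable]: "(\<lambda>y. indicator ?V y *\<^sub>R unflatten k g B y) \<in> borel_measurable borel"
    using chart_open_image by (intro borel_measurable_continuous_on_indicator continuous_on_unflatten) auto
  have "continuous_on ?V (\<lambda>y. norm (grad g (unflatten k g B y)) / \<bar>grad g (unflatten k g B y) $ k\<bar>)"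
    using chart_grad[OF unflatten_mem]
    by (intro continuous_intros continuous_on_compose2[OF continuous_on_grad[OF chart_smooth] continuous_on_unflatten])
      (auto intro: unflatten_mem)
  then have 2[measurable]: "(\<lambda>y. indicator ?V y *\<^sub>R (norm (grad g (unflatten k g B y)) / \<bar>grad g (unflatten k g B y) $ k\<bar>))
      \<in> borel_measurable borel"
    using chart_open_image by (intro borel_measurable_continuous_on_indicator) auto
  have [measurable]: "?V \<in> sets borel" using chart_open_image by simp
  have "(\<lambda>y. u (indicator ?V y *\<^sub>R unflatten k g B y) *
      ennreal (indicator ?V y *\<^sub>R (norm (grad g (unflatten k g B y)) / \<bar>grad g (unflatten k g B y) $ k\<bar>)))
      \<in> borel_measurable borel"
    by measurable
  then show ?thesis
    by (rule back_subst[of "\<lambda>f. f \<in> _"]) (auto simp: slice_integrand_def fun_eq_iff indicator_def)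
qed

text \<open>The coarea formula in a single chart: the Jacobian of \<open>flatten\<close> cancels the
  denominator of the area density and leaves the norm of the gradient.\<close>

lemma nn_integral_slice_integrand:
  assumes [measurable]: "u \<in> borel_measurable borel"
  shows "(\<integral>\<^sup>+s. \<integral>\<^sup>+x. slice_integrand u (x + s *\<^sub>R axis k 1) \<partial>hyperplane_lborel k \<partial>lborel)
    = (\<integral>\<^sup>+x\<in>B. u x * ennreal (norm (grad g x)) \<partial>lborel)"
proof -
  let ?V = "flatten k g ` B"
  have det: "det (matrix (\<lambda>w. drop_coord k w + (grad g x \<bullet> w) *\<^sub>R axis k 1)) = grad g x $ k" for x
    by (rule det_replace_row)
  have "(\<integral>\<^sup>+s. \<integral>\<^sup>+x. slice_integrand u (x + s *\<^sub>R axis k 1) \<partial>hyperplane_lborel k \<partial>lborel)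
     = (\<integral>\<^sup>+y. slice_integrand u y \<partial>lborel)"
    by (rule nn_integral_lborel_hyperplane[symmetric]) simp
  also have "\<dots> = (\<integral>\<^sup>+y\<in>?V. slice_integrand u y \<partial>lborel)"
    by (intro nn_integral_cong) (auto simp: slice_integrand_def indicator_def)
  also have "\<dots> = (\<integral>\<^sup>+x\<in>B. ennreal \<bar>grad g x $ k\<bar> * slice_integrand u (flatten k g x) \<partial>lborel)"
    unfolding det[symmetric]
    by (rule nn_integral_change_of_variables[OF chart_open chart_flatten_has_derivative chart_inj])
      (auto simp: det intro!: continuous_intros continuous_on_grad[OF chart_smooth])
  also have "\<dots> = (\<integral>\<^sup>+x\<in>B. u x * ennreal (norm (grad g x)) \<partial>lborel)"
  proof (intro nn_integral_cong)
    fix x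
    show "ennreal \<bar>grad g x $ k\<bar> * slice_integrand u (flatten k g x) * indicator B x =
       u x * ennreal (norm (grad g x)) * indicator B x"
    proof (cases "x \<in> B")
      case True
      have "ennreal \<bar>grad g x $ k\<bar> * ennreal (norm (grad g x) / \<bar>grad g x $ k\<bar>) = ennreal (norm (grad g x))"
        using chart_grad[OF True] by (simp add: ennreal_mult'[symmetric])
      then show ?thesis
        using True by (simp add: slice_integrand_def unflatten_flatten) (metis mult.commute mult.assoc)
    qed auto
  qed
  finally show ?thesis .
qed

text \<open>The level set is a graph, and \<open>drop_coord k\<close> inverts its parametrization.
  This gives the homeomorphism and, after differentiation, the injectivity of the derivative on the
  hyperplane.\<close>

lemma local_parametrization_level_set:
  fixes s :: real
  assumes sub: "B \<subseteq> Q"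
  defines "W \<equiv> {x. drop_coord k x + s *\<^sub>R axis k 1 \<in> flatten k g ` B}"
  defines "\<psi> \<equiv> (\<lambda>x. unflatten k g B (drop_coord k x + s *\<^sub>R axis k 1))"
  shows "local_parametrization {x\<in>Q. g x = s} k W \<psi>"
    and "\<psi> ` (W \<inter> coord_hyperplane k) = B \<inter> {x\<in>Q. g x = s}"
proof -
  let ?a = "\<lambda>x :: real^'n. drop_coord k x + s *\<^sub>R axis k 1"
  let ?\<Sigma> = "{x\<in>Q. g x = s}"
  have conta: "continuous_on UNIV ?a" by (intro continuous_intros continuous_on_drop_coord)
  have openW: "open W"
    unfolding W_def using conta chart_open_image
    by (simp add: continuous_on_open_vimage[OF open_UNIV] vimage_def)
  have smooth: "smooth_on \<psi> W"
    unfolding \<psi>_def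
    by (rule smooth_on_compose[OF openW chart_open_image _ smooth_on_unflatten
          smooth_on_add[OF openW smooth_on_bounded_linear[OF bounded_linear_drop_coord] smooth_on_const]])
      (auto simp: W_def)
  have dropW: "drop_coord k (\<psi> x) = drop_coord k x" if "x \<in> W" for x
    using that by (simp add: \<psi>_def W_def drop_unflatten drop_coord_add_axis drop_coord_drop_coord)
  have gW: "g (\<psi> x) = s" "\<psi> x \<in> B" if "x \<in> W" for x
    using that by (simp_all add: \<psi>_def W_def g_unflatten unflatten_mem drop_coord_nth)
  have inv: "drop_coord k x \<in> W" "\<psi> (drop_coord k x) = x" if "x \<in> B" "g x = s" for x
  proof -
    have "?a (drop_coord k x) = flatten k g x"
      using that by (simp add: flatten_def drop_coord_drop_coord)
    then show "drop_coord k x \<in> W" "\<psi> (drop_coord k x) = x"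
      using that by (auto simp: W_def \<psi>_def unflatten_flatten)
  qed
  have img: "\<psi> ` (W \<inter> coord_hyperplane k) = B \<inter> ?\<Sigma>"
  proof
    show "\<psi> ` (W \<inter> coord_hyperplane k) \<subseteq> B \<inter> ?\<Sigma>" using gW sub by auto
    show "B \<inter> ?\<Sigma> \<subseteq> \<psi> ` (W \<inter> coord_hyperplane k)"
    proof
      fix p assume "p \<in> B \<inter> ?\<Sigma>"
      then have "drop_coord k p \<in> W \<inter> coord_hyperplane k" "p = \<psi> (drop_coord k p)"
        using inv[of p] drop_coord_mem by auto
      then show "p \<in> \<psi> ` (W \<inter> coord_hyperplane k)" by blast
    qed
  qed
  then show "\<psi> ` (W \<inter> coord_hyperplane k) = B \<inter> ?\<Sigma>" .
  have hom: "homeomorphism (W \<inter> coord_hyperplane k) (B \<inter> ?\<Sigma>) \<psi> (drop_coord k)"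
  proof (rule homeomorphismI)
    show "continuous_on (W \<inter> coord_hyperplane k) \<psi>"
      by (rule continuous_on_subset[OF smooth_on_imp_continuous_on[OF smooth]]) auto
    show "continuous_on (B \<inter> ?\<Sigma>) (drop_coord k)" by (rule continuous_on_drop_coord)
  qed (use img inv drop_coord_mem dropW drop_coord_id in auto)
  have "inj_on (frechet_derivative \<psi> (at x)) (coord_hyperplane k)" if x: "x \<in> W" for x
  proof -
    let ?D = "frechet_derivative \<psi> (at x)"
    have "(\<psi> has_derivative ?D) (at x)" by (rule smooth_on_has_derivative[OF smooth x])
    from bounded_linear.has_derivative[OF bounded_linear_drop_coord this]
    have "((\<lambda>x. drop_coord k (\<psi> x)) has_derivative (\<lambda>v. drop_coord k (?D v))) (at x)" .
    \<comment> \<open>\<open>\<psi>\<close> ignores coordinate \<open>k\<close>, so the identity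
      \<open>dropW\<close> holds on the open set \<open>W\<close> and not only on the hyperplane; it
      may therefore be differentiated.\<close>
    then have "(drop_coord k has_derivative (\<lambda>v. drop_coord k (?D v))) (at x)"
      by (rule has_derivative_transform_within_open[OF _ openW x]) (rule dropW)
    then have "(\<lambda>v. drop_coord k (?D v)) = drop_coord k"
      using bounded_linear_imp_has_derivative[OF bounded_linear_drop_coord] has_derivative_unique by blast
    then have "drop_coord k (?D v) = v" if "v \<in> coord_hyperplane k" for v
      using that by (metis drop_coord_id)
    then show ?thesis by (metis inj_onI)
  qed
  then show "local_parametrization ?\<Sigma> k W \<psi>"
    unfolding local_parametrization_def using openW smooth hom chart_open by blast
qed

end

abbreviation slice_integral :: "(real^'n \<Rightarrow> real) \<Rightarrow> 'n \<Rightarrow> (real^'n) set \<Rightarrow> (real^'n \<Rightarrow> ennreal) \<Rightarrow> real \<Rightarrow> ennreal" where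
  "slice_integral g k B u s \<equiv> \<integral>\<^sup>+x. slice_integrand g k B u (x + s *\<^sub>R axis k 1) \<partial>hyperplane_lborel k"

subsection \<open>The surface measure of a level set\<close>

lemma continuous_on_volume_density:
  assumes "smooth_on \<psi> W"
  shows "continuous_on W (volume_density k \<psi>)"
proof -
  have "continuous_on W (\<lambda>x. (if i = k \<or> j = k then (if i = j then 1 else 0)
     else frechet_derivative \<psi> (at x) (axis i 1) \<bullet> frechet_derivative \<psi> (at x) (axis j 1)) :: real)" for i j
    by (cases "i = k \<or> j = k")
      (auto intro!: continuous_on_inner smooth_on_imp_continuous_on[OF smooth_on_frechet_derivative[OF assms]])
  then show ?thesis
    unfolding volume_density_def[abs_def] det_def by (auto intro!: continuous_intros)
qed

text \<open>\<open>g\<close> is constant along \<open>\<psi>\<close> on lines inside the hyperplane.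
  Off the hyperplane \<open>\<psi>\<close> may leave the level set, hence the restriction on
  \<open>v\<close>.\<close>

lemma tangent_orthogonal_grad:
  fixes g :: "real^'n \<Rightarrow> real"
  assumes par: "local_parametrization {x\<in>Q. g x = s} k W \<psi>"
    and x: "x \<in> W" "x \<in> coord_hyperplane k" and diff: "g differentiable (at (\<psi> x))"
    and v: "v \<in> coord_hyperplane k"
  shows "grad g (\<psi> x) \<bullet> frechet_derivative \<psi> (at x) v = 0"
proof -
  have W: "open W" "smooth_on \<psi> W" using par by (auto simp: local_parametrization_def)
  have lev: "g (\<psi> y) = s" if "y \<in> W \<inter> coord_hyperplane k" for y
    using par that unfolding local_parametrization_def homeomorphism_def by blast
  define U where "U = (\<lambda>t::real. x + t *\<^sub>R v) -` W"
  have openU: "open U" unfolding U_def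
    using W(1) by (intro continuous_open_vimage) (auto intro!: continuous_intros)
  have line: "((\<lambda>t. x + t *\<^sub>R v) has_derivative (\<lambda>t. t *\<^sub>R v)) (at 0)"
    by (auto intro!: derivative_eq_intros)
  have "(\<psi> has_derivative frechet_derivative \<psi> (at x)) (at (x + 0 *\<^sub>R v))"
    using smooth_on_has_derivative[OF W(2) x(1)] by simp
  from has_derivative_compose[OF line this]
  have "((\<lambda>t. \<psi> (x + t *\<^sub>R v)) has_derivative (\<lambda>t. frechet_derivative \<psi> (at x) (t *\<^sub>R v))) (at 0)" .
  moreover have "(g has_derivative (\<lambda>v. grad g (\<psi> x) \<bullet> v)) (at (\<psi> (x + 0 *\<^sub>R v)))"
    using has_derivative_grad[OF diff] by simp
  ultimately have D: "((\<lambda>t. g (\<psi> (x + t *\<^sub>R v))) has_derivative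
      (\<lambda>t. grad g (\<psi> x) \<bullet> frechet_derivative \<psi> (at x) (t *\<^sub>R v))) (at 0)"
    by (rule has_derivative_compose)
  have "((\<lambda>t::real. s) has_derivative (\<lambda>t. grad g (\<psi> x) \<bullet> frechet_derivative \<psi> (at x) (t *\<^sub>R v))) (at 0)"
  proof (rule has_derivative_transform_within_open[OF D openU])
    show "0 \<in> U" using x by (simp add: U_def)
    show "g (\<psi> (x + t *\<^sub>R v)) = s" if "t \<in> U" for t
      using that x v by (intro lev) (auto simp: U_def coord_hyperplane_def)
  qed
  then have "(\<lambda>t::real. grad g (\<psi> x) \<bullet> frechet_derivative \<psi> (at x) (t *\<^sub>R v)) = (\<lambda>t. 0)"
    by (intro has_derivative_unique[OF _ has_derivative_const])
  from fun_cong[OF this, of 1] show ?thesis by simp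
qed

text \<open>Both sides are compared on the slab \<open>0 < x\<^sub>k\<^sub>1 < 1\<close> by means of the change of variables
  \<open>x \<mapsto> \<pi>\<^sub>k (\<psi> (\<pi>\<^sub>k\<^sub>1 x)) + x\<^sub>k\<^sub>1 e\<^sub>k\<close>, where \<open>\<pi>\<^sub>j\<close> is \<open>drop_coord j\<close>.\<close>

lemma slice_integral_eq_parametrized:
  fixes g :: "real^'n \<Rightarrow> real"
  assumes chart: "level_chart g k B" and BQ: "B \<subseteq> Q"
    and par: "local_parametrization {x\<in>Q. g x = s} k1 W \<psi>"
    and u[measurable]: "u \<in> borel_measurable borel"
    and u0: "\<And>p. p \<notin> \<psi> ` (W \<inter> coord_hyperplane k1) \<Longrightarrow> u p = 0"
  shows "slice_integral g k B u s
     = (\<integral>\<^sup>+x\<in>W \<inter> coord_hyperplane k1. u (\<psi> x) * indicator B (\<psi> x) * ennreal (volume_density k1 \<psi> x)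
          \<partial>hyperplane_lborel k1)"
proof -
  let ?H = "coord_hyperplane k1 :: (real^'n) set"
  let ?G = "flatten k g" and ?I = "unflatten k g B"
  let ?pi = "drop_coord k1"
  define slab :: "'n \<Rightarrow> (real^'n) set" where "slab k = {x. 0 < x $ k \<and> x $ k < 1}" for k
  have open_slab: "open (slab k)" for k
    unfolding slab_def by (intro open_Collect_conj open_Collect_less continuous_intros)
  have W: "open W" "smooth_on \<psi> W"
    and inj_der: "\<And>x. x \<in> W \<inter> ?H \<Longrightarrow> inj_on (frechet_derivative \<psi> (at x)) ?H"
    using par by (auto simp: local_parametrization_def)
  obtain V \<phi> where hom: "homeomorphism (W \<inter> ?H) (V \<inter> {x\<in>Q. g x = s}) \<psi> \<phi>"
    using par by (auto simp: local_parametrization_def)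
  have lev: "g (\<psi> x) = s" if "x \<in> W \<inter> ?H" for x
    using hom that unfolding homeomorphism_def by blast
  have inj_psi: "inj_on \<psi> (W \<inter> ?H)"
    using hom by (meson homeomorphism_apply1 inj_on_inverseI)
  note openB = chart_open[OF chart]
  have contpsi: "continuous_on W \<psi>" by (rule smooth_on_imp_continuous_on[OF W(2)])
  define U where "U = W \<inter> \<psi> -` B"
  have openU: "open U"
    unfolding U_def by (rule continuous_open_preimage[OF contpsi W(1) openB])
  define \<Omega> where "\<Omega> = ?pi -` U \<inter> slab k1"
  have open_piU: "open (?pi -` U)"
    using continuous_on_drop_coord[of UNIV k1] openU by (simp add: continuous_on_open_vimage)
  then have open\<Omega>: "open \<Omega>" unfolding \<Omega>_def using open_slab by auto
  define T where "T x = drop_coord k (\<psi> (?pi x)) + x $ k1 *\<^sub>R axis k 1" for x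
  define T' where "T' x w = drop_coord k (frechet_derivative \<psi> (at (?pi x)) (?pi w)) + w $ k1 *\<^sub>R axis k (1::real)" for x w
  have piH: "?pi x \<in> ?H" for x by (rule drop_coord_mem)
  have derT: "(T has_derivative T' x) (at x)" if "x \<in> \<Omega>" for x
  proof -
    have xW: "?pi x \<in> W" using that by (simp add: \<Omega>_def U_def)
    from has_derivative_compose[OF bounded_linear_imp_has_derivative[OF bounded_linear_drop_coord]
        smooth_on_has_derivative[OF W(2) xW]]
    have "((\<lambda>x. \<psi> (?pi x)) has_derivative (\<lambda>w. frechet_derivative \<psi> (at (?pi x)) (?pi w))) (at x)" .
    from bounded_linear.has_derivative[OF bounded_linear_drop_coord this]
    show ?thesis unfolding T_def[abs_def] T'_def
      by (intro has_derivative_add has_derivative_scaleR_left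
          bounded_linear_imp_has_derivative[OF bounded_linear_vec_nth])
  qed
  have flatT: "drop_coord k (T x) + s *\<^sub>R axis k 1 = ?G (\<psi> (?pi x))" if "x \<in> \<Omega>" for x
  proof -
    have "g (\<psi> (?pi x)) = s" using that piH by (intro lev) (auto simp: \<Omega>_def U_def)
    then show ?thesis by (simp add: T_def flatten_def drop_coord_add_axis drop_coord_drop_coord)
  qed
  have inB: "\<psi> (?pi x) \<in> B" "?pi x \<in> W \<inter> ?H" if "x \<in> \<Omega>" for x
    using that piH by (auto simp: \<Omega>_def U_def)
  have injT: "inj_on T \<Omega>"
  proof (rule inj_onI)
    fix x y assume xy: "x \<in> \<Omega>" "y \<in> \<Omega>" "T x = T y"
    have "?G (\<psi> (?pi x)) = ?G (\<psi> (?pi y))" using flatT xy by metis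
    then have "\<psi> (?pi x) = \<psi> (?pi y)"
      using chart_inj[OF chart] inB xy by (auto dest: inj_onD)
    then have "?pi x = ?pi y" using inj_psi inB xy by (auto dest: inj_onD)
    moreover have "T z $ k = z $ k1" for z by (simp add: T_def drop_coord_nth)
    then have "x $ k1 = y $ k1" using xy(3) by metis
    ultimately show "x = y" using drop_coord_eq_iff by blast
  qed
  have matT: "matrix (T' x) = (\<chi> r c. (if c = k1 then axis k 1 else drop_coord k (frechet_derivative \<psi> (at (?pi x)) (axis c 1))) $ r)"
    if "x \<in> \<Omega>" for x
  proof -
    have lin: "linear (frechet_derivative \<psi> (at (?pi x)))"
      using inB[OF that] by (intro linear_frechet_derivative smooth_on_differentiable[OF W(2)]) auto
    have ax: "?pi (axis c (1::real)) = (if c = k1 then 0 else axis c 1)" for c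
      by (auto simp: vec_eq_iff drop_coord_nth axis_def)
    have lin0: "frechet_derivative \<psi> (at (?pi x)) 0 = 0" "drop_coord k 0 = 0"
      using linear_0[OF lin] linear_0[OF bounded_linear.linear[OF bounded_linear_drop_coord[of k]]] by auto
    have "T' x (axis c 1) = (if c = k1 then axis k 1 else drop_coord k (frechet_derivative \<psi> (at (?pi x)) (axis c 1)))" for c
      unfolding T'_def ax by (cases "c = k1") (simp_all add: lin0, simp add: axis_def)
    then show ?thesis by (simp add: matrix_def)
  qed
  \<comment> \<open>The Jacobian of \<open>T\<close> is the determinant of the projected frame,
    namely \<open>\<nu> $ k\<close> times the determinant with the unit normal. The factor from
    \<open>slice_integrand\<close> is the reciprocal of the absolute value of
    \<open>\<nu> $ k\<close> and restores the true area.\<close>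
  have dens: "\<bar>det (matrix (T' x))\<bar> * (norm (grad g (\<psi> (?pi x))) / \<bar>grad g (\<psi> (?pi x)) $ k\<bar>)
      = volume_density k1 \<psi> (?pi x)" if x: "x \<in> \<Omega>" for x
  proof -
    let ?a = "?pi x"
    let ?n = "grad g (\<psi> ?a)" and ?D = "frechet_derivative \<psi> (at ?a)"
    define \<nu> where "\<nu> = ?n /\<^sub>R norm ?n"
    have nk: "?n $ k \<noteq> 0" by (rule chart_grad[OF chart inB(1)[OF x]])
    then have n0: "norm ?n > 0" by auto
    have diff: "g differentiable (at (\<psi> ?a))"
      by (rule smooth_on_differentiable[OF chart_smooth[OF chart] inB(1)[OF x]])
    have lin: "linear ?D"
      using inB[OF x] by (intro linear_frechet_derivative smooth_on_differentiable[OF W(2)]) auto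
    have nu1: "\<nu> \<bullet> \<nu> = 1"
      using n0 by (simp add: \<nu>_def power2_norm_eq_inner[symmetric] field_simps power2_eq_square)
    have nu0: "\<nu> \<bullet> ?D (axis i 1) = 0" if "i \<noteq> k1" for i
      using tangent_orthogonal_grad[OF par _ _ diff, of "axis i 1"] inB[OF x] that
      by (simp add: \<nu>_def coord_hyperplane_def axis_def)
    have indep: "c = 0" if c: "c $ k1 = 0" "(\<Sum>i\<in>UNIV - {k1}. c $ i *\<^sub>R ?D (axis i 1)) = 0" for c :: "real^'n"
    proof -
      have "?D c = ?D (\<Sum>i\<in>UNIV. c $ i *\<^sub>R axis i 1)"
        by (simp add: basis_expansion flip: scalar_mult_eq_scaleR)
      also have "\<dots> = (\<Sum>i\<in>UNIV. c $ i *\<^sub>R ?D (axis i 1))"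
        by (simp add: linear_sum[OF lin] linear_scale[OF lin])
      also have "\<dots> = 0"
        using c by (subst sum.remove[of _ k1]) auto
      finally have "?D c = ?D 0" by (simp add: linear_0[OF lin])
      then show ?thesis
        using inj_der[OF inB(2)[OF x]] c(1) by (auto simp: inj_on_def coord_hyperplane_def)
    qed
    have nuk: "\<nu> $ k \<noteq> 0" using nk n0 by (simp add: \<nu>_def)
    have "volume_density k1 \<psi> ?a = \<bar>det (\<chi> r c. (if c = k1 then \<nu> else ?D (axis c 1)) $ r)\<bar>"
      unfolding volume_density_def by (rule sqrt_det_gram[OF nu1 nu0])
    moreover have "det (matrix (T' x)) = \<nu> $ k * det (\<chi> r c. (if c = k1 then \<nu> else ?D (axis c 1)) $ r)"
      unfolding matT[OF x] by (rule det_projected_frame[OF nu1 nu0 nuk indep])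
    ultimately show ?thesis using n0 nk by (simp add: \<nu>_def abs_mult)
  qed
  have detcont: "continuous_on \<Omega> (\<lambda>x. det (matrix (T' x)))"
  proof -
    have "continuous_on \<Omega> (\<lambda>x. frechet_derivative \<psi> (at (?pi x)) v)" for v
      by (rule continuous_on_compose2[OF smooth_on_imp_continuous_on[OF smooth_on_frechet_derivative[OF W(2)]]
            continuous_on_drop_coord]) (auto simp: \<Omega>_def U_def)
    then have c: "continuous_on \<Omega> (\<lambda>x. drop_coord k (frechet_derivative \<psi> (at (?pi x)) v))" for v
      by (rule continuous_on_compose2[OF continuous_on_drop_coord[of UNIV]]) auto
    show ?thesis
      unfolding T'_def matrix_def det_def by (auto intro!: continuous_intros c)
  qed
  define q where "q z = slice_integrand g k B u (drop_coord k z + s *\<^sub>R axis k 1) * indicator (slab k) z" for z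
  have [measurable]: "slab j \<in> sets borel" for j using open_slab by simp
  note [measurable] = slice_integrand_measurable[OF chart u]
  have q[measurable]: "q \<in> borel_measurable borel" unfolding q_def[abs_def] by measurable
  have qT: "q (T x) = u (\<psi> (?pi x)) * ennreal (norm (grad g (\<psi> (?pi x))) / \<bar>grad g (\<psi> (?pi x)) $ k\<bar>)"
    if "x \<in> \<Omega>" for x
  proof -
    have "T x \<in> slab k" using that by (auto simp: slab_def T_def drop_coord_nth \<Omega>_def)
    then show ?thesis
      using inB[OF that] by (simp add: q_def flatT[OF that] slice_integrand_def[OF chart] unflatten_flatten[OF chart])
  qed
  \<comment> \<open>Points of the slab missed by \<open>T\<close> lie over points of the level set
    outside the image of \<open>\<psi>\<close>, where \<open>u\<close> vanishes, or outside the
    chart.\<close>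
  have q0: "q z = 0" if z: "z \<notin> T ` \<Omega>" for z
  proof (rule ccontr)
    let ?y = "drop_coord k z + s *\<^sub>R axis k 1"
    assume "q z \<noteq> 0"
    then have zs: "z \<in> slab k" and y: "?y \<in> ?G ` B"
      and uy: "u (?I ?y) \<noteq> 0"
      by (auto simp: q_def slice_integrand_def[OF chart] indicator_def split: if_splits)
    obtain a where a: "a \<in> W \<inter> ?H" "?I ?y = \<psi> a" using u0 uy by blast
    define x where "x = a + z $ k *\<^sub>R axis k1 1"
    have pix: "?pi x = a" using a by (simp add: x_def drop_coord_add_axis drop_coord_id)
    have xk: "x $ k1 = z $ k" using a by (simp add: x_def coord_hyperplane_def)
    have "\<psi> a \<in> B" using unflatten_mem[OF chart y] a by simp
    then have "x \<in> \<Omega>" using a zs by (simp add: \<Omega>_def U_def pix slab_def xk)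
    moreover have "T x = z"
    proof -
      have "drop_coord k (\<psi> a) = drop_coord k z"
        using drop_unflatten[OF chart y] a by (simp add: drop_coord_add_axis drop_coord_drop_coord)
      then show ?thesis by (simp add: T_def pix xk drop_coord_decomp)
    qed
    ultimately show False using z by blast
  qed
  define R where "R a = indicator U a * u (indicator U a *\<^sub>R \<psi> a) * ennreal (indicator U a *\<^sub>R volume_density k1 \<psi> a)" for a
  have [measurable]: "R \<in> borel_measurable borel"
  proof -
    have [measurable]: "U \<in> sets borel" using openU by simp
    have [measurable]: "(\<lambda>a. indicator U a *\<^sub>R \<psi> a) \<in> borel_measurable borel"
      by (intro borel_measurable_continuous_on_indicator continuous_on_subset[OF contpsi])
        (use openU in \<open>auto simp: U_def\<close>)
    have [measurable]: "(\<lambda>a. indicator U a *\<^sub>R volume_density k1 \<psi> a) \<in> borel_measurable borel"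
      by (intro borel_measurable_continuous_on_indicator continuous_on_subset[OF continuous_on_volume_density[OF W(2)]])
        (use openU in \<open>auto simp: U_def\<close>)
    show ?thesis unfolding R_def[abs_def] by measurable
  qed
  have "slice_integral g k B u s
      = (\<integral>\<^sup>+z. slice_integrand g k B u (drop_coord k z + s *\<^sub>R axis k 1) * indicator {x. 0 < x $ k \<and> x $ k < 1} z \<partial>lborel)"
    by (rule nn_integral_hyperplane_slab) measurable
  also have "\<dots> = (\<integral>\<^sup>+z\<in>T ` \<Omega>. q z \<partial>lborel)"
    by (intro nn_integral_cong) (use q0 in \<open>auto simp: indicator_def q_def slab_def\<close>)
  also have "\<dots> = (\<integral>\<^sup>+x\<in>\<Omega>. ennreal \<bar>det (matrix (T' x))\<bar> * q (T x) \<partial>lborel)"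
    by (rule nn_integral_change_of_variables[OF open\<Omega> derT injT detcont q])
  also have "\<dots> = (\<integral>\<^sup>+x. R (?pi x) * indicator {x. 0 < x $ k1 \<and> x $ k1 < 1} x \<partial>lborel)"
  proof (intro nn_integral_cong)
    fix x
    show "ennreal \<bar>det (matrix (T' x))\<bar> * q (T x) * indicator \<Omega> x =
        R (?pi x) * indicator {x. 0 < x $ k1 \<and> x $ k1 < 1} x"
    proof (cases "x \<in> \<Omega>")
      case True
      then have "?pi x \<in> U" "0 < x $ k1 \<and> x $ k1 < 1" by (auto simp: \<Omega>_def slab_def)
      moreover have "ennreal \<bar>det (matrix (T' x))\<bar> * q (T x) = u (\<psi> (?pi x)) * ennreal (volume_density k1 \<psi> (?pi x))"
        unfolding dens[OF True, symmetric] qT[OF True] by (subst ennreal_mult) (simp_all only: mult_ac abs_ge_zero zero_le_divide_iff norm_ge_zero simp_thms)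
      ultimately show ?thesis using True by (simp add: R_def)
    next
      case False
      then show ?thesis by (auto simp: \<Omega>_def slab_def R_def indicator_def)
    qed
  qed
  also have "\<dots> = (\<integral>\<^sup>+a. R a \<partial>hyperplane_lborel k1)"
    by (rule nn_integral_hyperplane_slab[symmetric]) measurable
  also have "\<dots> = (\<integral>\<^sup>+x\<in>W \<inter> ?H. u (\<psi> x) * indicator B (\<psi> x) * ennreal (volume_density k1 \<psi> x)
          \<partial>hyperplane_lborel k1)"
    by (intro nn_integral_cong_AE eventually_mono[OF AE_hyperplane_lborel])
      (auto simp: R_def U_def indicator_def)
  finally show ?thesis .
qed

lemma ennreal_suminf_swap:
  fixes a :: "nat \<Rightarrow> nat \<Rightarrow> ennreal"
  shows "(\<Sum>n. \<Sum>i. a n i) = (\<Sum>i. \<Sum>n. a n i)"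
proof -
  have "(\<integral>\<^sup>+n. (\<Sum>i. a n i) \<partial>count_space UNIV) = (\<Sum>i. \<integral>\<^sup>+n. a n i \<partial>count_space UNIV)"
    by (rule nn_integral_suminf) simp
  then show ?thesis by (simp add: nn_integral_count_space_nat)
qed

text \<open>With disjoint indicator functions as weights this gives the coarea formula; continuous weights give
  the continuity of the area in the level.\<close>

definition level_atlas :: "(real^'n) set \<Rightarrow> (real^'n \<Rightarrow> real) \<Rightarrow> real \<Rightarrow>
    (nat \<Rightarrow> 'n) \<Rightarrow> (nat \<Rightarrow> (real^'n) set) \<Rightarrow> (nat \<Rightarrow> real^'n \<Rightarrow> ennreal) \<Rightarrow> bool" where
  "level_atlas Q g s k B w \<longleftrightarrow> open Q \<and> smooth_on g Q \<and>
     (\<forall>i. level_chart g (k i) (B i) \<and> B i \<subseteq> Q \<and> w i \<in> borel_measurable borel \<and> (\<forall>x. x \<notin> B i \<longrightarrow> w i x = 0)) \<and>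
     (\<forall>x\<in>Q. g x = s \<longrightarrow> (\<Sum>i. w i x) = 1)"

definition level_measure :: "(real^'n \<Rightarrow> real) \<Rightarrow> real \<Rightarrow>
    (nat \<Rightarrow> 'n) \<Rightarrow> (nat \<Rightarrow> (real^'n) set) \<Rightarrow> (nat \<Rightarrow> real^'n \<Rightarrow> ennreal) \<Rightarrow> (real^'n) measure" where
  "level_measure g s k B w = measure_of UNIV (sets borel)
     (\<lambda>C. \<Sum>i. slice_integral g (k i) (B i) (\<lambda>p. w i p * indicator C p) s)"

text \<open>The condition under \<open>THE\<close> in \<open>surface_measure\<close>, named so that
  existence and uniqueness can be proved separately.\<close>

definition is_surface_measure :: "(real^'n) set \<Rightarrow> (real^'n) measure \<Rightarrow> bool" where
  "is_surface_measure \<Sigma> \<mu> \<longleftrightarrow> sets \<mu> = sets borel \<and> emeasure \<mu> (UNIV - \<Sigma>) = 0 \<and>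
     (\<forall>k W \<psi> C. local_parametrization \<Sigma> k W \<psi> \<longrightarrow> C \<in> sets borel \<longrightarrow>
        C \<subseteq> \<psi> ` (W \<inter> coord_hyperplane k) \<longrightarrow>
        emeasure \<mu> C =
          (\<integral>\<^sup>+x\<in>W \<inter> coord_hyperplane k \<inter> \<psi> -` C. ennreal (volume_density k \<psi> x)
             \<partial>hyperplane_lborel k))"

context
  fixes Q :: "(real^'n) set" and g s k B w
  assumes atlas: "level_atlas Q g s k B w"
begin

lemma atlas_chart: "level_chart g (k i) (B i)" and atlas_sub: "B i \<subseteq> Q"
  and atlas_w[measurable]: "w i \<in> borel_measurable borel" and atlas_w0: "x \<notin> B i \<Longrightarrow> w i x = 0"
  and atlas_sum: "x \<in> Q \<Longrightarrow> g x = s \<Longrightarrow> (\<Sum>i. w i x) = 1"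
  and atlas_open: "open Q" and atlas_smooth: "smooth_on g Q"
  using atlas by (auto simp: level_atlas_def)

lemma level_set_borel: "{x\<in>Q. g x = s} \<in> sets borel"
proof -
  have "(\<lambda>x. indicator Q x *\<^sub>R g x) \<in> borel_measurable borel"
    using atlas_open by (intro borel_measurable_continuous_on_indicator smooth_on_imp_continuous_on atlas_smooth) auto
  from measurable_sets_borel[OF this, of "{s}"]
  have "Q \<inter> (\<lambda>x. indicator Q x *\<^sub>R g x) -` {s} \<in> sets borel"
    using atlas_open by auto
  also have "Q \<inter> (\<lambda>x. indicator Q x *\<^sub>R g x) -` {s} = {x\<in>Q. g x = s}" by auto
  finally show ?thesis .
qed

lemma emeasure_level_measure:
  assumes "C \<in> sets borel"
  shows "emeasure (level_measure g s k B w) C =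
     (\<Sum>i. slice_integral g (k i) (B i) (\<lambda>p. w i p * indicator C p) s)" (is "_ = ?\<mu> C")
proof (rule emeasure_measure_of[OF level_measure_def])
  show "countably_additive (sets (level_measure g s k B w)) ?\<mu>"
  proof (rule countably_additiveI)
    fix A :: "nat \<Rightarrow> (real^'n) set"
    assume A: "range A \<subseteq> sets (level_measure g s k B w)" "disjoint_family A"
    have sA[measurable]: "A n \<in> sets borel" for n
      using A(1) by (auto simp: level_measure_def sets.sigma_sets_eq[of borel, simplified])
    have m[measurable]: "slice_integrand g (k i) (B i) (\<lambda>p. w i p * indicator (A n) p) \<in> borel_measurable borel" for i n
      by (rule slice_integrand_measurable[OF atlas_chart]) measurable
    have pt: "(\<Sum>n. slice_integrand g (k i) (B i) (\<lambda>p. w i p * indicator (A n) p) y)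
        = slice_integrand g (k i) (B i) (\<lambda>p. w i p * indicator (\<Union>n. A n) p) y" for i y
      by (simp add: slice_integrand_def[OF atlas_chart] ennreal_suminf_multc suminf_indicator[OF A(2)])
    have "(\<Sum>n. ?\<mu> (A n)) = (\<Sum>i. \<Sum>n. slice_integral g (k i) (B i) (\<lambda>p. w i p * indicator (A n) p) s)"
      by (rule ennreal_suminf_swap)
    also have "\<dots> = ?\<mu> (\<Union>n. A n)"
      by (simp add: nn_integral_suminf[symmetric] pt)
    finally show "(\<Sum>n. ?\<mu> (A n)) = ?\<mu> (\<Union>n. A n)" .
  qed
  show "positive (sets (level_measure g s k B w)) ?\<mu>"
  proof -
    have "slice_integrand g (k i) (B i) (\<lambda>p. w i p * indicator {} p) y = 0" for i y
      by (auto simp: slice_integrand_def[OF atlas_chart])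
    then show ?thesis by (simp add: positive_def)
  qed
  show "C \<in> sets (level_measure g s k B w)"
    using assms by (simp add: level_measure_def sets.sigma_sets_eq[of borel, simplified])
qed auto

text \<open>Each summand can be rewritten in any prescribed parametrization by
  \<open>slice_integral_eq_parametrized\<close>. There the weights add up to \<open>1\<close>, and
  the atlas disappears from the formula.\<close>

lemma is_surface_measure_level_measure: "is_surface_measure {x\<in>Q. g x = s} (level_measure g s k B w)"
  unfolding is_surface_measure_def
proof (intro conjI allI impI)
  let ?\<Sigma> = "{x\<in>Q. g x = s}"
  show "sets (level_measure g s k B w) = sets borel"
    by (simp add: level_measure_def sets.sigma_sets_eq[of borel, simplified])
  have "slice_integrand g (k i) (B i) (\<lambda>p. w i p * indicator (UNIV - ?\<Sigma>) p) (x + s *\<^sub>R axis (k i) 1) = 0"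
    if "x \<in> coord_hyperplane (k i)" for i x
  proof (cases "x + s *\<^sub>R axis (k i) 1 \<in> flatten (k i) g ` B i")
    case True
    from g_unflatten[OF atlas_chart this] unflatten_mem[OF atlas_chart this] atlas_sub[of i] that
    show ?thesis by (auto simp: slice_integrand_def[OF atlas_chart] coord_hyperplane_def)
  qed (simp add: slice_integrand_def[OF atlas_chart])
  then have "slice_integral g (k i) (B i) (\<lambda>p. w i p * indicator (UNIV - ?\<Sigma>) p) s = (\<integral>\<^sup>+x. 0 \<partial>hyperplane_lborel (k i))" for i
    by (intro nn_integral_cong_AE eventually_mono[OF AE_hyperplane_lborel])
  then show "emeasure (level_measure g s k B w) (UNIV - ?\<Sigma>) = 0"
    using level_set_borel by (subst emeasure_level_measure) auto
next
  let ?\<Sigma> = "{x\<in>Q. g x = s}"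
  fix k1 W \<psi> C
  assume par: "local_parametrization ?\<Sigma> k1 W \<psi>" and C[measurable]: "C \<in> sets borel"
    and CW: "C \<subseteq> \<psi> ` (W \<inter> coord_hyperplane k1)"
  let ?WH = "W \<inter> coord_hyperplane k1"
  have W: "open W" "smooth_on \<psi> W" using par by (auto simp: local_parametrization_def)
  have img: "\<psi> x \<in> ?\<Sigma>" if "x \<in> ?WH" for x
    using par that unfolding local_parametrization_def homeomorphism_def by blast
  have [measurable]: "(\<lambda>a. indicator W a *\<^sub>R \<psi> a) \<in> borel_measurable borel"
    using W(1) by (intro borel_measurable_continuous_on_indicator smooth_on_imp_continuous_on[OF W(2)]) auto
  have [measurable]: "(\<lambda>a. indicator W a *\<^sub>R volume_density k1 \<psi> a) \<in> borel_measurable borel"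
    using W(1) by (intro borel_measurable_continuous_on_indicator continuous_on_volume_density[OF W(2)]) auto
  have "closed (coord_hyperplane k1 :: (real^'n) set)"
    unfolding coord_hyperplane_def by (intro closed_Collect_eq continuous_intros)
  then have [measurable]: "?WH \<in> sets borel" using W(1) by auto
  have [measurable]: "B i \<in> sets borel" for i using chart_open[OF atlas_chart[of i]] by simp
  define F where "F i x = indicator ?WH x * (w i (indicator W x *\<^sub>R \<psi> x) * indicator C (indicator W x *\<^sub>R \<psi> x)
      * indicator (B i) (indicator W x *\<^sub>R \<psi> x)) * ennreal (indicator W x *\<^sub>R volume_density k1 \<psi> x)" for i x
  have [measurable]: "F i \<in> borel_measurable borel" for i
    unfolding F_def[abs_def] by measurable
  have "emeasure (level_measure g s k B w) C = (\<Sum>i. \<integral>\<^sup>+x. F i x \<partial>hyperplane_lborel k1)"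
    unfolding emeasure_level_measure[OF C]
  proof (intro suminf_cong)
    fix i
    have "slice_integral g (k i) (B i) (\<lambda>p. w i p * indicator C p) s = (\<integral>\<^sup>+x\<in>?WH. w i (\<psi> x) * indicator C (\<psi> x) * indicator (B i) (\<psi> x)
          * ennreal (volume_density k1 \<psi> x) \<partial>hyperplane_lborel k1)"
      by (rule slice_integral_eq_parametrized[OF atlas_chart atlas_sub par]) (use CW in \<open>auto simp: indicator_def\<close>)
    also have "\<dots> = (\<integral>\<^sup>+x. F i x \<partial>hyperplane_lborel k1)"
      by (intro nn_integral_cong) (auto simp: F_def indicator_def)
    finally show "slice_integral g (k i) (B i) (\<lambda>p. w i p * indicator C p) s = (\<integral>\<^sup>+x. F i x \<partial>hyperplane_lborel k1)" .
  qed
  also have "\<dots> = (\<integral>\<^sup>+x. (\<Sum>i. F i x) \<partial>hyperplane_lborel k1)"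
    by (rule nn_integral_suminf[symmetric]) measurable
  also have "\<dots> = (\<integral>\<^sup>+x\<in>?WH \<inter> \<psi> -` C. ennreal (volume_density k1 \<psi> x) \<partial>hyperplane_lborel k1)"
  proof (intro nn_integral_cong)
    fix x
    show "(\<Sum>i. F i x) = ennreal (volume_density k1 \<psi> x) * indicator (?WH \<inter> \<psi> -` C) x"
    proof (cases "x \<in> ?WH \<inter> \<psi> -` C")
      case True
      have "w i (\<psi> x) * indicator (B i) (\<psi> x) = w i (\<psi> x)" for i
        using atlas_w0 by (cases "\<psi> x \<in> B i") auto
      then have "F i x = w i (\<psi> x) * ennreal (volume_density k1 \<psi> x)" for i
        using True by (auto simp: F_def)
      then show ?thesis
        using True img[of x] atlas_sum[of "\<psi> x"] by (simp add: ennreal_suminf_multc)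
    next
      case False
      then have "F i x = 0" for i by (auto simp: F_def indicator_def)
      then show ?thesis using False by simp
    qed
  qed
  finally show "emeasure (level_measure g s k B w) C =
      (\<integral>\<^sup>+x\<in>W \<inter> coord_hyperplane k1 \<inter> \<psi> -` C. ennreal (volume_density k1 \<psi> x) \<partial>hyperplane_lborel k1)" .
qed

text \<open>On subsets of one chart the graph parametrization dictates the value. Countably many
  disjoint pieces of charts cover the level set, and its complement is null.\<close>

lemma is_surface_measure_unique:
  assumes \<mu>: "is_surface_measure {x\<in>Q. g x = s} \<mu>" and \<nu>: "is_surface_measure {x\<in>Q. g x = s} \<nu>"
  shows "\<mu> = \<nu>"
proof (rule measure_eqI)
  let ?\<Sigma> = "{x\<in>Q. g x = s}"
  have sets: "sets \<mu> = sets borel" "sets \<nu> = sets borel"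
    using \<mu> \<nu> by (auto simp: is_surface_measure_def)
  then show "sets \<mu> = sets \<nu>" by simp
  have loc: "emeasure \<mu> C = emeasure \<nu> C" if "C \<in> sets borel" "C \<subseteq> B i \<inter> ?\<Sigma>" for i C
  proof -
    note P = local_parametrization_level_set[OF atlas_chart[of i] atlas_sub[of i], where s = s]
    have "emeasure \<kappa> C = (\<integral>\<^sup>+x\<in>{x. drop_coord (k i) x + s *\<^sub>R axis (k i) 1 \<in> flatten (k i) g ` B i} \<inter> coord_hyperplane (k i) \<inter>
          (\<lambda>x. unflatten (k i) g (B i) (drop_coord (k i) x + s *\<^sub>R axis (k i) 1)) -` C.
          ennreal (volume_density (k i) (\<lambda>x. unflatten (k i) g (B i) (drop_coord (k i) x + s *\<^sub>R axis (k i) 1)) x)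
          \<partial>hyperplane_lborel (k i))" if "is_surface_measure ?\<Sigma> \<kappa>" for \<kappa>
      using that[unfolded is_surface_measure_def, THEN conjunct2, THEN conjunct2, rule_format, OF P(1) \<open>C \<in> sets borel\<close>]
        \<open>C \<subseteq> B i \<inter> ?\<Sigma>\<close> unfolding P(2) .
    from this[OF \<mu>] this[OF \<nu>] show ?thesis by simp
  qed
  have [measurable]: "B i \<in> sets borel" for i using chart_open[OF atlas_chart[of i]] by simp
  then have "range B \<subseteq> sets borel" by auto
  from sets.range_disjointed_sets'[OF this] have [measurable]: "disjointed B i \<in> sets borel" for i
    by auto
  \<comment> \<open>At a point outside all charts every weight would vanish, contradicting that they
    sum to \<open>1\<close> on the level set.\<close>
  have cover: "?\<Sigma> \<subseteq> (\<Union>i. B i)"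
  proof
    fix x assume x: "x \<in> ?\<Sigma>"
    show "x \<in> (\<Union>i. B i)"
    proof (rule ccontr)
      assume "x \<notin> (\<Union>i. B i)"
      then have "(\<Sum>i. w i x) = 0" using atlas_w0 by simp
      then show False using atlas_sum x by auto
    qed
  qed
  note [measurable] = level_set_borel
  fix A assume "A \<in> sets \<mu>"
  then have A[measurable]: "A \<in> sets borel" using sets by simp
  have split: "emeasure \<kappa> A = (\<Sum>i. emeasure \<kappa> (A \<inter> ?\<Sigma> \<inter> disjointed B i))"
    if \<kappa>: "is_surface_measure ?\<Sigma> \<kappa>" for \<kappa>
  proof -
    have [simp]: "sets \<kappa> = sets borel" and null: "emeasure \<kappa> (UNIV - ?\<Sigma>) = 0"
      using \<kappa> by (auto simp: is_surface_measure_def)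
    have "UNIV - ?\<Sigma> \<in> null_sets \<kappa>"
      using null level_set_borel by (auto simp: null_sets_def)
    then have "emeasure \<kappa> A = emeasure \<kappa> (A - (UNIV - ?\<Sigma>))"
      by (intro emeasure_Diff_null_set[symmetric]) auto
    also have "A - (UNIV - ?\<Sigma>) = (\<Union>i. A \<inter> ?\<Sigma> \<inter> disjointed B i)"
      using cover UN_disjointed_eq[of B] by auto
    also have "emeasure \<kappa> \<dots> = (\<Sum>i. emeasure \<kappa> (A \<inter> ?\<Sigma> \<inter> disjointed B i))"
    proof (rule suminf_emeasure[symmetric])
      show "range (\<lambda>i. A \<inter> ?\<Sigma> \<inter> disjointed B i) \<subseteq> sets \<kappa>"
        by auto
      show "disjoint_family (\<lambda>i. A \<inter> ?\<Sigma> \<inter> disjointed B i)"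
        using disjoint_family_disjointed[of B] by (fastforce simp: disjoint_family_on_def)
    qed
    finally show ?thesis .
  qed
  show "emeasure \<mu> A = emeasure \<nu> A"
    unfolding split[OF \<mu>] split[OF \<nu>]
  proof (intro suminf_cong loc)
    fix i
    show "A \<inter> ?\<Sigma> \<inter> disjointed B i \<in> sets borel"
      by measurable
    show "A \<inter> ?\<Sigma> \<inter> disjointed B i \<subseteq> B i \<inter> ?\<Sigma>"
      using disjointed_subset[of B i] by auto
  qed
qed

text \<open>Existence and uniqueness resolve the definite description. The left side does not
  mention the atlas, so every application may choose weights to suit itself.\<close>

theorem hypersurface_volume_level_set:
  "hypersurface_volume {x\<in>Q. g x = s} =
     (\<Sum>i. slice_integral g (k i) (B i) (w i) s)"
proof -
  let ?\<Sigma> = "{x\<in>Q. g x = s}" and ?m = "level_measure g s k B w"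
  have "surface_measure ?\<Sigma> = ?m"
    unfolding surface_measure_def is_surface_measure_def[symmetric]
    by (rule the_equality) (auto intro: is_surface_measure_level_measure is_surface_measure_unique)
  then have "hypersurface_volume ?\<Sigma> = emeasure ?m ?\<Sigma>"
    by (simp add: hypersurface_volume_def)
  also have "\<dots> = (\<Sum>i. slice_integral g (k i) (B i) (w i) s)"
    unfolding emeasure_level_measure[OF level_set_borel]
  proof (intro suminf_cong nn_integral_cong_AE eventually_mono[OF AE_hyperplane_lborel])
    fix i and x :: "real^'n" assume x: "x \<in> coord_hyperplane (k i)"
    let ?y = "x + s *\<^sub>R axis (k i) 1"
    show "slice_integrand g (k i) (B i) (\<lambda>p. w i p * indicator ?\<Sigma> p) ?y = slice_integrand g (k i) (B i) (w i) ?y"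
    proof (cases "?y \<in> flatten (k i) g ` B i")
      case True
      have "unflatten (k i) g (B i) ?y \<in> ?\<Sigma>"
        using g_unflatten[OF atlas_chart True] unflatten_mem[OF atlas_chart True] atlas_sub[of i] x
        by (auto simp: coord_hyperplane_def)
      then show ?thesis by (simp add: slice_integrand_def[OF atlas_chart])
    qed (simp add: slice_integrand_def[OF atlas_chart])
  qed
  finally show ?thesis .
qed

end

subsection \<open>The coarea formula\<close>

text \<open>One countable atlas, chosen independently of \<open>s\<close>, serves all levels. The
  integral over \<open>s\<close> can then be taken chart by chart.\<close>

theorem coarea_regular:
  fixes g :: "real^'n \<Rightarrow> real"
  assumes Q: "open Q" "smooth_on g Q" and reg: "\<And>x. x \<in> Q \<Longrightarrow> grad g x \<noteq> 0"
    and [measurable]: "h \<in> borel_measurable borel"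
  shows "(\<lambda>s. hypersurface_volume {x\<in>Q. g x = s}) \<in> borel_measurable borel"
    and "(\<integral>\<^sup>+s. h s * hypersurface_volume {x\<in>Q. g x = s} \<partial>lborel)
      = (\<integral>\<^sup>+x\<in>Q. h (g x) * ennreal (norm (grad g x)) \<partial>lborel)"
proof -
  have "\<forall>p\<in>Q. \<exists>k r. r > 0 \<and> ball p r \<subseteq> Q \<and> level_chart g k (ball p r)"
    using level_chart_exists[OF Q] reg by blast
  then obtain K R where KR: "\<And>p. p \<in> Q \<Longrightarrow> R p > 0 \<and> ball p (R p) \<subseteq> Q \<and> level_chart g (K p) (ball p (R p))"
    by metis
  obtain F where F: "F \<subseteq> (\<lambda>p. ball p (R p)) ` Q" "countable F" "\<Union>F = (\<Union>p\<in>Q. ball p (R p))"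
    using Lindelof[of "(\<lambda>p. ball p (R p)) ` Q"] by blast
  have UF: "\<Union>F = Q"
    unfolding F(3)
  proof
    show "(\<Union>p\<in>Q. ball p (R p)) \<subseteq> Q" using KR by blast
    show "Q \<subseteq> (\<Union>p\<in>Q. ball p (R p))" using KR by fastforce
  qed
  have empty: "level_chart g undefined {}"
    using smooth_on_subset[OF Q(2), of "{}"] by (simp add: level_chart_def)
  \<comment> \<open>\<open>from_nat_into\<close> is unspecified for the empty family, which occurs
    when \<open>Q\<close> is empty. Repetitions for a finite family become empty pieces after
    \<open>disjointed\<close>.\<close>
  define B where "B i = (if F = {} then {} else from_nat_into F i)" for i
  have B: "\<exists>k. level_chart g k (B i)" "B i \<subseteq> Q" for i
  proof -
    have "B i \<in> F \<or> B i = {}" by (auto simp: B_def from_nat_into)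
    moreover have "(\<exists>k. level_chart g k C) \<and> C \<subseteq> Q" if C: "C \<in> F" for C
    proof -
      obtain p where "p \<in> Q" "C = ball p (R p)" using F(1) C by blast
      then show ?thesis using KR by blast
    qed
    ultimately show "\<exists>k. level_chart g k (B i)" "B i \<subseteq> Q"
      using empty by auto
  qed
  then obtain k where k: "\<And>i. level_chart g (k i) (B i)" by metis
  have UB: "(\<Union>i. B i) = Q"
  proof (cases "F = {}")
    case False
    then have "range B = F" using range_from_nat_into[OF False F(2)] by (simp add: B_def[abs_def])
    then show ?thesis using UF by simp
  qed (use UF in \<open>auto simp: B_def\<close>)
  define w :: "nat \<Rightarrow> real^'n \<Rightarrow> ennreal" where "w i = indicator (disjointed B i)" for i
  have Bb[measurable]: "B i \<in> sets borel" for i using chart_open[OF k[of i]] by simp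
  then have "range B \<subseteq> sets borel" by auto
  from sets.range_disjointed_sets'[OF this] have [measurable]: "disjointed B i \<in> sets borel" for i
    by auto
  have sumw: "(\<Sum>i. w i x) = indicator Q x" for x
    unfolding w_def suminf_indicator[OF disjoint_family_disjointed] UN_disjointed_eq UB ..
  have wm[measurable]: "w i \<in> borel_measurable borel" for i by (simp add: w_def)
  have w0: "w i x = 0" if "x \<notin> B i" for i x
    using that disjointed_subset[of B i] by (auto simp: w_def indicator_def)
  have atlas: "level_atlas Q g s k B w" for s
    unfolding level_atlas_def using Q k B(2) sumw wm w0 by simp
  note vol = hypersurface_volume_level_set[OF atlas]
  have sm[measurable]: "slice_integrand g (k i) (B i) (w i) \<in> borel_measurable borel" for i
    by (rule slice_integrand_measurable[OF k]) simp
  have ms[measurable]: "(\<lambda>s. slice_integral g (k i) (B i) (w i) s)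
      \<in> borel_measurable borel" for i
  proof -
    interpret sigma_finite_measure "hyperplane_lborel (k i)" by (rule sigma_finite_hyperplane_lborel)
    show ?thesis by measurable
  qed
  show "(\<lambda>s. hypersurface_volume {x\<in>Q. g x = s}) \<in> borel_measurable borel"
    unfolding vol by measurable
  \<comment> \<open>On the slice at height \<open>s\<close> the function \<open>g\<close> equals
    \<open>s\<close>, so \<open>h s\<close> can be moved inside as \<open>h\<close> evaluated along
    \<open>g\<close>. The extension by zero only secures Borel measurability.\<close>
  have pull: "h s * (slice_integral g (k i) (B i) (w i) s)
     = slice_integral g (k i) (B i) (\<lambda>p. w i p * h (indicator Q p *\<^sub>R g p)) s"
    for s i
  proof -
    have "slice_integral g (k i) (B i) (\<lambda>p. w i p * h (indicator Q p *\<^sub>R g p)) s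
      = (\<integral>\<^sup>+x. h s * slice_integrand g (k i) (B i) (w i) (x + s *\<^sub>R axis (k i) 1) \<partial>hyperplane_lborel (k i))"
    proof (intro nn_integral_cong_AE eventually_mono[OF AE_hyperplane_lborel])
      fix x :: "real^'n" assume x: "x \<in> coord_hyperplane (k i)"
      let ?y = "x + s *\<^sub>R axis (k i) 1"
      show "slice_integrand g (k i) (B i) (\<lambda>p. w i p * h (indicator Q p *\<^sub>R g p)) ?y
         = h s * slice_integrand g (k i) (B i) (w i) ?y"
      proof (cases "?y \<in> flatten (k i) g ` B i")
        case True
        have "g (unflatten (k i) g (B i) ?y) = s" "unflatten (k i) g (B i) ?y \<in> Q"
          using g_unflatten[OF k True] unflatten_mem[OF k True] B(2) x by (auto simp: coord_hyperplane_def)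
        then show ?thesis using True by (simp add: slice_integrand_def[OF k] mult_ac)
      qed (simp add: slice_integrand_def[OF k])
    qed
    then show ?thesis by (simp add: nn_integral_cmult)
  qed
  have gm[measurable]: "(\<lambda>x. indicator Q x *\<^sub>R g x) \<in> borel_measurable borel"
    using Q(1) by (intro borel_measurable_continuous_on_indicator smooth_on_imp_continuous_on[OF Q(2)]) auto
  have [measurable]: "(\<lambda>x. indicator Q x *\<^sub>R grad g x) \<in> borel_measurable borel"
    using Q(1) by (intro borel_measurable_continuous_on_indicator continuous_on_grad[OF Q(2)]) auto
  have "(\<integral>\<^sup>+s. h s * hypersurface_volume {x\<in>Q. g x = s} \<partial>lborel)
     = (\<Sum>i. \<integral>\<^sup>+s. h s * (slice_integral g (k i) (B i) (w i) s) \<partial>lborel)"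
    unfolding vol ennreal_suminf_cmult[symmetric] by (rule nn_integral_suminf) measurable
  also have "\<dots> = (\<Sum>i. \<integral>\<^sup>+x\<in>B i. w i x * h (indicator Q x *\<^sub>R g x) * ennreal (norm (grad g x)) \<partial>lborel)"
    unfolding pull by (intro suminf_cong nn_integral_slice_integrand[OF k]) measurable
  also have "\<dots> = (\<Sum>i. \<integral>\<^sup>+x. w i x * (h (indicator Q x *\<^sub>R g x) * ennreal (norm (indicator Q x *\<^sub>R grad g x))) \<partial>lborel)"
    using disjointed_subset[of B] B(2)
    by (intro suminf_cong nn_integral_cong) (force simp: w_def indicator_def)
  also have "\<dots> = (\<integral>\<^sup>+x. (\<Sum>i. w i x * (h (indicator Q x *\<^sub>R g x) * ennreal (norm (indicator Q x *\<^sub>R grad g x)))) \<partial>lborel)"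
    by (rule nn_integral_suminf[symmetric]) measurable
  also have "\<dots> = (\<integral>\<^sup>+x\<in>Q. h (g x) * ennreal (norm (grad g x)) \<partial>lborel)"
    by (intro nn_integral_cong) (auto simp: ennreal_suminf_multc sumw indicator_def)
  finally show "(\<integral>\<^sup>+s. h s * hypersurface_volume {x\<in>Q. g x = s} \<partial>lborel)
      = (\<integral>\<^sup>+x\<in>Q. h (g x) * ennreal (norm (grad g x)) \<partial>lborel)" .
qed

subsection \<open>Continuity of the area of level sets\<close>

lemma continuous_on_extend_by_zero:
  fixes f :: "'a::t2_space \<Rightarrow> 'b::real_normed_vector"
  assumes "open V" "compact L" "L \<subseteq> V" "continuous_on V f" "\<And>x. x \<in> V - L \<Longrightarrow> f x = 0"
  shows "continuous_on UNIV (\<lambda>x. if x \<in> V then f x else 0)"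
proof -
  have "continuous_on V (\<lambda>x. if x \<in> V then f x else 0)"
    using assms(4) by (simp cong: continuous_on_cong)
  moreover have "continuous_on (- L) (\<lambda>x. if x \<in> V then f x else 0)"
  proof -
    have "continuous_on (- L) (\<lambda>x. 0 :: 'b)" by simp
    then show ?thesis by (rule continuous_on_eq) (use assms(5) in auto)
  qed
  ultimately have "continuous_on (V \<union> - L) (\<lambda>x. if x \<in> V then f x else 0)"
    using assms(1) compact_imp_closed[OF assms(2)] by (intro continuous_on_open_Un) auto
  moreover have "V \<union> - L = UNIV" using assms(3) by auto
  ultimately show ?thesis by simp
qed

lemma tendsto_hyperplane_integral:
  fixes f :: "real^'n \<Rightarrow> real"
  assumes cont: "continuous_on UNIV f" and L: "compact L" "\<And>y. y \<notin> L \<Longrightarrow> f y = 0"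
    and s: "s \<longlonglongrightarrow> s0"
  shows "(\<lambda>n. \<integral>\<^sup>+x. ennreal (f (x + s n *\<^sub>R axis k 1)) \<partial>hyperplane_lborel k)
     \<longlonglongrightarrow> (\<integral>\<^sup>+x. ennreal (f (x + s0 *\<^sub>R axis k 1)) \<partial>hyperplane_lborel k)"
proof -
  have [measurable]: "f \<in> borel_measurable borel"
    by (rule borel_measurable_continuous_onI[OF cont])
  obtain C where C: "\<And>y. y \<in> L \<Longrightarrow> f y \<le> C"
    using compact_imp_bounded[OF compact_continuous_image[OF continuous_on_subset[OF cont] L(1)]]
    by (metis bounded_has_Sup(1) empty_iff image_eqI top_greatest)
  then have fC: "f y \<le> max C 0" for y using L(2) by (cases "y \<in> L") (auto simp: le_max_iff_disj)
  obtain D where D: "\<And>y. y \<in> L \<Longrightarrow> norm y \<le> D"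
    using compact_imp_bounded[OF L(1)] by (auto simp: bounded_iff)
  obtain S where S: "\<And>n. \<bar>s n\<bar> \<le> S"
    using convergent_imp_Bseq[OF convergentI[OF s]] by (auto simp: Bseq_def)
  \<comment> \<open>All translates of the support that occur lie in one cube of half-width
    \<open>m\<close>, which supplies the dominating function.\<close>
  obtain m where m: "D + S \<le> real m" using real_arch_simple by blast
  define A where "A = {x :: real^'n. \<forall>i. x $ i \<in> {- real m..real m}}"
  have fin: "emeasure (hyperplane_lborel k) A < \<infinity>" and [measurable]: "A \<in> sets borel"
    using hyperplane_lborel_cube(1)[of m] hyperplane_lborel_cube(2)[where k = k and m = m] by (simp_all add: A_def)
  have supp: "x \<in> A" if "f (x + s n *\<^sub>R axis k 1) \<noteq> 0" for x n
  proof -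
    have "norm x \<le> norm (x + s n *\<^sub>R axis k 1) + norm (s n *\<^sub>R axis k (1::real))"
      using norm_triangle_ineq4[of "x + s n *\<^sub>R axis k 1" "s n *\<^sub>R axis k 1"] by simp
    also have "\<dots> \<le> D + S"
      using D[of "x + s n *\<^sub>R axis k 1"] L(2) that S[of n] by fastforce
    finally have "\<bar>x $ i\<bar> \<le> real m" for i
      using component_le_norm_cart[of x i] m by linarith
    then show ?thesis by (auto simp: A_def abs_le_iff minus_le_iff)
  qed
  show ?thesis
  proof (rule nn_integral_dominated_convergence[where w = "\<lambda>x. ennreal (max C 0) * indicator A x"])
    show "(\<integral>\<^sup>+x. ennreal (max C 0) * indicator A x \<partial>hyperplane_lborel k) < \<infinity>"
      using fin by (simp add: nn_integral_cmult_indicator ennreal_mult_less_top)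
    show "AE x in hyperplane_lborel k. ennreal (f (x + s n *\<^sub>R axis k 1)) \<le> ennreal (max C 0) * indicator A x" for n
    proof (rule AE_I2)
      fix x
      show "ennreal (f (x + s n *\<^sub>R axis k 1)) \<le> ennreal (max C 0) * indicator A x"
        using supp[of x n] fC[of "x + s n *\<^sub>R axis k 1"]
        by (cases "f (x + s n *\<^sub>R axis k 1) = 0") (auto intro: ennreal_leI)
    qed
    show "AE x in hyperplane_lborel k. (\<lambda>n. ennreal (f (x + s n *\<^sub>R axis k 1))) \<longlonglongrightarrow> ennreal (f (x + s0 *\<^sub>R axis k 1))"
    proof (rule AE_I2)
      fix x
      have "isCont f (x + s0 *\<^sub>R axis k 1)" using cont by (simp add: continuous_on_eq_continuous_at)
      moreover have "(\<lambda>n. x + s n *\<^sub>R axis k 1) \<longlonglongrightarrow> x + s0 *\<^sub>R axis k 1"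
        by (intro tendsto_intros s)
      ultimately show "(\<lambda>n. ennreal (f (x + s n *\<^sub>R axis k 1))) \<longlonglongrightarrow> ennreal (f (x + s0 *\<^sub>R axis k 1))"
        by (intro tendsto_ennrealI isCont_tendsto_compose[of _ f])
    qed
  qed measurable
qed

text \<open>The compact set \<open>K\<close> prevents area from escaping to the boundary of
  \<open>Q\<close>. It permits a finite atlas with continuous weights whose supports are compact
  inside the charts; each slice integral then converges by dominated convergence.\<close>

lemma tendsto_level_area:
  fixes g :: "real^'n \<Rightarrow> real"
  assumes Q: "open Q" "smooth_on g Q" and reg: "\<And>x. x \<in> Q \<Longrightarrow> grad g x \<noteq> 0"
    and K: "compact K" "K \<subseteq> Q"
    and s: "s \<longlonglongrightarrow> s0" and sK: "\<And>n. {x\<in>Q. g x = s n} \<subseteq> K" "{x\<in>Q. g x = s0} \<subseteq> K"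
  shows "(\<lambda>n. hypersurface_volume {x\<in>Q. g x = s n}) \<longlonglongrightarrow> hypersurface_volume {x\<in>Q. g x = s0}"
proof -
  have "\<forall>p\<in>Q. \<exists>k r. r > 0 \<and> ball p r \<subseteq> Q \<and> level_chart g k (ball p r)"
    using level_chart_exists[OF Q] reg by blast
  then obtain K' R where KR: "\<And>p. p \<in> Q \<Longrightarrow> R p > 0 \<and> ball p (R p) \<subseteq> Q \<and> level_chart g (K' p) (ball p (R p))"
    by metis
  \<comment> \<open>Half radii leave room for the weights to have compact support inside the
    charts.\<close>
  have "K \<subseteq> (\<Union>p\<in>K. ball p (R p / 2))" using KR K(2) by fastforce
  then obtain P where P: "P \<subseteq> K" "finite P" "K \<subseteq> (\<Union>p\<in>P. ball p (R p / 2))"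
    using compactE_image[OF K(1), of K "\<lambda>p. ball p (R p / 2)"] by (metis open_ball)
  obtain e :: "nat \<Rightarrow> real^'n" and m where e: "bij_betw e {..<m} P"
    using bij_betw_from_nat_into_finite[OF P(2)] by blast
  have eP: "e i \<in> P" "e i \<in> Q" if "i < m" for i
    using e that P(1) K(2) by (auto simp: bij_betw_def)
  define hat where "hat p x = max 0 (R p / 2 - dist x p)" for p x :: "real^'n"
  define S where "S x = (\<Sum>i<m. hat (e i) x)" for x
  have conthat: "continuous_on UNIV (hat p)" for p
    unfolding hat_def by (intro continuous_intros)
  have contS: "continuous_on UNIV S"
    unfolding S_def by (intro continuous_intros conthat)
  have hat0: "hat p x \<ge> 0" for p x by (simp add: hat_def)
  have Spos: "S x > 0" if "x \<in> K" for x
  proof -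
    obtain p where p: "p \<in> P" "x \<in> ball p (R p / 2)" using P(3) \<open>x \<in> K\<close> by blast
    then obtain i where i: "i < m" "e i = p" using e by (auto simp: bij_betw_def)
    have "hat (e i) x > 0" using p i by (simp add: hat_def dist_commute)
    also have "hat (e i) x \<le> S x"
      unfolding S_def using i hat0 by (intro member_le_sum) auto
    finally show ?thesis .
  qed
  obtain c where c: "c > 0" "\<And>x. x \<in> K \<Longrightarrow> c \<le> S x"
  proof (cases "K = {}")
    case False
    then obtain x0 where "x0 \<in> K" "\<forall>y\<in>K. S x0 \<le> S y"
      using continuous_attains_inf[OF K(1) _ continuous_on_subset[OF contS]] by blast
    then show ?thesis using that[of "S x0"] Spos by blast
  qed (use that[of 1] in auto)
  \<comment> \<open>The maximum with \<open>c\<close> keeps the denominator positive everywhere. On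
    \<open>K\<close> it equals \<open>S x\<close>, so the normalisation is exact where it is
    needed.\<close>
  define w where "w i x = (if i < m then hat (e i) x / max c (S x) else 0)" for i x
  define B where "B i = (if i < m then ball (e i) (R (e i)) else {})" for i
  define k where "k i = K' (e i)" for i
  have chart: "level_chart g (k i) (B i)" "B i \<subseteq> Q" for i
    using KR eP smooth_on_subset[OF Q(2), of "{}"] by (auto simp: B_def k_def level_chart_def)
  have contw: "continuous_on UNIV (w i)" for i
  proof (cases "i < m")
    case True
    have "max c (S x) \<noteq> 0" for x using c(1) by (simp add: max_def)
    then have "continuous_on UNIV (\<lambda>x. hat (e i) x / max c (S x))"
      by (intro continuous_intros conthat contS) auto
    then show ?thesis using True by (simp add: w_def[abs_def])
  qed (simp add: w_def[abs_def])
  have w0: "w i x = 0" if "i < m" "x \<notin> cball (e i) (R (e i) / 2)" for i x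
    using that by (simp add: w_def hat_def dist_commute)
  have sumw: "(\<Sum>i. ennreal (w i x)) = 1" if "x \<in> K" for x
  proof -
    have mx: "max c (S x) = S x" using c(2)[OF that] by simp
    have "(\<Sum>i. ennreal (w i x)) = (\<Sum>i<m. ennreal (w i x))"
      by (rule suminf_finite) (auto simp: w_def)
    also have "\<dots> = ennreal (\<Sum>i<m. w i x)"
      using hat0 c(1) by (intro sum_ennreal) (auto simp: w_def intro!: divide_nonneg_nonneg)
    also have "(\<Sum>i<m. w i x) = 1"
      using Spos[OF that] by (simp add: w_def mx sum_divide_distrib[symmetric] S_def[symmetric])
    finally show ?thesis by simp
  qed
  have atlas: "level_atlas Q g t k B (\<lambda>i x. ennreal (w i x))" if "{x\<in>Q. g x = t} \<subseteq> K" for t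
  proof -
    have "ennreal (w i x) = 0" if "x \<notin> B i" for i x
    proof (cases "i < m")
      case True
      then have "cball (e i) (R (e i) / 2) \<subseteq> B i" using KR[OF eP(2)[OF True]] by (auto simp: B_def)
      then have "x \<notin> cball (e i) (R (e i) / 2)" using that by blast
      then show ?thesis using w0[OF True] by simp
    qed (simp add: w_def)
    moreover have "(\<lambda>x. ennreal (w i x)) \<in> borel_measurable borel" for i
      using borel_measurable_continuous_onI[OF contw] by measurable
    ultimately show ?thesis
      unfolding level_atlas_def using Q chart sumw that by blast
  qed
  define f where "f i y = (if y \<in> flatten (k i) g ` B i then w i (unflatten (k i) g (B i) y) *
      (norm (grad g (unflatten (k i) g (B i) y)) / \<bar>grad g (unflatten (k i) g (B i) y) $ k i\<bar>) else 0)" for i y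
  have sl: "slice_integrand g (k i) (B i) (\<lambda>x. ennreal (w i x)) y = ennreal (f i y)" for i y
  proof -
    have "w i x \<ge> 0" for x using hat0 c(1) by (auto simp: w_def intro!: divide_nonneg_nonneg)
    then show ?thesis by (simp add: slice_integrand_def[OF chart(1)] f_def ennreal_mult[symmetric])
  qed
  define L where "L i = flatten (k i) g ` cball (e i) (R (e i) / 2)" for i
  have vol: "hypersurface_volume {x\<in>Q. g x = t} =
      (\<Sum>i<m. \<integral>\<^sup>+x. ennreal (f i (x + t *\<^sub>R axis (k i) 1)) \<partial>hyperplane_lborel (k i))"
    if "{x\<in>Q. g x = t} \<subseteq> K" for t
    unfolding hypersurface_volume_level_set[OF atlas[OF that]] sl
    by (rule suminf_finite) (auto simp: f_def B_def)
  have lim: "(\<lambda>n. \<integral>\<^sup>+x. ennreal (f i (x + s n *\<^sub>R axis (k i) 1)) \<partial>hyperplane_lborel (k i))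
      \<longlonglongrightarrow> (\<integral>\<^sup>+x. ennreal (f i (x + s0 *\<^sub>R axis (k i) 1)) \<partial>hyperplane_lborel (k i))" if i: "i < m" for i
  proof -
    note ch = chart(1)[of i]
    let ?V = "flatten (k i) g ` B i" and ?I = "unflatten (k i) g (B i)"
    have sub: "cball (e i) (R (e i) / 2) \<subseteq> B i" using KR[OF eP(2)[OF i]] i by (auto simp: B_def)
    have "continuous_on (B i) (flatten (k i) g)"
      by (intro continuous_at_imp_continuous_on ballI has_derivative_continuous[OF chart_flatten_has_derivative[OF ch]])
    then have L: "compact (L i)"
      unfolding L_def by (intro compact_continuous_image continuous_on_subset[OF _ sub]) auto
    have LV: "L i \<subseteq> ?V" using sub by (auto simp: L_def)
    have zero: "w i (?I y) * (norm (grad g (?I y)) / \<bar>grad g (?I y) $ k i\<bar>) = 0" if "y \<in> ?V - L i" for y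
    proof -
      have "?I y \<notin> cball (e i) (R (e i) / 2)"
        using that flatten_unflatten[OF ch, of y] unfolding L_def by (metis DiffE imageI)
      then show ?thesis using w0[OF i] by simp
    qed
    have cI: "continuous_on ?V ?I" by (rule continuous_on_unflatten[OF ch])
    have "continuous_on ?V (\<lambda>y. w i (?I y) * (norm (grad g (?I y)) / \<bar>grad g (?I y) $ k i\<bar>))"
      using chart_grad[OF ch unflatten_mem[OF ch]]
      by (intro continuous_intros continuous_on_compose2[OF continuous_on_grad[OF chart_smooth[OF ch]] cI]
          continuous_on_compose2[OF contw cI]) (auto intro: unflatten_mem[OF ch])
    from continuous_on_extend_by_zero[OF chart_open_image[OF ch] L LV this zero]
    have "continuous_on UNIV (f i)" by (simp add: f_def[abs_def])
    moreover have "f i y = 0" if "y \<notin> L i" for y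
      using zero that by (auto simp: f_def)
    ultimately show ?thesis using L s by (intro tendsto_hyperplane_integral)
  qed
  show ?thesis
    unfolding vol[OF sK(1)] vol[OF sK(2)] by (intro tendsto_sum lim) auto
qed

subsection \<open>Transport by a diffeomorphism\<close>

lemma AE_lborel_negligible: "negligible S \<Longrightarrow> AE x in lborel. x \<notin> S"
  unfolding negligible_iff_null_sets null_sets_completion_iff2
  by (auto intro: AE_I' elim!: bexE)

text \<open>The coarea formula with weight \<open>indicator {s}\<close>: a single level is null on
  the line, so the integral over \<open>{g = s}\<close> vanishes although its integrand is positive
  there.\<close>

lemma negligible_regular_level:
  fixes g :: "real^'n \<Rightarrow> real"
  assumes Q: "open Q" "smooth_on g Q" and reg: "\<And>x. x \<in> Q \<Longrightarrow> grad g x \<noteq> 0"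
  shows "negligible {x\<in>Q. g x = s}"
proof -
  have "(\<integral>\<^sup>+x\<in>Q. indicator {s} (g x) * ennreal (norm (grad g x)) \<partial>lborel)
     = (\<integral>\<^sup>+t. indicator {s} t * hypersurface_volume {x\<in>Q. g x = t} \<partial>lborel)"
    by (rule coarea_regular(2)[OF Q reg, symmetric]) auto
  also have "\<dots> = (\<integral>\<^sup>+t. 0 \<partial>(lborel :: real measure))"
    by (intro nn_integral_cong_AE eventually_mono[OF AE_lborel_singleton[of s]]) auto
  finally have "(\<integral>\<^sup>+x. indicator {s} (g x) * ennreal (norm (grad g x)) * indicator Q x \<partial>lborel) = 0" by simp
  moreover have "(\<lambda>x. indicator {s} (g x) * ennreal (norm (grad g x)) * indicator Q x) \<in> borel_measurable lborel"
  proof -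
    have [measurable]: "(\<lambda>x. indicator Q x *\<^sub>R g x) \<in> borel_measurable borel"
      using Q(1) by (intro borel_measurable_continuous_on_indicator smooth_on_imp_continuous_on[OF Q(2)]) auto
    note [measurable] = borel_measurable_norm_grad[OF Q]
    have "(\<lambda>x. indicator {s} (indicator Q x *\<^sub>R g x) * (ennreal (norm (grad g x)) * indicator Q x))
        \<in> borel_measurable lborel" by measurable
    then show ?thesis
      by (rule back_subst[of "\<lambda>f. f \<in> _"]) (auto simp: indicator_def fun_eq_iff)
  qed
  ultimately have "AE x in lborel. indicator {s} (g x) * ennreal (norm (grad g x)) * indicator Q x = 0"
    by (subst (asm) nn_integral_0_iff_AE) auto
  then have "AE x in lborel. x \<notin> {x\<in>Q. g x = s}"
    by (rule eventually_mono) (use reg in \<open>auto simp: indicator_def split: if_splits\<close>)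
  then obtain Z where "{x\<in>Q. g x = s} \<subseteq> Z" "Z \<in> null_sets lborel"
    by (auto elim!: AE_E simp: null_sets_def)
  then show ?thesis
    using negligible_iff_null_sets null_sets_completionI negligible_subset by blast
qed

lemma negligible_smooth_frontier:
  assumes "smooth_boundary S"
  shows "negligible (frontier S)"
proof (rule locally_negligible_alt[THEN iffD2], rule ballI)
  fix p assume p: "p \<in> frontier S"
  from assms[unfolded smooth_boundary_def, rule_format, OF p]
  obtain U g where U: "open U" "p \<in> U" "smooth_on g U" "\<forall>x\<in>U. grad g x \<noteq> 0"
    "frontier S \<inter> U = {x\<in>U. g x = 0}"
    by (elim exE conjE) (rule that)
  have "negligible (frontier S \<inter> U)"
    unfolding U(5) by (rule negligible_regular_level[OF U(1,3)]) (use U(4) in blast)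
  then show "\<exists>V. openin (top_of_set (frontier S)) V \<and> p \<in> V \<and> negligible V"
    using U(1,2) p by (intro exI[of _ "frontier S \<inter> U"]) (auto simp: openin_open)
qed

section \<open>Smooth maps on sets that need not be open\<close>

lemma smooth_map_imp_continuous_on:
  assumes "smooth_map S f"
  shows "continuous_on S f"
  unfolding continuous_on_eq_continuous_within
proof
  fix x assume x: "x \<in> S"
  then obtain U F where U: "open U" "x \<in> U" "smooth_on F U" "\<forall>y\<in>S \<inter> U. F y = f y"
    using assms unfolding smooth_map_def by blast
  have "isCont F x" using smooth_on_imp_continuous_on[OF U(3)] U(1,2) by (simp add: continuous_on_eq_continuous_at)
  then have "continuous (at x within S) F" by (rule continuous_at_imp_continuous_at_within)
  moreover obtain d where d: "d > 0" "ball x d \<subseteq> U" using U(1,2) openE by blast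
  have "F y = f y" if "y \<in> S" "dist y x < d" for y
    using that d(2) U(4) by (metis Int_iff dist_commute mem_ball subsetD)
  ultimately show "continuous (at x within S) f"
    using continuous_transform_within[of x S F d f] x d(1) by blast
qed

lemma smooth_map_imp_differentiable_on:
  assumes "smooth_map S f"
  shows "f differentiable_on S"
  unfolding differentiable_on_def
proof
  fix x assume x: "x \<in> S"
  then obtain U F where U: "open U" "x \<in> U" "smooth_on F U" "\<forall>y\<in>S \<inter> U. F y = f y"
    using assms unfolding smooth_map_def by blast
  obtain d where d: "d > 0" "ball x d \<subseteq> U" using U(1,2) openE by blast
  have "F differentiable (at x within S)"
    using smooth_on_differentiable[OF U(3,2)] by (rule differentiable_at_withinI)
  then show "f differentiable (at x within S)"
  proof (rule differentiable_transform_within[OF _ d(1) x])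
    show "F y = f y" if "y \<in> S" "dist y x < d" for y
      using that d(2) U(4) by (metis Int_iff dist_commute mem_ball subsetD)
  qed
qed

lemma smooth_map_imp_smooth_on:
  assumes f: "smooth_map S f" and V: "open V" "V \<subseteq> S"
  shows "smooth_on f V"
proof (rule smooth_on_local)
  fix x assume x: "x \<in> V"
  then obtain U F where U: "open U" "x \<in> U" "smooth_on F U" "\<forall>y\<in>S \<inter> U. F y = f y"
    using f V unfolding smooth_map_def by blast
  have "smooth_on f (U \<inter> V)"
    by (rule smooth_on_cong[of _ F]) (use U V in \<open>auto intro: smooth_on_subset\<close>)
  then show "\<exists>V. open V \<and> x \<in> V \<and> smooth_on f V"
    using U V x by (intro exI[of _ "U \<inter> V"]) auto
qed

abbreviation gradient_L1 :: "(real^'n) set \<Rightarrow> (real^'n \<Rightarrow> real) \<Rightarrow> ennreal" where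
  "gradient_L1 S g \<equiv> \<integral>\<^sup>+y\<in>S. ennreal (norm (grad g y)) \<partial>lborel"

locale compact_diffeo =
  fixes M :: "(real^'n) set" and \<Phi> :: "real^'n \<Rightarrow> real^'n"
  assumes compactM: "compact M" and boundaryM: "smooth_boundary M"
    and diffeo: "smooth_diffeo_onto_image M \<Phi>"
begin

abbreviation N :: "(real^'n) set" where "N \<equiv> interior M"
abbreviation P :: "real^'n \<Rightarrow> real^'n" where "P \<equiv> inv_into M \<Phi>"

lemma inj: "inj_on \<Phi> M" and smooth_map: "smooth_map M \<Phi>" and smooth_map_inv: "smooth_map (\<Phi> ` M) P"
  using diffeo by (auto simp: smooth_diffeo_onto_image_def)

lemma P_\<Phi>: "x \<in> N \<Longrightarrow> P (\<Phi> x) = x"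
  using inj interior_subset by (auto intro: inv_into_f_f)

lemma open_image: "open U \<Longrightarrow> U \<subseteq> N \<Longrightarrow> open (\<Phi> ` U)"
  by (rule invariance_of_domain)
    (use interior_subset[of M] in \<open>auto intro: continuous_on_subset[OF smooth_map_imp_continuous_on[OF smooth_map]]
      inj_on_subset[OF inj]\<close>)

lemma smooth_\<Phi>: "smooth_on \<Phi> N"
  by (rule smooth_map_imp_smooth_on[OF smooth_map]) (auto simp: interior_subset)

lemma smooth_P: "smooth_on P (\<Phi> ` N)"
  by (rule smooth_map_imp_smooth_on[OF smooth_map_inv open_image]) (use interior_subset in auto)

lemma smooth_transport:
  assumes "open U" "U \<subseteq> N" "smooth_on f U"
  shows "smooth_on (\<lambda>y. f (P y)) (\<Phi> ` U)"
  by (rule smooth_on_compose[OF open_image[OF assms(1,2)] assms(1) _ assms(3) smooth_on_subset[OF smooth_P]])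
    (use assms(2) P_\<Phi> in auto)

text \<open>Chain rule for \<open>f\<close> written as the transported function after
  \<open>\<Phi>\<close>. Hence one set of noncritical points, mapped forward, supplies a regular
  domain at every time.\<close>

lemma grad_transport_neq_0:
  assumes U: "open U" "U \<subseteq> N" "smooth_on f U" and x: "x \<in> U" and nz: "grad f x \<noteq> 0"
  shows "grad (\<lambda>y. f (P y)) (\<Phi> x) \<noteq> 0"
proof
  assume 0: "grad (\<lambda>y. f (P y)) (\<Phi> x) = 0"
  have "((\<lambda>y. f (P y)) has_derivative (\<lambda>v. grad (\<lambda>y. f (P y)) (\<Phi> x) \<bullet> v)) (at (\<Phi> x))"
    using x by (intro has_derivative_grad smooth_on_differentiable[OF smooth_transport[OF U]]) auto
  from has_derivative_compose[OF smooth_on_has_derivative[OF smooth_\<Phi>] this]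
  have "((\<lambda>x. f (P (\<Phi> x))) has_derivative (\<lambda>v. 0)) (at x)"
    using x U(2) by (auto simp: 0)
  then have "(f has_derivative (\<lambda>v. 0)) (at x)"
    by (rule has_derivative_transform_within_open[OF _ U(1) x]) (use U(2) P_\<Phi> in auto)
  then have "(f has_derivative (\<lambda>v. 0 \<bullet> v)) (at x)" by simp
  from grad_eqI[OF this] nz show False by simp
qed

lemma negligible_boundary_image: "negligible (\<Phi> ` M - \<Phi> ` N)"
proof -
  have "M - N = frontier M"
    using compact_imp_closed[OF compactM] by (simp add: frontier_def)
  then have "negligible (M - N)" using negligible_smooth_frontier[OF boundaryM] by simp
  then have "negligible (\<Phi> ` (M - N))"
    by (rule negligible_differentiable_image_negligible[OF order_refl])
      (auto intro: differentiable_on_subset[OF smooth_map_imp_differentiable_on[OF smooth_map]])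
  then show ?thesis by (rule negligible_subset) auto
qed

text \<open>The image of the boundary is null, and at images of interior points the gradient within
  the image of \<open>M\<close> is the ordinary gradient.\<close>

lemma L1_norm_gradient_pushforward:
  "L1_norm_on (\<Phi> ` M) (gradient_within (\<Phi> ` M) (pushforward M \<Phi> f))
    = gradient_L1 (\<Phi> ` N) (\<lambda>y. f (P y))"
  unfolding L1_norm_on_def
proof (intro nn_integral_cong_AE eventually_mono[OF AE_lborel_negligible[OF negligible_boundary_image]])
  fix y assume y: "y \<notin> \<Phi> ` M - \<Phi> ` N"
  have sub: "\<Phi> ` N \<subseteq> \<Phi> ` M" using interior_subset by auto
  show "ennreal (norm (gradient_within (\<Phi> ` M) (pushforward M \<Phi> f) y)) * indicator (\<Phi> ` M) y
     = ennreal (norm (grad (\<lambda>y. f (P y)) y)) * indicator (\<Phi> ` N) y"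
  proof (cases "y \<in> \<Phi> ` N")
    case True
    have "at y within \<Phi> ` M = at y"
      by (rule at_within_open_subset[OF True open_image sub]) auto
    then show ?thesis
      using True sub by (auto simp: gradient_within_def pushforward_def)
  next
    case False
    then show ?thesis using y by auto
  qed
qed

end

subsection \<open>A global defining function\<close>

text \<open>\<open>g\<close> may be arbitrary outside \<open>U\<close>: on the open complement of
  the closed ball the product is zero, and this complement together with \<open>U\<close> covers the
  space.\<close>

lemma smooth_on_bump_mult:
  assumes U: "open U" "cball p r \<subseteq> U" "smooth_on g U" and r: "r > 0"
  shows "smooth_on (\<lambda>x. bump p r x * g x) UNIV"
proof (rule smooth_on_local)
  fix x :: 'a
  show "\<exists>V. open V \<and> x \<in> V \<and> smooth_on (\<lambda>x. bump p r x * g x) V"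
  proof (cases "x \<in> U")
    case True
    then show ?thesis
      using U by (intro exI[of _ U]) (auto intro!: smooth_on_mult smooth_on_subset[OF smooth_on_bump])
  next
    case False
    have "smooth_on (\<lambda>x. bump p r x * g x) (- cball p r)"
    proof (rule smooth_on_cong[OF _ smooth_on_const[of 0]])
      fix y assume "y \<in> - cball p r"
      then have "y \<notin> ball p r" by auto
      then show "0 = bump p r y * g y" using bump_eq_0_iff[OF r, of p y] by simp
    qed auto
    then show ?thesis using False U by (intro exI[of _ "- cball p r"]) auto
  qed
qed

text \<open>Local defining functions are added up with bump functions as coefficients. At a boundary point
  all summands vanish and are nonpositive in \<open>A\<close>, so no cancellation of their gradients can occur.\<close>

lemma defining_function_exists:
  fixes A :: "(real^'n) set"
  assumes A: "open A" "compact (closure A)" "smooth_boundary A"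
  obtains \<rho> V where "smooth_on \<rho> UNIV" "\<And>x. x \<in> A \<Longrightarrow> \<rho> x < 0" "\<And>x. x \<notin> A \<Longrightarrow> \<rho> x \<ge> 0"
    "open V" "frontier A \<subseteq> V" "\<And>x. x \<in> V \<Longrightarrow> x \<notin> closure A \<Longrightarrow> \<rho> x > 0"
    "\<And>x. x \<in> frontier A \<Longrightarrow> \<rho> x = 0" "\<And>x. x \<in> frontier A \<Longrightarrow> grad \<rho> x \<noteq> 0"
proof -
  define good where "good p r U g \<longleftrightarrow> r > 0 \<and> open U \<and> cball p r \<subseteq> U \<and> smooth_on g U \<and>
      (\<forall>x\<in>U. (x \<in> A \<longrightarrow> g x < 0) \<and> (x \<in> frontier A \<longrightarrow> g x = 0 \<and> grad g x \<noteq> 0) \<and> (x \<notin> closure A \<longrightarrow> g x > 0)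
        \<and> (g x < 0 \<longrightarrow> x \<in> A))"
    for p :: "real^'n" and r U and g :: "real^'n \<Rightarrow> real"
  have clA: "closure A = A \<union> frontier A" using A(1) closure_Un_frontier by auto
  have dis: "A \<inter> frontier A = {}" using A(1) by (auto simp: frontier_def interior_open)
  have "\<exists>r U g. good p r U g" if p: "p \<in> closure A" for p
  proof (cases "p \<in> A")
    case True
    then obtain r where "r > 0" "cball p r \<subseteq> A" using A(1) open_contains_cball by blast
    \<comment> \<open>At points of \<open>A\<close> itself the constant \<open>-1\<close> qualifies,
      since its domain \<open>A\<close> contains no boundary points.\<close>
    then have "good p r A (\<lambda>x. -1)"
      using A(1) dis closure_subset[of A] by (auto simp: good_def smooth_on_const)
    then show ?thesis by blast
  next
    case False
    then have pf: "p \<in> frontier A" using p clA by auto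
    from A(3)[unfolded smooth_boundary_def, rule_format, OF pf]
    obtain U g where U: "open U" "p \<in> U" "smooth_on g U" "\<forall>x\<in>U. grad g x \<noteq> 0"
      "interior A \<inter> U = {x\<in>U. g x < 0}" "frontier A \<inter> U = {x\<in>U. g x = 0}"
      by (elim exE conjE) (rule that)
    have iA: "interior A = A" using A(1) by (rule interior_open)
    obtain r where "r > 0" "cball p r \<subseteq> U" using U(1,2) open_contains_cball by blast
    moreover have "(x \<in> A \<longrightarrow> g x < 0) \<and> (x \<in> frontier A \<longrightarrow> g x = 0 \<and> grad g x \<noteq> 0) \<and> (x \<notin> closure A \<longrightarrow> g x > 0)
        \<and> (g x < 0 \<longrightarrow> x \<in> A)" if x: "x \<in> U" for x
    proof -
      have "x \<in> A \<longleftrightarrow> g x < 0" "x \<in> frontier A \<longleftrightarrow> g x = 0"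
        using U(5,6) x unfolding iA by blast+
      then show ?thesis using U(4) x unfolding clA by auto
    qed
    ultimately have "good p r U g"
      unfolding good_def using U(1,3) by blast
    then show ?thesis by blast
  qed
  then obtain r U g where good: "\<And>p. p \<in> closure A \<Longrightarrow> good p (r p) (U p) (g p)"
    by metis
  have r: "r p > 0" if "p \<in> closure A" for p using good[OF that] by (simp add: good_def)
  have "closure A \<subseteq> (\<Union>p\<in>closure A. ball p (r p))" using r by fastforce
  then obtain P where P: "P \<subseteq> closure A" "finite P" "closure A \<subseteq> (\<Union>p\<in>P. ball p (r p))"
    using compactE_image[OF A(2), of "closure A" "\<lambda>p. ball p (r p)"] by (metis open_ball)
  define summand where "summand p x = bump p (r p) x * g p x" for p x
  define \<rho> where "\<rho> x = (\<Sum>p\<in>P. summand p x)" for x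
  define V where "V = (\<Union>p\<in>P. ball p (r p))"
  have gp: "good p (r p) (U p) (g p)" "r p > 0" if "p \<in> P" for p using good r that P(1) by auto
  have smsummand: "smooth_on (summand p) UNIV" if "p \<in> P" for p
    using gp[OF that] unfolding summand_def[abs_def] good_def
    by (intro smooth_on_bump_mult[where U = "U p"]) auto
  have sm: "smooth_on \<rho> UNIV"
    unfolding \<rho>_def[abs_def] by (intro smooth_on_sum smsummand) auto
  have in_U: "x \<in> U p" if "p \<in> P" "x \<in> ball p (r p)" for p x
    using gp[OF that(1)] that(2) ball_subset_cball by (auto simp: good_def)
  have out: "summand p x = 0" if "p \<in> P" "x \<notin> ball p (r p)" for p x
    using bump_eq_0_iff[OF gp(2)[OF that(1)], of p x] that(2) by (simp add: summand_def)
  have bpos: "bump p (r p) x > 0" if "p \<in> P" "x \<in> ball p (r p)" for p x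
    using bump_pos_iff[OF gp(2)[OF that(1)], of p x] that(2) by simp
  have summand_neg: "summand p x < 0" if "p \<in> P" "x \<in> A" "x \<in> ball p (r p)" for p x
    using gp(1)[OF that(1)] in_U[OF that(1,3)] bpos[OF that(1,3)] that(2)
    by (simp add: summand_def good_def mult_pos_neg)
  have summand_A: "summand p x \<le> 0" if "p \<in> P" "x \<in> A" for p x
    using summand_neg[OF that] out[OF that(1), of x] by (cases "x \<in> ball p (r p)") auto
  have summand_pos: "summand p x > 0" if "p \<in> P" "x \<notin> closure A" "x \<in> ball p (r p)" for p x
    using gp(1)[OF that(1)] in_U[OF that(1,3)] bpos[OF that(1,3)] that(2)
    by (simp add: summand_def good_def)
  have summand_out: "summand p x \<ge> 0" if "p \<in> P" "x \<notin> closure A" for p x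
    using summand_pos[OF that] out[OF that(1), of x] by (cases "x \<in> ball p (r p)") auto
  have summand_fr: "summand p x = 0" if "p \<in> P" "x \<in> frontier A" for p x
    using gp(1)[OF that(1)] in_U[OF that(1)] that out[OF that(1), of x]
    by (cases "x \<in> ball p (r p)") (auto simp: summand_def good_def)
  have neg: "\<rho> x < 0" if x: "x \<in> A" for x
  proof -
    obtain p where p: "p \<in> P" "x \<in> ball p (r p)" using P(3) x clA by blast
    have "(\<Sum>p\<in>P. summand p x) < (\<Sum>p\<in>P. 0)"
      by (rule sum_strict_mono_ex1) (use P(2) summand_A summand_neg[OF p(1) x p(2)] p(1) x in auto)
    then show ?thesis by (simp add: \<rho>_def)
  qed
  have fr: "\<rho> x = 0" if "x \<in> frontier A" for x
    using summand_fr that by (simp add: \<rho>_def)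
  have nonneg: "\<rho> x \<ge> 0" if x: "x \<notin> A" for x
  proof (cases "x \<in> frontier A")
    case False
    then have "x \<notin> closure A" using x clA by auto
    then show ?thesis using summand_out by (auto simp: \<rho>_def intro: sum_nonneg)
  qed (simp add: fr)
  have pos: "\<rho> x > 0" if x: "x \<in> V" "x \<notin> closure A" for x
  proof -
    obtain p where p: "p \<in> P" "x \<in> ball p (r p)" using x(1) by (auto simp: V_def)
    have "(\<Sum>p\<in>P. 0) < (\<Sum>p\<in>P. summand p x)"
      by (rule sum_strict_mono_ex1) (use P(2) summand_out summand_pos[OF p(1) x(2) p(2)] p(1) x in auto)
    then show ?thesis by (simp add: \<rho>_def)
  qed
  have grad: "grad \<rho> x \<noteq> 0" if x: "x \<in> frontier A" for x
  proof
    assume g0: "grad \<rho> x = 0"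
    obtain p where p: "p \<in> P" "x \<in> ball p (r p)" using P(3) x clA by blast
    have Up: "open (U p)" "x \<in> U p" "smooth_on (g p) (U p)" and gx: "g p x = 0" "grad (g p) x \<noteq> 0"
      using gp(1)[OF p(1)] in_U[OF p] x by (auto simp: good_def)
    define v where "v = grad (g p) x"
    define b where "b = bump p (r p)"
    have dg: "((\<lambda>t. g p (x + t *\<^sub>R v)) has_real_derivative (v \<bullet> v)) (at 0)"
      using grad_along_line[OF smooth_on_differentiable[OF Up(3,2)]] by (simp add: v_def)
    have db: "((\<lambda>t. b (x + t *\<^sub>R v)) has_real_derivative (grad b x \<bullet> v)) (at 0)"
      unfolding b_def by (intro grad_along_line smooth_on_differentiable[OF smooth_on_bump]) auto
    have d\<rho>: "((\<lambda>t. \<rho> (x + t *\<^sub>R v)) has_real_derivative 0) (at 0)"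
      using grad_along_line[OF smooth_on_differentiable[OF sm, of x], of v] g0 by simp
    have vv: "v \<bullet> v > 0" using gx(2) by (simp add: v_def)
    have bx: "b x > 0" using bpos[OF p] by (simp add: b_def)
    \<comment> \<open>Without the summand of \<open>p\<close>, the sum has negative derivative along
      \<open>v\<close> and is thus positive slightly behind \<open>x\<close>. That point lies in
      \<open>A\<close>, because \<open>g p\<close> is negative there, but in \<open>A\<close> all
      remaining summands are nonpositive.\<close>
    have "((\<lambda>t. \<rho> (x + t *\<^sub>R v) - b (x + t *\<^sub>R v) * g p (x + t *\<^sub>R v)) has_real_derivative - (b x * (v \<bullet> v))) (at 0)"
      by (rule DERIV_cong[OF DERIV_diff[OF d\<rho> DERIV_mult[OF db dg]]]) (simp add: gx(1))
    from DERIV_neg_dec_left[OF this] obtain d1 where d1: "d1 > 0"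
      "\<And>h. 0 < h \<Longrightarrow> h < d1 \<Longrightarrow> \<rho> (x - h *\<^sub>R v) - b (x - h *\<^sub>R v) * g p (x - h *\<^sub>R v) > 0"
      using bx vv fr[OF x] gx(1) by auto
    from DERIV_pos_inc_left[OF dg vv] obtain d2 where d2: "d2 > 0"
      "\<And>h. 0 < h \<Longrightarrow> h < d2 \<Longrightarrow> g p (x - h *\<^sub>R v) < 0"
      using gx(1) by auto
    have "open ((\<lambda>h. x - h *\<^sub>R v) -` (U p \<inter> ball p (r p)))"
      using Up(1) by (intro continuous_open_vimage) (auto intro!: continuous_intros)
    moreover have "0 \<in> (\<lambda>h. x - h *\<^sub>R v) -` (U p \<inter> ball p (r p))" using Up(2) p(2) by simp
    ultimately obtain d3 where d3: "d3 > 0" "ball 0 d3 \<subseteq> (\<lambda>h. x - h *\<^sub>R v) -` (U p \<inter> ball p (r p))"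
      using openE by blast
    define h where "h = min d1 (min d2 d3) / 2"
    have h: "0 < h" "h < d1" "h < d2" "h < d3" using d1(1) d2(1) d3(1) by (auto simp: h_def)
    define y where "y = x - h *\<^sub>R v"
    have "h \<in> ball 0 d3" using h by simp
    then have "y \<in> U p" using d3(2) by (auto simp: y_def)
    moreover have "g p y < 0" using d2(2)[OF h(1,3)] by (simp add: y_def)
    ultimately have yA: "y \<in> A" using gp(1)[OF p(1)] by (auto simp: good_def)
    have "\<rho> y = summand p y + (\<Sum>q\<in>P - {p}. summand q y)"
      unfolding \<rho>_def using P(2) p(1) by (rule sum.remove)
    also have "\<dots> \<le> summand p y"
      using sum_nonpos[of "P - {p}" "\<lambda>q. summand q y"] summand_A yA by simp
    finally show False using d1(2)[OF h(1,2)] by (simp add: y_def summand_def b_def)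
  qed
  show ?thesis
    by (rule that[of \<rho> V]) (use sm neg nonneg pos fr grad P(3) clA in \<open>auto simp: V_def\<close>)
qed

subsection \<open>The Sobolev constant is at most the Cheeger constant\<close>

lemma smooth_step_pos: "u < 0 \<Longrightarrow> smooth_step u > 0"
  using smooth_step_denominator[of u] by (simp add: smooth_step_def flat_exp_0_pos_iff)

lemma smooth_step_has_derivative:
  "(smooth_step has_real_derivative deriv smooth_step u) (at u)"
  using smooth_on_differentiable[OF smooth_on_smooth_step, of u]
  by (auto simp: DERIV_deriv_iff_real_differentiable)

lemma continuous_on_deriv_smooth_step: "continuous_on UNIV (deriv smooth_step)"
proof -
  have "frechet_derivative smooth_step (at u) 1 = deriv smooth_step u" for u
    using frechet_derivative_eqI[of smooth_step "(*) (deriv smooth_step u)" u] smooth_step_has_derivative[of u]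
    by (simp add: has_field_derivative_def)
  moreover have "continuous_on UNIV (\<lambda>u. frechet_derivative smooth_step (at u) 1)"
    by (intro smooth_on_imp_continuous_on smooth_on_frechet_derivative smooth_on_smooth_step)
  ultimately show ?thesis by simp
qed

lemma deriv_smooth_step_nonpos: "deriv smooth_step u \<le> 0"
proof (rule ccontr)
  assume "\<not> deriv smooth_step u \<le> 0"
  then obtain d where "d > 0" "\<forall>h>0. h < d \<longrightarrow> smooth_step u < smooth_step (u + h)"
    using DERIV_pos_inc_right[OF smooth_step_has_derivative] by (meson not_le)
  then have "smooth_step u < smooth_step (u + d / 2)" by simp
  moreover have "smooth_step (u + d / 2) \<le> smooth_step u" using \<open>d > 0\<close> by (intro smooth_step_antimono) simp
  ultimately show False by simp
qed

text \<open>At these points, endpoints included, the step attains its minimum \<open>0\<close> or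
  its maximum \<open>1\<close>.\<close>

lemma deriv_smooth_step_eq_0: "u \<le> -1 \<or> u \<ge> 0 \<Longrightarrow> deriv smooth_step u = 0"
proof (elim disjE)
  assume "u \<ge> 0"
  then show ?thesis
    using DERIV_local_min[OF smooth_step_has_derivative, of 1 u] smooth_step_eq_0 smooth_step_nonneg by auto
next
  assume "u \<le> -1"
  then show ?thesis
    using DERIV_local_max[OF smooth_step_has_derivative, of 1 u] smooth_step_eq_1 smooth_step_le_1 by auto
qed

context compact_diffeo
begin

lemma transport_level_set:
  "U \<subseteq> N \<Longrightarrow> {y \<in> \<Phi> ` U. f (P y) = s} = \<Phi> ` {x\<in>U. f x = s}"
  using P_\<Phi> by auto

text \<open>By the coarea formula, the integral is an average of the areas of the level sets of \<open>\<rho>\<close> at levels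
  in \<open>[-1/n, 0]\<close>.\<close>

lemma eventually_gradient_le_area:
  assumes A: "open A" "compact (closure A)" "closure A \<subseteq> N"
    and \<rho>: "smooth_on \<rho> UNIV" "\<And>x. x \<in> A \<Longrightarrow> \<rho> x < 0" "\<And>x. x \<notin> A \<Longrightarrow> \<rho> x \<ge> 0"
    and V: "open V" "frontier A \<subseteq> V" "\<And>x. x \<in> V \<Longrightarrow> x \<notin> closure A \<Longrightarrow> \<rho> x > 0"
    and fr: "\<And>x. x \<in> frontier A \<Longrightarrow> \<rho> x = 0" "\<And>x. x \<in> frontier A \<Longrightarrow> grad \<rho> x \<noteq> 0"
    and c: "c > hypersurface_volume (\<Phi> ` frontier A)"
  shows "\<forall>\<^sub>F n in sequentially. gradient_L1 (\<Phi> ` N) (\<lambda>y. smooth_step (real n * \<rho> (P y))) \<le> c"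
proof -
  have cont\<rho>: "continuous_on S \<rho>" for S
    using smooth_on_imp_continuous_on[OF \<rho>(1)] by (rule continuous_on_subset) auto
  have clA: "closure A = A \<union> frontier A" using A(1) closure_Un_frontier by auto
  define G where "G = V \<inter> N \<inter> {x. grad \<rho> x \<noteq> 0}"
  have openG: "open G"
  proof -
    have "open (grad \<rho> -` (- {0}))"
      using continuous_on_grad[OF \<rho>(1)] by (intro open_vimage) auto
    then show ?thesis unfolding G_def using V(1) by (auto simp: vimage_def)
  qed
  have GN: "G \<subseteq> N" by (auto simp: G_def)
  have frG: "frontier A \<subseteq> G" using V(2) fr(2) A(3) clA by (auto simp: G_def)
  \<comment> \<open>\<open>G\<close> contains the boundary of \<open>A\<close>, so the rest of the
    closure is a compact subset of \<open>A\<close>, on which the negative function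
    \<open>\<rho>\<close> stays away from \<open>0\<close>.\<close>
  obtain \<delta> where \<delta>: "\<delta> > 0" "\<And>x. x \<in> closure A \<Longrightarrow> x \<notin> G \<Longrightarrow> \<rho> x \<le> - \<delta>"
  proof (cases "closure A - G = {}")
    case False
    have "compact (closure A - G)" using A(2) openG by (simp add: compact_diff)
    from continuous_attains_sup[OF this False cont\<rho>]
    obtain x0 where x0: "x0 \<in> closure A - G" "\<And>x. x \<in> closure A - G \<Longrightarrow> \<rho> x \<le> \<rho> x0" by blast
    have "\<rho> x0 < 0" using x0(1) frG clA \<rho>(2) by auto
    then show ?thesis using that[of "- \<rho> x0"] x0(2) by auto
  qed (use that[of 1] in auto)
  define g where "g y = \<rho> (P y)" for y
  define Q where "Q = \<Phi> ` G"
  have openQ: "open Q" unfolding Q_def by (rule open_image[OF openG GN])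
  have smg: "smooth_on g (\<Phi> ` N)"
    unfolding g_def[abs_def] by (rule smooth_transport) (auto intro: smooth_on_subset[OF \<rho>(1)])
  then have smQ: "smooth_on g Q" by (rule smooth_on_subset) (use GN in \<open>auto simp: Q_def\<close>)
  have reg: "grad g y \<noteq> 0" if "y \<in> Q" for y
    using that grad_transport_neq_0[OF openG GN smooth_on_subset[OF \<rho>(1)]] by (auto simp: Q_def G_def g_def[abs_def])
  define K where "K = \<Phi> ` (closure A \<inter> {x. - \<delta> / 2 \<le> \<rho> x})"
  have K: "compact K" "K \<subseteq> Q"
  proof -
    have "compact (closure A \<inter> {x. - \<delta> / 2 \<le> \<rho> x})"
      by (intro compact_Int_closed A(2) closed_Collect_le continuous_intros cont\<rho>)
    moreover have "closure A \<subseteq> M" using A(3) interior_subset by auto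
    ultimately show "compact K"
      unfolding K_def
      by (intro compact_continuous_image continuous_on_subset[OF smooth_map_imp_continuous_on[OF smooth_map]]) auto
    have "x \<in> G" if "x \<in> closure A" "- \<delta> / 2 \<le> \<rho> x" for x
      using \<delta>(1) \<delta>(2)[OF that(1)] that(2) by fastforce
    then show "K \<subseteq> Q" by (auto simp: K_def Q_def)
  qed
  define area where "area s = hypersurface_volume {y\<in>Q. g y = s}" for s
  \<comment> \<open>Outside the closure of \<open>A\<close> the function \<open>\<rho>\<close> is
    positive on \<open>V\<close>, so nonpositive levels cannot have spurious components
    there.\<close>
  have lev: "{y\<in>Q. g y = s} \<subseteq> K" if "- \<delta> / 2 \<le> s" "s \<le> 0" for s
  proof -
    have "x \<in> closure A" if x: "x \<in> G" "\<rho> x = s" for x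
      using V(3)[of x] x \<open>s \<le> 0\<close> by (auto simp: G_def)
    then show ?thesis
      unfolding Q_def g_def transport_level_set[OF GN] K_def using that by auto
  qed
  have "{x\<in>G. \<rho> x = 0} = frontier A"
    using frG fr(1) V(3) \<rho>(2) clA by (force simp: G_def)
  then have area0: "area 0 = hypersurface_volume (\<Phi> ` frontier A)"
    unfolding area_def Q_def g_def transport_level_set[OF GN] by simp
  \<comment> \<open>A bound uniform over the shrinking window of levels suffices. Levels violating
    it would converge to \<open>0\<close> and contradict the continuity of the area at level
    \<open>0\<close>.\<close>
  have "\<forall>\<^sub>F n in sequentially. \<forall>s. - (1 / real n) \<le> s \<longrightarrow> s \<le> 0 \<longrightarrow> area s \<le> c"
  proof (rule ccontr)
    assume neg: "\<not> ?thesis"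
    then have "\<exists>n\<ge>m. \<exists>s. - (1 / real n) \<le> s \<and> s \<le> 0 \<and> area s > c" for m
      unfolding eventually_sequentially by (meson not_le)
    then have "\<exists>s. - (1 / real (Suc m)) \<le> s \<and> s \<le> 0 \<and> area s > c" for m
    proof -
      obtain n s where ns: "n \<ge> Suc m" "- (1 / real n) \<le> s" "s \<le> 0" "area s > c"
        using \<open>\<And>m. \<exists>n\<ge>m. \<exists>s. _\<close>[of "Suc m"] by blast
      have "1 / real n \<le> 1 / real (Suc m)" using ns(1) by (simp add: frac_le)
      then show ?thesis using ns by (intro exI[of _ s]) auto
    qed
    then obtain s where s: "\<And>m. - (1 / real (Suc m)) \<le> s m" "\<And>m. s m \<le> 0" "\<And>m. area (s m) > c"
      by metis
    have lim: "s \<longlonglongrightarrow> 0"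
    proof (rule tendsto_sandwich[of "\<lambda>m. - (1 / real (Suc m))" s sequentially "\<lambda>_. 0"])
      show "(\<lambda>m. - (1 / real (Suc m))) \<longlonglongrightarrow> 0"
        using tendsto_minus[OF LIMSEQ_inverse_real_of_nat] by (simp add: inverse_eq_divide)
    qed (use s in auto)
    obtain m0 where m0: "\<And>m. m \<ge> m0 \<Longrightarrow> s m > - \<delta> / 2"
      using order_tendstoD(1)[OF lim, of "- \<delta> / 2"] \<delta>(1) by (auto simp: eventually_sequentially)
    \<comment> \<open>After the shift all levels exceed \<open>- \<delta> / 2\<close>, so the
      corresponding level sets lie in \<open>K\<close>.\<close>
    define s' where "s' m = s (m + m0)" for m
    have "(\<lambda>m. hypersurface_volume {y\<in>Q. g y = s' m}) \<longlonglongrightarrow> hypersurface_volume {y\<in>Q. g y = 0}"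
    proof (rule tendsto_level_area[OF openQ smQ reg K])
      show "s' \<longlonglongrightarrow> 0" unfolding s'_def using lim by (rule LIMSEQ_ignore_initial_segment)
      show "{y \<in> Q. g y = s' m} \<subseteq> K" for m
        using m0[of "m + m0"] s(2) by (intro lev) (auto simp: s'_def less_imp_le)
      show "{y \<in> Q. g y = 0} \<subseteq> K" using \<delta>(1) by (intro lev) auto
    qed
    then have "(\<lambda>m. area (s' m)) \<longlonglongrightarrow> area 0" by (simp add: area_def)
    moreover have "area 0 < c" using c by (simp add: area0)
    ultimately have "\<forall>\<^sub>F m in sequentially. area (s' m) < c" by (rule order_tendstoD(2))
    then obtain m where "area (s' m) < c" by (auto simp: eventually_sequentially)
    then show False using s(3)[of "m + m0"] by (simp add: s'_def)
  qed
  \<comment> \<open>For these \<open>n\<close>, points of the closure of \<open>A\<close> outside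
    \<open>G\<close> satisfy \<open>real n * \<rho> x \<le> -1\<close>, where the step is constant.
    The whole gradient therefore lives in the regular region.\<close>
  moreover have "\<forall>\<^sub>F n in sequentially. real n > 1 / \<delta>"
    using filterlim_real_sequentially by (simp add: filterlim_at_top_dense)
  ultimately show ?thesis
  proof eventually_elim
    case (elim n)
    define D where "D u = deriv smooth_step u" for u
    have n: "real n > 0" using elim(2) \<delta>(1) by (meson less_trans zero_less_divide_1_iff)
    have n\<delta>: "real n * \<delta> > 1" using elim(2) \<delta>(1) by (simp add: divide_less_eq)
    have D0: "D u \<le> 0" for u unfolding D_def by (rule deriv_smooth_step_nonpos)
    have contD: "continuous_on UNIV D" unfolding D_def[abs_def] by (rule continuous_on_deriv_smooth_step)
    have [measurable]: "D \<in> borel_measurable borel" by (rule borel_measurable_continuous_onI[OF contD])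
    have gradf: "grad (\<lambda>y. smooth_step (real n * \<rho> (P y))) y = (D (real n * g y) * real n) *\<^sub>R grad g y"
      if y: "y \<in> \<Phi> ` N" for y
    proof (rule grad_eqI)
      have "((\<lambda>y. real n * g y) has_derivative (\<lambda>v. real n * (grad g y \<bullet> v))) (at y)"
        by (intro has_derivative_mult_right has_derivative_grad smooth_on_differentiable[OF smg y])
      from has_derivative_compose[OF this smooth_step_has_derivative[unfolded has_field_derivative_def]]
      show "((\<lambda>y. smooth_step (real n * \<rho> (P y))) has_derivative (\<lambda>v. ((D (real n * g y) * real n) *\<^sub>R grad g y) \<bullet> v)) (at y)"
        by (simp add: D_def g_def mult.assoc)
    qed
    define h where "h s = ennreal (- (D (real n * s) * real n))" for s
    have [measurable]: "h \<in> borel_measurable borel" unfolding h_def[abs_def] by measurable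
    have outside: "D (real n * g y) = 0" if y: "y \<in> \<Phi> ` N" "y \<notin> Q" for y
    proof -
      obtain x where x: "x \<in> N" "y = \<Phi> x" "x \<notin> G" using y by (auto simp: Q_def)
      have gy: "g y = \<rho> x" using x P_\<Phi> by (simp add: g_def)
      have "real n * \<rho> x \<le> -1 \<or> real n * \<rho> x \<ge> 0"
      proof (cases "x \<in> closure A")
        case True
        have "real n * \<rho> x \<le> real n * (- \<delta>)" using \<delta>(2)[OF True x(3)] n by (intro mult_left_mono) auto
        then show ?thesis using n\<delta> by auto
      next
        case False
        then have "\<rho> x \<ge> 0" using \<rho>(3) clA by auto
        then show ?thesis using n by auto
      qed
      then show ?thesis unfolding gy D_def by (rule deriv_smooth_step_eq_0)
    qed
    have "gradient_L1 (\<Phi> ` N) (\<lambda>y. smooth_step (real n * \<rho> (P y)))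
        = (\<integral>\<^sup>+y\<in>Q. h (g y) * ennreal (norm (grad g y)) \<partial>lborel)"
    proof (intro nn_integral_cong)
      fix y
      have QN: "Q \<subseteq> \<Phi> ` N" using GN by (auto simp: Q_def)
      show "ennreal (norm (grad (\<lambda>y. smooth_step (real n * \<rho> (P y))) y)) * indicator (\<Phi> ` N) y
         = h (g y) * ennreal (norm (grad g y)) * indicator Q y"
      proof (cases "y \<in> \<Phi> ` N")
        case True
        have "ennreal (norm (grad (\<lambda>y. smooth_step (real n * \<rho> (P y))) y)) = h (g y) * ennreal (norm (grad g y))"
          unfolding gradf[OF True] h_def using D0[of "real n * g y"] n
          by (simp add: abs_mult ennreal_mult[symmetric] mult_nonpos_nonneg)
        then show ?thesis
          using True outside[OF True] by (cases "y \<in> Q") (auto simp: h_def)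
      next
        case False
        then have "y \<notin> Q" using QN by blast
        then show ?thesis using False by simp
      qed
    qed
    also have "\<dots> = (\<integral>\<^sup>+s. h s * area s \<partial>lborel)"
      unfolding area_def by (rule coarea_regular(2)[OF openQ smQ reg, symmetric]) auto
    also have "\<dots> \<le> (\<integral>\<^sup>+s. c * (ennreal (- (D (real n * s) * real n)) * indicator {- (1 / real n)..0} s) \<partial>lborel)"
    proof (intro nn_integral_mono)
      fix s :: real
      show "h s * area s \<le> c * (ennreal (- (D (real n * s) * real n)) * indicator {- (1 / real n)..0} s)"
      proof (cases "s \<in> {- (1 / real n)..0}")
        case True
        then have "area s \<le> c" using elim(1) by auto
        then show ?thesis using True by (simp add: h_def mult.commute mult_right_mono)
      next
        case False
        then have "real n * s \<le> -1 \<or> real n * s \<ge> 0"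
          using n by (auto simp: field_simps zero_le_mult_iff)
        then have "D (real n * s) = 0" unfolding D_def by (rule deriv_smooth_step_eq_0)
        then show ?thesis by (simp add: h_def)
      qed
    qed
    also have "\<dots> = c * (\<integral>\<^sup>+s. ennreal (- (D (real n * s) * real n)) * indicator {- (1 / real n)..0} s \<partial>lborel)"
      by (rule nn_integral_cmult) measurable
    \<comment> \<open>The total weight is \<open>smooth_step (-1) - smooth_step 0 = 1\<close>, which
      makes the bound a mean value.\<close>
    also have "(\<integral>\<^sup>+s. ennreal (- (D (real n * s) * real n)) * indicator {- (1 / real n)..0} s \<partial>lborel)
        = ennreal (- smooth_step (real n * 0) - - smooth_step (real n * (- (1 / real n))))"
    proof (rule nn_integral_FTC_Icc)
      fix s :: real
      have "((\<lambda>s. real n * s) has_real_derivative real n) (at s)" by (auto intro!: derivative_eq_intros)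
      from DERIV_minus[OF DERIV_chain2[OF smooth_step_has_derivative this]]
      show "((\<lambda>s. - smooth_step (real n * s)) has_real_derivative - (D (real n * s) * real n)) (at s)"
        by (simp add: D_def)
      show "0 \<le> - (D (real n * s) * real n)" using D0[of "real n * s"] n by (simp add: mult_nonpos_nonneg)
    qed (use n in auto)
    also have "\<dots> = 1" using n by (simp add: smooth_step_eq_0 smooth_step_eq_1)
    finally show ?case by simp
  qed
qed

end

section \<open>Quotients and averages of extended nonnegative numbers\<close>

lemma ennreal_le_divide_iff:
  fixes a b c :: ennreal
  assumes "c \<noteq> 0" "c \<noteq> \<infinity>"
  shows "a \<le> b / c \<longleftrightarrow> a * c \<le> b"
proof
  assume "a \<le> b / c"
  then have "a * c \<le> b / c * c" by (rule mult_right_mono) simp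
  also have "b / c * c = b" using assms by (simp add: ennreal_divide_times less_top)
  finally show "a * c \<le> b" .
next
  assume "a * c \<le> b"
  then have "a * c / c \<le> b / c" by (rule divide_right_mono_ennreal)
  then show "a \<le> b / c" using assms by (simp add: ennreal_mult_divide_eq)
qed

lemma average_add_const:
  fixes a :: "'t \<Rightarrow> ennreal"
  assumes "finite T" "T \<noteq> {}"
  shows "1 / of_nat (card T) * (\<Sum>t\<in>T. a t + e) = 1 / of_nat (card T) * (\<Sum>t\<in>T. a t) + e"
proof -
  have "card T \<noteq> 0" using assms by simp
  then have "1 / of_nat (card T) * (of_nat (card T) * e) = e"
    by (simp add: mult.assoc[symmetric] ennreal_divide_times of_nat_less_top)
  then show ?thesis by (simp add: sum.distrib distrib_left)
qed

lemma emeasure_lborel_open_neq_0: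
  fixes A :: "'a::euclidean_space set"
  assumes "open A" "A \<noteq> {}"
  shows "emeasure lborel A \<noteq> 0"
proof
  assume "emeasure lborel A = 0"
  then have "A \<in> null_sets lborel" using assms(1) by (simp add: null_sets_def)
  then have "negligible A"
    unfolding negligible_iff_null_sets by (rule null_sets_completionI)
  then show False using open_not_negligible assms by blast
qed

text \<open>The masses of \<open>f n\<close> increase to that of \<open>A\<close>, while the
  gradients eventually stay below the boundary areas up to \<open>e\<close>. Finiteness of
  \<open>T\<close> gives a common threshold for all times.\<close>

lemma sobolev_le_cheeger:
  fixes M :: "(real^'n) set"
  assumes T: "finite T" "T \<noteq> {}" and diffeo: "\<And>t. t \<in> T \<Longrightarrow> compact_diffeo M (\<Phi> t)"
  shows "dynamic_sobolev M T \<Phi> \<le> dynamic_cheeger M T \<Phi>"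
  unfolding dynamic_cheeger_def
proof (rule INF_greatest)
  fix A assume "A \<in> admissible_sets M"
  then have A: "A \<noteq> {}" "open A" "compact (closure A)" "closure A \<subseteq> interior M" "smooth_boundary A"
    by (auto simp: admissible_sets_def)
  let ?S = "dynamic_sobolev M T \<Phi>"
  let ?N = "\<lambda>f. L1_norm_on M f"
  let ?I = "\<lambda>t f. L1_norm_on (\<Phi> t ` M) (gradient_within (\<Phi> t ` M) (pushforward M (\<Phi> t) f))"
  define a where "a t = hypersurface_volume (\<Phi> t ` frontier A)" for t
  have AM: "A \<subseteq> M" using A(4) closure_subset[of A] interior_subset[of M] by blast
  have "bounded A" by (rule bounded_subset[OF compact_imp_bounded[OF A(3)] closure_subset])
  then have finA: "emeasure lborel A \<noteq> \<infinity>" using emeasure_bounded_finite[of A] by auto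
  have posA: "emeasure lborel A \<noteq> 0" by (rule emeasure_lborel_open_neq_0[OF A(2,1)])
  have [measurable]: "A \<in> sets borel" using A(2) by simp
  obtain \<rho> V where \<rho>: "smooth_on \<rho> UNIV" "\<And>x. x \<in> A \<Longrightarrow> \<rho> x < 0" "\<And>x. x \<notin> A \<Longrightarrow> \<rho> x \<ge> 0"
    and V: "open V" "frontier A \<subseteq> V" "\<And>x. x \<in> V \<Longrightarrow> x \<notin> closure A \<Longrightarrow> \<rho> x > 0"
    and fr: "\<And>x. x \<in> frontier A \<Longrightarrow> \<rho> x = 0" "\<And>x. x \<in> frontier A \<Longrightarrow> grad \<rho> x \<noteq> 0"
    using defining_function_exists[OF A(2,3,5)] by metis
  define f where "f n x = smooth_step (real n * \<rho> x)" for n x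
  have f0: "f n x = 0" if "x \<notin> A" for n x
    using \<rho>(3)[OF that] by (simp add: f_def smooth_step_eq_0)
  have fpos: "f n x > 0" if "x \<in> A" "n > 0" for n x
    using \<rho>(2)[OF that(1)] that(2) by (simp add: f_def smooth_step_pos mult_pos_neg)
  have smf: "smooth_on (f n) UNIV" for n
    unfolding f_def[abs_def]
    by (rule smooth_on_compose[OF _ _ _ smooth_on_smooth_step smooth_on_mult[OF _ smooth_on_const \<rho>(1)]]) auto
  have suppf: "{x. f n x \<noteq> 0} = A" if "n > 0" for n
    using f0[of _ n] fpos[OF _ that] by (auto simp: less_le)
  \<comment> \<open>For \<open>n = 0\<close> the function is identically
    \<open>smooth_step 0 = 0\<close>, hence no test function.\<close>
  have test: "f n \<in> test_functions M" if "n > 0" for n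
  proof -
    obtain x where "x \<in> A" using A(1) by blast
    then have "f n x \<noteq> 0" using fpos[OF _ that] by (auto simp: less_le)
    then show ?thesis
      unfolding test_functions_def using smf A(3,4) suppf[OF that] by auto
  qed
  have Nf: "?N (f n) = (\<integral>\<^sup>+x. ennreal (f n x) \<partial>lborel)" for n
    unfolding L1_norm_on_def using f0 AM smooth_step_nonneg
    by (intro nn_integral_cong) (auto simp: indicator_def f_def)
  have bound: "?S * ?N (f n) \<le> 1 / of_nat (card T) * (\<Sum>t\<in>T. ?I t (f n))" if n: "n > 0" for n
  proof -
    have le: "?S \<le> (1 / of_nat (card T) * (\<Sum>t\<in>T. ?I t (f n))) / ?N (f n)"
      unfolding dynamic_sobolev_def by (rule INF_lower[OF test[OF n]])
    show ?thesis
    proof (rule ennreal_le_divide_iff[THEN iffD1, OF _ _ le])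
      have [measurable]: "f n \<in> borel_measurable borel"
        by (rule borel_measurable_continuous_onI[OF smooth_on_imp_continuous_on[OF smf]])
      have "(\<integral>\<^sup>+x. ennreal (f n x) \<partial>lborel) \<le> (\<integral>\<^sup>+x. indicator A x \<partial>lborel)"
        using f0 smooth_step_le_1 by (intro nn_integral_mono) (auto simp: indicator_def f_def)
      then show "?N (f n) \<noteq> \<infinity>"
        using finA by (auto simp: Nf top_unique)
      show "?N (f n) \<noteq> 0"
      proof
        assume "?N (f n) = 0"
        then have "AE x in lborel. ennreal (f n x) = 0"
          by (simp add: Nf nn_integral_0_iff_AE)
        then have "AE x in lborel. x \<notin> A"
          by (rule eventually_mono) (use fpos[OF _ n] in fastforce)
        then have "emeasure lborel A = 0"
          by (subst (asm) AE_iff_measurable[of A]) auto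
        with posA show False by simp
      qed
    qed
  qed
  have sup: "emeasure lborel A = (SUP n. ?N (f n))"
  proof -
    have "(SUP n. \<integral>\<^sup>+x. ennreal (f n x) \<partial>lborel) = (\<integral>\<^sup>+x. (SUP n. ennreal (f n x)) \<partial>lborel)"
    proof (rule nn_integral_monotone_convergence_SUP[symmetric])
      show "incseq (\<lambda>n x. ennreal (f n x))"
      proof (intro incseq_SucI le_funI ennreal_leI)
        fix n x
        show "f n x \<le> f (Suc n) x"
        proof (cases "x \<in> A")
          case True
          then show ?thesis unfolding f_def using \<rho>(2)[OF True]
            by (intro smooth_step_antimono) (simp add: algebra_simps)
        qed (simp add: f0)
      qed
      show "(\<lambda>x. ennreal (f n x)) \<in> borel_measurable lborel" for n
        using borel_measurable_continuous_onI[OF smooth_on_imp_continuous_on[OF smf]] by measurable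
    qed
    moreover have "(SUP n. ennreal (f n x)) = indicator A x" for x
    proof (cases "x \<in> A")
      case True
      \<comment> \<open>Chosen so that \<open>real m * \<rho> x \<le> -1\<close>; the supremum is
        then attained at \<open>m\<close>.\<close>
      obtain m :: nat where m: "1 / - \<rho> x \<le> real m" using real_arch_simple by blast
      have "real m * \<rho> x \<le> -1" using m \<rho>(2)[OF True] by (simp add: field_simps)
      then have "ennreal (f m x) = 1" by (simp add: f_def smooth_step_eq_1)
      then have "1 \<le> (SUP n. ennreal (f n x))" by (metis SUP_upper UNIV_I)
      moreover have "(SUP n. ennreal (f n x)) \<le> 1"
        by (intro SUP_least) (simp add: f_def smooth_step_le_1)
      ultimately show ?thesis using True by simp
    qed (simp add: f0)
    ultimately show ?thesis by (simp add: Nf)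
  qed
  have mono: "?N (f m) \<le> ?N (f n)" if "m \<le> n" for m n
    unfolding L1_norm_on_def
  proof (intro nn_integral_mono mult_right_mono ennreal_leI)
    fix x
    have "f m x \<le> f n x"
    proof (cases "x \<in> A")
      case True
      have "real n * \<rho> x \<le> real m * \<rho> x" using \<rho>(2)[OF True] that by (intro mult_right_mono_neg) auto
      then show ?thesis unfolding f_def by (rule smooth_step_antimono)
    qed (simp add: f0)
    then show "norm (f m x) \<le> norm (f n x)" using smooth_step_nonneg by (simp add: f_def)
  qed auto
  \<comment> \<open>Infinite areas are split off first: only for finite \<open>a t\<close> is
    \<open>a t < a t + e\<close> strict, as the gradient bound requires.\<close>
  have main: "?S * emeasure lborel A \<le> 1 / of_nat (card T) * (\<Sum>t\<in>T. a t)"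
  proof (cases "\<exists>t\<in>T. a t = \<infinity>")
    case True
    then obtain t where "t \<in> T" "a t = top" by auto
    then have "top \<le> (\<Sum>t\<in>T. a t)" using member_le_sum[of t T a] T(1) by simp
    moreover have "1 / of_nat (card T) \<noteq> (0::ennreal)" by simp
    ultimately show ?thesis by (simp add: top_unique ennreal_mult_top)
  next
    case False
    show ?thesis
    proof (rule ennreal_le_epsilon)
      fix e :: real assume e: "0 < e"
      have "\<forall>\<^sub>F n in sequentially. ?I t (f n) \<le> a t + ennreal e" if t: "t \<in> T" for t
      proof -
        interpret compact_diffeo M "\<Phi> t" by (rule diffeo[OF t])
        have "a t < a t + ennreal e"
          using False t e by (cases "a t" rule: ennreal_cases) (auto simp: ennreal_plus[symmetric] ennreal_less_iff simp del: ennreal_plus)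
        then show ?thesis
          unfolding L1_norm_gradient_pushforward f_def
          by (intro eventually_gradient_le_area[OF A(2,3,4) \<rho> V fr]) (simp_all add: a_def)
      qed
      then have "\<forall>\<^sub>F n in sequentially. \<forall>t\<in>T. ?I t (f n) \<le> a t + ennreal e"
        using T(1) by (simp add: eventually_ball_finite)
      then obtain n0 where n0: "\<And>n t. n \<ge> n0 \<Longrightarrow> t \<in> T \<Longrightarrow> ?I t (f n) \<le> a t + ennreal e"
        by (auto simp: eventually_sequentially)
      have "?S * ?N (f m) \<le> 1 / of_nat (card T) * (\<Sum>t\<in>T. a t) + ennreal e" for m
      proof -
        \<comment> \<open>Beyond \<open>m\<close>, so that the mass of \<open>f m\<close> is at most
          that of \<open>f n\<close>; beyond \<open>n0\<close>, so that the gradient bound holds;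
          and positive, so that \<open>f n\<close> is a test function.\<close>
        define n where "n = Suc (max m n0)"
        have "?S * ?N (f m) \<le> ?S * ?N (f n)" by (intro mult_left_mono mono) (auto simp: n_def)
        also have "\<dots> \<le> 1 / of_nat (card T) * (\<Sum>t\<in>T. ?I t (f n))" by (rule bound) (simp add: n_def)
        also have "\<dots> \<le> 1 / of_nat (card T) * (\<Sum>t\<in>T. a t + ennreal e)"
          by (intro mult_left_mono sum_mono n0) (auto simp: n_def)
        finally show ?thesis by (simp add: average_add_const[OF T])
      qed
      then have "(SUP m. ?S * ?N (f m)) \<le> 1 / of_nat (card T) * (\<Sum>t\<in>T. a t) + ennreal e"
        by (intro SUP_least)
      then show "?S * emeasure lborel A \<le> 1 / of_nat (card T) * (\<Sum>t\<in>T. a t) + ennreal e"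
        by (simp add: sup SUP_mult_left_ennreal)
    qed
  qed
  show "?S \<le> 1 / of_nat (card T) * (\<Sum>t\<in>T. hypersurface_volume (\<Phi> t ` frontier A)) / emeasure lborel A"
    using main unfolding a_def by (subst ennreal_le_divide_iff[OF posA finA])
qed

subsection \<open>Perturbation to a function with isolated critical points\<close>

text \<open>Countably many of the isolating neighbourhoods still cover \<open>Z\<close>, and each
  contains at most one of its points.\<close>

lemma countable_of_isolated:
  fixes Z :: "'a::second_countable_topology set"
  assumes "\<And>z. z \<in> Z \<Longrightarrow> \<exists>W. open W \<and> z \<in> W \<and> W \<inter> Z \<subseteq> {z}"
  shows "countable Z"
proof -
  obtain W where W: "\<And>z. z \<in> Z \<Longrightarrow> open (W z) \<and> z \<in> W z \<and> W z \<inter> Z \<subseteq> {z}"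
    using assms by metis
  obtain F where F: "F \<subseteq> W ` Z" "countable F" "\<Union>F = \<Union>(W ` Z)"
    using Lindelof[of "W ` Z"] W by blast
  have "Z \<subseteq> (\<Union>C\<in>F. C \<inter> Z)"
    using F(3) W by blast
  moreover have "countable (C \<inter> Z)" if C: "C \<in> F" for C
  proof -
    obtain z where "z \<in> Z" "C = W z" using F(1) C by blast
    then have "C \<inter> Z \<subseteq> {z}" using W by blast
    then show ?thesis by (rule countable_subset) simp
  qed
  then have "countable (\<Union>C\<in>F. C \<inter> Z)" using F(2) by blast
  ultimately show ?thesis by (rule countable_subset)
qed

text \<open>Near \<open>x\<close> the linear part has norm at least \<open>b * norm (y - x)\<close>,
  while the remainder is at most half of that.\<close>

lemma isolated_zero_of_injective_derivative:
  fixes F :: "'a::euclidean_space \<Rightarrow> 'b::euclidean_space"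
  assumes F: "(F has_derivative H) (at x)" "F x = 0" and inj: "inj H"
  obtains d where "d > 0" "\<And>y. norm (y - x) < d \<Longrightarrow> F y = 0 \<Longrightarrow> y = x"
proof -
  have lin: "linear H" by (rule has_derivative_linear[OF F(1)])
  obtain b where b: "b > 0" "\<And>v. b * norm v \<le> norm (H v)"
    using linear_inj_bounded_below_pos[OF lin inj] by blast
  obtain d where d: "d > 0" "\<And>y. norm (y - x) < d \<Longrightarrow> norm (F y - F x - H (y - x)) \<le> b / 2 * norm (y - x)"
    using F(1) b(1) unfolding has_derivative_at_alt by (meson half_gt_zero)
  show ?thesis
  proof (rule that[OF d(1)])
    fix y assume y: "norm (y - x) < d" "F y = 0"
    have "b * norm (y - x) \<le> norm (H (y - x))" by (rule b(2))
    also have "\<dots> \<le> b / 2 * norm (y - x)" using d(2)[OF y(1)] y(2) F(2) by simp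
    finally have "norm (y - x) \<le> 0" using b(1) by (simp add: mult_le_cancel_right)
    then show "y = x" by simp
  qed
qed

lemma grad_add_linear:
  assumes "f differentiable (at x)"
  shows "grad (\<lambda>x. f x + a \<bullet> x) x = grad f x + a"
proof (rule grad_eqI)
  have "((\<lambda>x. f x + a \<bullet> x) has_derivative (\<lambda>v. grad f x \<bullet> v + a \<bullet> v)) (at x)"
    by (intro has_derivative_add has_derivative_grad[OF assms] bounded_linear_imp_has_derivative bounded_linear_inner_right)
  moreover have "(\<lambda>v. grad f x \<bullet> v + a \<bullet> v) = (\<bullet>) (grad f x + a)"
    by (simp add: fun_eq_iff inner_add_left)
  ultimately show "((\<lambda>x. f x + a \<bullet> x) has_derivative (\<bullet>) (grad f x + a)) (at x)"
    by simp
qed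

lemma smooth_on_add_linear:
  fixes f :: "real^'n \<Rightarrow> real"
  assumes "smooth_on f UNIV"
  shows "smooth_on (\<lambda>x. f x + a \<bullet> x) UNIV"
  by (intro smooth_on_add assms smooth_on_bounded_linear bounded_linear_inner_right) simp

text \<open>If \<open>-a\<close> is a regular value of \<open>\<nabla>f\<close>, the critical points of \<open>x \<mapsto> f x + a \<bullet> x\<close> are nondegenerate. For
  this it suffices to know Sard's theorem for maps between spaces of equal dimension.\<close>

lemma morse_perturbation:
  fixes f :: "real^'n \<Rightarrow> real"
  assumes f: "smooth_on f UNIV" and e: "e > 0"
  obtains a where "norm a < e" "countable ((\<lambda>x. f x + a \<bullet> x) ` {x. grad (\<lambda>x. f x + a \<bullet> x) x = 0})"
proof -
  have "smooth_on (grad f) UNIV"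
  proof -
    have eq: "grad f = (\<lambda>x. \<Sum>i\<in>UNIV. frechet_derivative f (at x) (axis i 1) *\<^sub>R axis i 1)"
      by (rule ext, subst basis_expansion[symmetric]) (simp add: gradient_within_def scalar_mult_eq_scaleR)
    show ?thesis
      unfolding eq by (intro smooth_on_sum smooth_on_scaleR smooth_on_frechet_derivative f smooth_on_const) auto
  qed
  then have H: "(grad f has_derivative frechet_derivative (grad f) (at x)) (at x)" for x
    by (rule smooth_on_has_derivative) simp
  define H where "H x = frechet_derivative (grad f) (at x)" for x
  note H = H[folded H_def]
  define S where "S = {x. det (matrix (H x)) = 0}"
  have "negligible (grad f ` S)"
    by (rule negligible_critical_values[where f' = H]) (use H in \<open>auto simp: S_def\<close>)
  moreover have "\<not> negligible (ball (0::real^'n) e)"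
    using e by (intro open_not_negligible) auto
  ultimately obtain b where b: "b \<in> ball 0 e" "b \<notin> grad f ` S"
    using negligible_subset by blast
  define a where "a = - b"
  define fa where "fa x = f x + a \<bullet> x" for x
  have gfa: "grad fa x = grad f x - b" for x
    using grad_add_linear[OF smooth_on_differentiable[OF f], of x a] by (simp add: fa_def[abs_def] a_def)
  have "countable {x. grad fa x = 0}"
  proof (rule countable_of_isolated)
    fix z assume "z \<in> {x. grad fa x = 0}"
    then have z: "grad f z - b = 0" by (simp add: gfa)
    have d: "((\<lambda>x. grad f x - b) has_derivative H z) (at z)"
      using has_derivative_diff[OF H has_derivative_const] by simp
    have "z \<notin> S" using b(2) z by auto
    then have "det (matrix (H z)) \<noteq> 0" by (simp add: S_def)
    then have "inj (H z)"
      using has_derivative_linear[OF H] det_nz_iff_inj by blast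
    then obtain r where r: "r > 0" "\<And>y. norm (y - z) < r \<Longrightarrow> grad f y - b = 0 \<Longrightarrow> y = z"
      using isolated_zero_of_injective_derivative[OF d z] by blast
    then show "\<exists>W. open W \<and> z \<in> W \<and> W \<inter> {x. grad fa x = 0} \<subseteq> {z}"
      by (intro exI[of _ "ball z r"]) (auto simp: gfa dist_norm norm_minus_commute)
  qed
  then have "countable (fa ` {x. grad fa x = 0})" by simp
  moreover have "norm a < e" using b(1) by (simp add: a_def)
  ultimately show ?thesis using that unfolding fa_def[abs_def] by blast
qed

subsection \<open>The Cheeger constant is at most the Sobolev constant\<close>

text \<open>\<open>h\<close> plays the role of the perturbed function, whose superlevel sets need
  not be bounded; intersecting with \<open>{f > 0}\<close> confines them to \<open>K\<close>. The
  assumption on \<open>s\<close> keeps the closure away from \<open>{f = 0}\<close>, so no boundary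
  arises there.\<close>

lemma superlevel_set_admissible:
  fixes f :: "real^'n \<Rightarrow> real"
  assumes f: "continuous_on UNIV f" and K: "compact K" "K \<subseteq> interior M" "\<And>x. f x > 0 \<Longrightarrow> x \<in> K"
    and h: "smooth_on h UNIV" and s: "\<And>x. x \<in> K \<Longrightarrow> h x \<ge> s \<Longrightarrow> f x > 0"
    and reg: "\<And>x. h x = s \<Longrightarrow> grad h x \<noteq> 0" and ne: "{x. f x > 0 \<and> h x > s} \<noteq> {}"
  defines "A \<equiv> {x. f x > 0 \<and> h x > s}"
  shows "A \<in> admissible_sets M" and "frontier A = {x. f x > 0 \<and> h x = s}"
proof -
  have conth: "continuous_on S h" for S
    using smooth_on_imp_continuous_on[OF h] by (rule continuous_on_subset) auto
  have openA: "open A"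
    unfolding A_def by (intro open_Collect_conj open_Collect_less continuous_intros f conth)
  have cl: "closed (K \<inter> {x. s \<le> h x})"
    using K(1) by (intro closed_Int compact_imp_closed closed_Collect_le continuous_intros conth)
  have clA: "closure A \<subseteq> K \<inter> {x. s \<le> h x}"
    by (rule closure_minimal[OF _ cl]) (use K(3) in \<open>auto simp: A_def\<close>)
  have "compact (closure A)"
    using K(1) clA compact_eq_bounded_closed bounded_subset[OF compact_imp_bounded[OF K(1)]] by blast
  have iA: "interior A = A" using openA by (rule interior_open)
  show fr: "frontier A = {x. f x > 0 \<and> h x = s}"
  proof
    show "frontier A \<subseteq> {x. f x > 0 \<and> h x = s}"
    proof
      fix x assume "x \<in> frontier A"
      then have x: "x \<in> K" "s \<le> h x" "x \<notin> A" using clA by (auto simp: frontier_def iA)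
      then have "f x > 0" using s by blast
      then show "x \<in> {x. f x > 0 \<and> h x = s}" using x by (auto simp: A_def)
    qed
    show "{x. f x > 0 \<and> h x = s} \<subseteq> frontier A"
    proof
      fix x assume "x \<in> {x. f x > 0 \<and> h x = s}"
      then have x: "f x > 0" "h x = s" by auto
      \<comment> \<open>Moving from \<open>x\<close> along the gradient of \<open>h\<close> raises
        \<open>h\<close> above \<open>s\<close> at once while \<open>f\<close> stays positive, so
        \<open>x\<close> is a limit of points of \<open>A\<close>.\<close>
      define v where "v = grad h x"
      have dh: "((\<lambda>t. h (x + t *\<^sub>R v)) has_real_derivative (v \<bullet> v)) (at 0)"
        using grad_along_line[OF smooth_on_differentiable[OF h, of x], of v] by (simp add: v_def)
      have "v \<bullet> v > 0" using reg[OF x(2)] by (simp add: v_def)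
      from DERIV_pos_inc_right[OF dh this] obtain d where d: "d > 0" "\<And>t. 0 < t \<Longrightarrow> t < d \<Longrightarrow> s < h (x + t *\<^sub>R v)"
        using x(2) by auto
      have "x \<in> closure A"
        unfolding closure_approachable
      proof (intro allI impI)
        fix e :: real assume e: "e > 0"
        have "open ((\<lambda>t. x + t *\<^sub>R v) -` ({x. f x > 0} \<inter> ball x e))"
          by (intro continuous_open_vimage open_Int open_Collect_less continuous_intros f) auto
        moreover have "0 \<in> (\<lambda>t. x + t *\<^sub>R v) -` ({x. f x > 0} \<inter> ball x e)" using x e by simp
        ultimately obtain d' where d': "d' > 0" "ball 0 d' \<subseteq> (\<lambda>t. x + t *\<^sub>R v) -` ({x. f x > 0} \<inter> ball x e)"
          using openE by blast
        define t where "t = min d d' / 2"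
        have t: "0 < t" "t < d" "t \<in> ball 0 d'" using d(1) d'(1) by (auto simp: t_def)
        have "x + t *\<^sub>R v \<in> A" "dist (x + t *\<^sub>R v) x < e"
          using d(2)[OF t(1,2)] d'(2) t(3) by (auto simp: A_def dist_commute)
        then show "\<exists>y\<in>A. dist y x < e" by blast
      qed
      moreover have "x \<notin> A" using x by (simp add: A_def)
      ultimately show "x \<in> frontier A" by (simp add: frontier_def iA)
    qed
  qed
  have "smooth_boundary A"
    unfolding smooth_boundary_def
  proof
    fix p assume p: "p \<in> frontier A"
    define U where "U = {x. f x > 0} \<inter> {x. grad h x \<noteq> 0}"
    have "open U"
      unfolding U_def by (intro open_Int open_Collect_less open_Collect_neq continuous_intros f continuous_on_grad h)
    moreover have "p \<in> U" using p reg unfolding fr U_def by auto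
    moreover have "smooth_on (\<lambda>x. s + - h x) U"
      by (intro smooth_on_add smooth_on_const smooth_on_minus \<open>open U\<close> smooth_on_subset[OF h]) auto
    moreover have "gradient_within UNIV (\<lambda>x. s + - h x) x \<noteq> 0" if "x \<in> U" for x
    proof -
      have "((\<lambda>x. s + - h x) has_derivative (\<lambda>v. 0 + - (grad h x \<bullet> v))) (at x)"
        by (intro has_derivative_add has_derivative_const has_derivative_minus has_derivative_grad
            smooth_on_differentiable[OF h]) auto
      then have "gradient_within UNIV (\<lambda>x. s + - h x) x = - grad h x" by (intro grad_eqI) simp
      then show ?thesis using that by (auto simp: U_def)
    qed
    moreover have "interior A \<inter> U = {x\<in>U. s + - h x < 0}" unfolding iA by (auto simp: A_def U_def)
    moreover have "frontier A \<inter> U = {x\<in>U. s + - h x = 0}" unfolding fr by (auto simp: U_def)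
    ultimately show "\<exists>U g. open U \<and> p \<in> U \<and> smooth_on g U \<and>
        (\<forall>x\<in>U. gradient_within UNIV g x \<noteq> 0) \<and>
        interior A \<inter> U = {x\<in>U. g x < 0} \<and> frontier A \<inter> U = {x\<in>U. g x = 0}"
      by (intro exI[of _ U] exI[of _ "\<lambda>x. s + - h x"] conjI ballI)
  qed
  then show "A \<in> admissible_sets M"
    unfolding admissible_sets_def using ne openA \<open>compact (closure A)\<close> clA K(2) by (auto simp: A_def)
qed

lemma cheeger_mult_le:
  fixes M :: "(real^'n) set"
  assumes A: "A \<in> admissible_sets M"
  shows "dynamic_cheeger M T \<Phi> * emeasure lborel A
    \<le> 1 / of_nat (card T) * (\<Sum>t\<in>T. hypersurface_volume (\<Phi> t ` frontier A))"
proof -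
  have A': "A \<noteq> {}" "open A" "compact (closure A)"
    using A by (auto simp: admissible_sets_def)
  have "bounded A" by (rule bounded_subset[OF compact_imp_bounded[OF A'(3)] closure_subset])
  then have "emeasure lborel A \<noteq> \<infinity>" using emeasure_bounded_finite[of A] by auto
  moreover have "emeasure lborel A \<noteq> 0" by (rule emeasure_lborel_open_neq_0[OF A'(2,1)])
  moreover have "dynamic_cheeger M T \<Phi> \<le>
      1 / of_nat (card T) * (\<Sum>t\<in>T. hypersurface_volume (\<Phi> t ` frontier A)) / emeasure lborel A"
    unfolding dynamic_cheeger_def by (rule INF_lower[OF A])
  ultimately show ?thesis using ennreal_le_divide_iff by blast
qed

text \<open>Tonelli's theorem for the region below the graph. The integration starts at
  \<open>d\<close> because the superlevel sets of a perturbed function are admissible only above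
  such a threshold.\<close>

lemma layer_cake:
  fixes h :: "real^'n \<Rightarrow> real"
  assumes h: "continuous_on UNIV h" and U: "open U"
  shows "(\<integral>\<^sup>+s. indicator {d<..} s * emeasure lborel {x\<in>U. s < h x} \<partial>lborel)
    = (\<integral>\<^sup>+x\<in>U. ennreal (h x - d) \<partial>lborel)"
    and "(\<lambda>s. emeasure lborel {x\<in>U. s < h x}) \<in> borel_measurable borel"
proof -
  have [measurable]: "h \<in> borel_measurable borel" by (rule borel_measurable_continuous_onI[OF h])
  have [measurable]: "U \<in> sets borel" using U by simp
  have em: "emeasure lborel {x\<in>U. s < h x} = (\<integral>\<^sup>+x. indicator U x * indicator {..<h x} s \<partial>lborel)" for s
  proof -
    have "emeasure lborel {x\<in>U. s < h x} = (\<integral>\<^sup>+x. indicator {x\<in>U. s < h x} x \<partial>lborel)"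
      by (rule nn_integral_indicator[symmetric]) measurable
    also have "\<dots> = (\<integral>\<^sup>+x. indicator U x * indicator {..<h x} s \<partial>lborel)"
      by (intro nn_integral_cong) (auto simp: indicator_def)
    finally show ?thesis .
  qed
  have prod[measurable]: "(\<lambda>(s, x). indicator U x * indicator {..<h x} s :: ennreal) \<in> borel_measurable (lborel \<Otimes>\<^sub>M lborel)"
  proof -
    have "(\<lambda>p. indicator U (snd p) * indicator {p. fst p < h (snd p)} p :: ennreal) \<in> borel_measurable (lborel \<Otimes>\<^sub>M lborel)"
      by measurable
    then show ?thesis
      by (rule back_subst[of "\<lambda>f. f \<in> _"]) (auto simp: indicator_def fun_eq_iff)
  qed
  show "(\<lambda>s. emeasure lborel {x\<in>U. s < h x}) \<in> borel_measurable borel"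
    unfolding em using lborel.borel_measurable_nn_integral[OF prod] by simp
  have "(\<integral>\<^sup>+s. indicator {d<..} s * emeasure lborel {x\<in>U. s < h x} \<partial>lborel)
      = (\<integral>\<^sup>+s. \<integral>\<^sup>+x. indicator {d<..} s * (indicator U x * indicator {..<h x} s) \<partial>lborel \<partial>lborel)"
    unfolding em by (intro nn_integral_cong nn_integral_cmult[symmetric]) measurable
  also have "\<dots> = (\<integral>\<^sup>+x. \<integral>\<^sup>+s. indicator {d<..} s * (indicator U x * indicator {..<h x} s) \<partial>lborel \<partial>lborel)"
  proof (rule lborel_pair.Fubini'[symmetric])
    have "(\<lambda>p. indicator {d<..} (fst p) * (indicator U (snd p) * indicator {..<h (snd p)} (fst p)) :: ennreal)
        \<in> borel_measurable (lborel \<Otimes>\<^sub>M lborel)"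
      using prod[unfolded case_prod_unfold] by measurable
    then show "(\<lambda>(s, x). indicator {d<..} s * (indicator U x * indicator {..<h x} s) :: ennreal)
        \<in> borel_measurable (lborel \<Otimes>\<^sub>M lborel)"
      by (simp add: case_prod_unfold)
  qed
  also have "\<dots> = (\<integral>\<^sup>+x\<in>U. ennreal (h x - d) \<partial>lborel)"
  proof (intro nn_integral_cong)
    fix x
    have "(\<integral>\<^sup>+s. indicator {d<..} s * (indicator U x * indicator {..<h x} s) \<partial>lborel)
        = (\<integral>\<^sup>+s. indicator U x * indicator {d<..<h x} s \<partial>lborel)"
      by (intro nn_integral_cong) (auto simp: indicator_def)
    also have "\<dots> = indicator U x * emeasure lborel {d<..<h x}"
      by (subst nn_integral_cmult) auto
    also have "\<dots> = ennreal (h x - d) * indicator U x"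
      \<comment> \<open>If \<open>h x < d\<close>, the interval is empty and \<open>ennreal\<close>
        truncates the negative difference to \<open>0\<close>.\<close>
      by (cases "d \<le> h x") (auto simp: mult.commute ennreal_neg)
    finally show "(\<integral>\<^sup>+s. indicator {d<..} s * (indicator U x * indicator {..<h x} s) \<partial>lborel)
        = ennreal (h x - d) * indicator U x" .
  qed
  finally show "(\<integral>\<^sup>+s. indicator {d<..} s * emeasure lborel {x\<in>U. s < h x} \<partial>lborel)
    = (\<integral>\<^sup>+x\<in>U. ennreal (h x - d) \<partial>lborel)" .
qed

text \<open>\<open>a \<bullet> P y\<close> is a combination of the transported coordinate functions
  with coefficients \<open>a $ i\<close>. Their gradients are bounded on the compact image of
  \<open>K\<close>, and the image of \<open>U\<close> has finite measure, so \<open>C\<close> does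
  not depend on \<open>a\<close>.\<close>

lemma (in compact_diffeo) gradient_perturbation_bound:
  assumes f: "smooth_on f UNIV" and K: "compact K" "K \<subseteq> N" and U: "open U" "U \<subseteq> K"
  obtains C where "C \<ge> 0" "\<And>a. gradient_L1 (\<Phi> ` U) (\<lambda>y. f (P y) + a \<bullet> P y)
     \<le> gradient_L1 (\<Phi> ` U) (\<lambda>y. f (P y)) + ennreal (norm a * C)"
proof -
  define b where "b i y = axis i 1 \<bullet> P y" for i y
  have smb: "smooth_on (b i) (\<Phi> ` N)" for i
    unfolding b_def[abs_def]
    by (intro smooth_transport smooth_on_bounded_linear bounded_linear_inner_right) auto
  have smf: "smooth_on (\<lambda>y. f (P y)) (\<Phi> ` N)"
    by (intro smooth_transport smooth_on_subset[OF f]) auto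
  define B where "B y = (\<Sum>i\<in>UNIV. norm (grad (b i) y))" for y
  have contB: "continuous_on (\<Phi> ` N) B"
    unfolding B_def by (intro continuous_intros continuous_on_grad smb)
  have KM: "K \<subseteq> M" using K(2) interior_subset by blast
  have cK: "compact (\<Phi> ` K)"
    by (intro compact_continuous_image K continuous_on_subset[OF smooth_map_imp_continuous_on[OF smooth_map] KM])
  have "compact (B ` \<Phi> ` K)"
    by (intro compact_continuous_image cK continuous_on_subset[OF contB]) (use K(2) in auto)
  then obtain c where c: "\<And>y. y \<in> \<Phi> ` K \<Longrightarrow> \<bar>B y\<bar> \<le> c"
    using compact_imp_bounded[of "B ` \<Phi> ` K"] unfolding bounded_iff by auto
  define m where "m = measure lborel (\<Phi> ` U)"
  have UN: "U \<subseteq> N" using U(2) K(2) by blast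
  have openU: "open (\<Phi> ` U)" by (rule open_image[OF U(1) UN])
  have "bounded (\<Phi> ` U)" using bounded_subset[OF compact_imp_bounded[OF cK]] U(2) by blast
  then have "emeasure lborel (\<Phi> ` U) < \<infinity>" by (rule emeasure_bounded_finite)
  then have m: "emeasure lborel (\<Phi> ` U) = ennreal m" "m \<ge> 0"
    unfolding m_def by (simp_all add: emeasure_eq_ennreal_measure less_top[symmetric])
  have [measurable]: "\<Phi> ` U \<in> sets borel" using openU by simp
  show ?thesis
  proof (rule that[of "max c 0 * m"])
    show "0 \<le> max c 0 * m" using m(2) by simp
    fix a :: "real^'n"
    let ?G = "\<lambda>y. ennreal (norm (grad (\<lambda>y. f (P y)) y))"
    have pt: "norm (grad (\<lambda>y. f (P y) + a \<bullet> P y) y) \<le> norm (grad (\<lambda>y. f (P y)) y) + norm a * max c 0"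
      if y: "y \<in> \<Phi> ` U" for y
    proof -
      have yN: "y \<in> \<Phi> ` N" using y UN by blast
      have "a \<bullet> P z = (\<Sum>i\<in>UNIV. a $ i * b i z)" for z
        by (simp add: b_def inner_vec_def[of a] inner_axis' mult.commute)
      then have eq: "(\<lambda>y. f (P y) + a \<bullet> P y) = (\<lambda>y. f (P y) + (\<Sum>i\<in>UNIV. a $ i * b i y))" by simp
      have "((\<lambda>y. f (P y) + (\<Sum>i\<in>UNIV. a $ i * b i y)) has_derivative
          (\<lambda>v. grad (\<lambda>y. f (P y)) y \<bullet> v + (\<Sum>i\<in>UNIV. a $ i * (grad (b i) y \<bullet> v)))) (at y)"
        by (intro has_derivative_add has_derivative_sum has_derivative_mult_right has_derivative_grad
            smooth_on_differentiable[OF smf yN] smooth_on_differentiable[OF smb yN])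
      moreover have "(\<lambda>v. grad (\<lambda>y. f (P y)) y \<bullet> v + (\<Sum>i\<in>UNIV. a $ i * (grad (b i) y \<bullet> v)))
          = (\<bullet>) (grad (\<lambda>y. f (P y)) y + (\<Sum>i\<in>UNIV. a $ i *\<^sub>R grad (b i) y))"
        by (simp add: fun_eq_iff inner_add_left inner_sum_left)
      ultimately have "grad (\<lambda>y. f (P y) + a \<bullet> P y) y = grad (\<lambda>y. f (P y)) y + (\<Sum>i\<in>UNIV. a $ i *\<^sub>R grad (b i) y)"
        unfolding eq by (intro grad_eqI) simp
      then have "norm (grad (\<lambda>y. f (P y) + a \<bullet> P y) y)
          \<le> norm (grad (\<lambda>y. f (P y)) y) + norm (\<Sum>i\<in>UNIV. a $ i *\<^sub>R grad (b i) y)"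
        by (simp add: norm_triangle_ineq)
      also have "norm (\<Sum>i\<in>UNIV. a $ i *\<^sub>R grad (b i) y) \<le> (\<Sum>i\<in>UNIV. norm a * norm (grad (b i) y))"
        by (rule sum_norm_le) (simp add: mult_right_mono component_le_norm_cart)
      also have "\<dots> = norm a * B y" by (simp add: B_def sum_distrib_left)
      also have "\<dots> \<le> norm a * max c 0"
        using c[of y] y U(2) by (intro mult_left_mono) auto
      finally show ?thesis by simp
    qed
    note [measurable] = borel_measurable_norm_grad[OF openU smooth_on_subset[OF smf image_mono[OF UN]]]
    have "gradient_L1 (\<Phi> ` U) (\<lambda>y. f (P y) + a \<bullet> P y)
       \<le> (\<integral>\<^sup>+y. ?G y * indicator (\<Phi> ` U) y + ennreal (norm a * max c 0) * indicator (\<Phi> ` U) y \<partial>lborel)"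
      by (intro nn_integral_mono)
        (auto simp: indicator_def ennreal_plus[symmetric] simp del: ennreal_plus intro!: ennreal_leI pt)
    also have "\<dots> = (\<integral>\<^sup>+y\<in>\<Phi> ` U. ?G y \<partial>lborel) + ennreal (norm a * max c 0) * emeasure lborel (\<Phi> ` U)"
      by (subst nn_integral_add) (auto simp: nn_integral_cmult_indicator)
    also have "ennreal (norm a * max c 0) * emeasure lborel (\<Phi> ` U) = ennreal (norm a * (max c 0 * m))"
      using m by (simp add: ennreal_mult[symmetric] mult.assoc)
    finally show "gradient_L1 (\<Phi> ` U) (\<lambda>y. f (P y) + a \<bullet> P y)
       \<le> (\<integral>\<^sup>+y\<in>\<Phi> ` U. ?G y \<partial>lborel) + ennreal (norm a * (max c 0 * m))" .
  qed
qed


text \<open>Positive levels are needed for compactly contained superlevel sets, so the two signs of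
  a test function are treated separately. \<open>ennreal\<close> truncates at \<open>0\<close>, so
  the integral on the left is that of the positive part.\<close>

lemma cheeger_mult_positive_part_le:
  fixes M :: "(real^'n) set" and f :: "real^'n \<Rightarrow> real"
  assumes T: "finite T" "T \<noteq> {}" and diffeo: "\<And>t. t \<in> T \<Longrightarrow> compact_diffeo M (\<Phi> t)"
    and f: "smooth_on f UNIV" and K: "compact K" "K \<subseteq> interior M" "\<And>x. f x > 0 \<Longrightarrow> x \<in> K"
  shows "dynamic_cheeger M T \<Phi> * (\<integral>\<^sup>+x. ennreal (f x) \<partial>lborel) \<le> 1 / of_nat (card T) *
    (\<Sum>t\<in>T. gradient_L1 (\<Phi> t ` {x. f x > 0}) (\<lambda>y. f (inv_into M (\<Phi> t) y)))"
proof -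
  let ?h = "dynamic_cheeger M T \<Phi>" and ?P = "\<lambda>t. inv_into M (\<Phi> t)"
  let ?c = "1 / of_nat (card T) :: ennreal"
  define U where "U = {x. f x > 0}"
  define I where "I t = gradient_L1 (\<Phi> t ` U) (\<lambda>y. f (?P t y))" for t
  have contf: "continuous_on UNIV f" by (rule smooth_on_imp_continuous_on[OF f])
  have [measurable]: "f \<in> borel_measurable borel" by (rule borel_measurable_continuous_onI[OF contf])
  have openU: "open U" unfolding U_def by (intro open_Collect_less continuous_intros contf)
  have UK: "U \<subseteq> K" using K(3) by (auto simp: U_def)
  have UN: "U \<subseteq> interior M" using UK K(2) by blast
  have "\<forall>t\<in>T. \<exists>C\<ge>0. \<forall>a. gradient_L1 (\<Phi> t ` U) (\<lambda>y. f (?P t y) + a \<bullet> ?P t y)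
     \<le> I t + ennreal (norm a * C)"
  proof
    fix t assume t: "t \<in> T"
    obtain C where "C \<ge> 0" "\<And>a. gradient_L1 (\<Phi> t ` U) (\<lambda>y. f (?P t y) + a \<bullet> ?P t y)
      \<le> I t + ennreal (norm a * C)"
      by (rule compact_diffeo.gradient_perturbation_bound[OF diffeo[OF t] f K(1,2) openU UK], rule that)
        (simp_all add: I_def)
    then show "\<exists>C\<ge>0. \<forall>a. gradient_L1 (\<Phi> t ` U) (\<lambda>y. f (?P t y) + a \<bullet> ?P t y)
      \<le> I t + ennreal (norm a * C)" by blast
  qed
  from bchoice[OF this] obtain C where C': "\<forall>t\<in>T. C t \<ge> 0 \<and> (\<forall>a.
     gradient_L1 (\<Phi> t ` U) (\<lambda>y. f (?P t y) + a \<bullet> ?P t y)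
     \<le> I t + ennreal (norm a * C t))" ..
  have C: "C t \<ge> 0"
    "gradient_L1 (\<Phi> t ` U) (\<lambda>y. f (?P t y) + a \<bullet> ?P t y)
     \<le> I t + ennreal (norm a * C t)" if "t \<in> T" for t a
    using C' that by auto
  have Csum: "C t \<le> (\<Sum>t\<in>T. C t)" if "t \<in> T" for t
    using that C(1) T(1) by (intro member_le_sum) auto
  have Cnn: "(\<Sum>t\<in>T. C t) \<ge> 0" using C(1) by (intro sum_nonneg) auto
  obtain R where R: "R > 0" "\<And>x. x \<in> K \<Longrightarrow> norm x \<le> R"
    using compact_imp_bounded[OF K(1)] by (auto simp: bounded_pos)
  \<comment> \<open>One \<open>d\<close> pays for the perturbation, which is at most
    \<open>d\<close> on \<open>K\<close>; the other pays for integrating only over levels above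
    \<open>d\<close>.\<close>
  have step: "?h * (\<integral>\<^sup>+x. ennreal (f x - 2 * d) \<partial>lborel) \<le> ?c * (\<Sum>t\<in>T. I t)" if d: "d > 0" for d
  proof (rule ennreal_le_epsilon)
    fix e :: real assume e: "0 < e"
    \<comment> \<open>The first bound gives \<open>\<bar>a \<bullet> x\<bar> \<le> d\<close> on
      \<open>K\<close>, the second \<open>norm a * C t \<le> e\<close> at every time. The summand
      \<open>1\<close> guards against a vanishing sum.\<close>
    define \<eta> where "\<eta> = min (d / R) (e / ((\<Sum>t\<in>T. C t) + 1))"
    have "\<eta> > 0" using d e R(1) Cnn by (simp add: \<eta>_def)
    then obtain a where a: "norm a < \<eta>" and crit: "countable ((\<lambda>x. f x + a \<bullet> x) ` {x. grad (\<lambda>x. f x + a \<bullet> x) x = 0})"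
      using morse_perturbation[OF f] by metis
    define h where "h x = f x + a \<bullet> x" for x
    have smh: "smooth_on h UNIV" unfolding h_def[abs_def] by (rule smooth_on_add_linear[OF f])
    have conth: "continuous_on UNIV h" by (rule smooth_on_imp_continuous_on[OF smh])
    have ad: "\<bar>a \<bullet> x\<bar> \<le> d" if "x \<in> K" for x
    proof -
      have "\<bar>a \<bullet> x\<bar> \<le> norm a * norm x" by (rule Cauchy_Schwarz_ineq2)
      also have "\<dots> \<le> d / R * R" using a R(2)[OF that] R(1) d by (intro mult_mono) (auto simp: \<eta>_def)
      finally show ?thesis using R(1) by simp
    qed
    have aC: "norm a * C t \<le> e" if t: "t \<in> T" for t
    proof -
      have "norm a * C t \<le> e / ((\<Sum>t\<in>T. C t) + 1) * ((\<Sum>t\<in>T. C t) + 1)"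
        using a Csum[OF t] C(1)[OF t] e Cnn by (intro mult_mono) (auto simp: \<eta>_def)
      also have "\<dots> = e" using Cnn by simp
      finally show ?thesis .
    qed
    define G where "G = U \<inter> {x. grad h x \<noteq> 0}"
    have openG: "open G"
      unfolding G_def by (intro open_Int openU open_Collect_neq continuous_intros continuous_on_grad[OF smh])
    have GN: "G \<subseteq> interior M" using UN by (auto simp: G_def)
    define g where "g t y = h (?P t y)" for t y
    define area where "area t s = hypersurface_volume {y \<in> \<Phi> t ` G. g t y = s}" for t s
    have reg: "open (\<Phi> t ` G)" "smooth_on (g t) (\<Phi> t ` G)" "\<And>y. y \<in> \<Phi> t ` G \<Longrightarrow> grad (g t) y \<noteq> 0" if t: "t \<in> T" for t
    proof -
      interpret compact_diffeo M "\<Phi> t" by (rule diffeo[OF t])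
      have smG: "smooth_on h G" by (rule smooth_on_subset[OF smh]) simp
      show "open (\<Phi> t ` G)" by (rule open_image[OF openG GN])
      show "smooth_on (g t) (\<Phi> t ` G)"
        unfolding g_def[abs_def] by (rule smooth_transport[OF openG GN smG])
      show "grad (g t) y \<noteq> 0" if "y \<in> \<Phi> t ` G" for y
        using that grad_transport_neq_0[OF openG GN smG] by (auto simp: G_def g_def[abs_def])
    qed
    have level: "?h * emeasure lborel {x\<in>U. s < h x} \<le> ?c * (\<Sum>t\<in>T. area t s)"
      if s: "s > d" "s \<notin> h ` {x. grad h x = 0}" for s
    proof (cases "{x. f x > 0 \<and> h x > s} = {}")
      case True
      then have "{x\<in>U. s < h x} = {}" by (auto simp: U_def)
      then have "emeasure lborel {x\<in>U. s < h x} = 0" by (simp only: emeasure_empty)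
      then show ?thesis by simp
    next
      case False
      \<comment> \<open>Here \<open>s > d\<close> is used: the linear part cannot lift
        \<open>h\<close> to the level \<open>s\<close> by itself.\<close>
      have pos: "f x > 0" if "x \<in> K" "h x \<ge> s" for x
        using ad[OF that(1)] that(2) s(1) by (simp add: h_def)
      have regs: "grad h x \<noteq> 0" if "h x = s" for x using s(2) that by auto
      note adm = superlevel_set_admissible[OF contf K smh pos regs False]
      have fr: "frontier {x. f x > 0 \<and> h x > s} = {x. f x > 0 \<and> h x = s}" by (rule adm(2))
      have "area t s = hypersurface_volume (\<Phi> t ` frontier {x. f x > 0 \<and> h x > s})" if t: "t \<in> T" for t
      proof -
        interpret compact_diffeo M "\<Phi> t" by (rule diffeo[OF t])
        have "{x\<in>G. h x = s} = frontier {x. f x > 0 \<and> h x > s}"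
          unfolding fr using regs by (auto simp: G_def U_def)
        then show ?thesis
          unfolding area_def g_def transport_level_set[OF GN] by simp
      qed
      moreover have "{x\<in>U. s < h x} = {x. f x > 0 \<and> h x > s}" by (auto simp: U_def)
      ultimately show ?thesis using cheeger_mult_le[OF adm(1)] by simp
    qed
    have [measurable]: "area t \<in> borel_measurable borel" if "t \<in> T" for t
      unfolding area_def[abs_def] by (rule coarea_regular(1)[OF reg[OF that], of "\<lambda>_. 0"]) auto
    note [measurable] = layer_cake(2)[OF conth openU]
    have AE: "AE s in lborel. s \<notin> h ` {x. grad h x = 0}"
      using crit unfolding h_def[abs_def]
      by (intro AE_not_in countable_imp_null_set_lborel)
    have "?h * (\<integral>\<^sup>+x. ennreal (f x - 2 * d) \<partial>lborel) \<le> ?h * (\<integral>\<^sup>+x\<in>U. ennreal (h x - d) \<partial>lborel)"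
    proof (intro mult_left_mono nn_integral_mono)
      fix x
      show "ennreal (f x - 2 * d) \<le> ennreal (h x - d) * indicator U x"
      proof (cases "x \<in> U")
        case True
        then have "f x - 2 * d \<le> h x - d" using ad[of x] UK by (auto simp: h_def)
        then show ?thesis using True by (simp add: ennreal_leI)
      next
        case False
        then have "f x - 2 * d \<le> 0" using d by (simp add: U_def)
        then show ?thesis using False by (simp add: ennreal_neg)
      qed
    qed simp
    also have "\<dots> = ?h * (\<integral>\<^sup>+s. indicator {d<..} s * emeasure lborel {x\<in>U. s < h x} \<partial>lborel)"
      by (simp add: layer_cake(1)[OF conth openU])
    also have "\<dots> = (\<integral>\<^sup>+s. ?h * (indicator {d<..} s * emeasure lborel {x\<in>U. s < h x}) \<partial>lborel)"
      by (rule nn_integral_cmult[symmetric]) measurable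
    also have "\<dots> \<le> (\<integral>\<^sup>+s. ?c * (\<Sum>t\<in>T. indicator {d<..} s * area t s) \<partial>lborel)"
    proof (intro nn_integral_mono_AE eventually_mono[OF AE])
      fix s assume "s \<notin> h ` {x. grad h x = 0}"
      then show "?h * (indicator {d<..} s * emeasure lborel {x\<in>U. s < h x}) \<le> ?c * (\<Sum>t\<in>T. indicator {d<..} s * area t s)"
        using level[of s] by (cases "s > d") auto
    qed
    also have "\<dots> = ?c * (\<Sum>t\<in>T. \<integral>\<^sup>+s. indicator {d<..} s * area t s \<partial>lborel)"
      by (subst nn_integral_cmult, (measurable; fail), subst nn_integral_sum) auto
    also have "\<dots> \<le> ?c * (\<Sum>t\<in>T. I t + ennreal e)"
    proof (intro mult_left_mono sum_mono)
      fix t assume t: "t \<in> T"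
      have "(\<integral>\<^sup>+s. indicator {d<..} s * area t s \<partial>lborel)
          = (\<integral>\<^sup>+y\<in>\<Phi> t ` G. indicator {d<..} (g t y) * ennreal (norm (grad (g t) y)) \<partial>lborel)"
        unfolding area_def by (rule coarea_regular(2)[OF reg[OF t]]) auto
      \<comment> \<open>Points of \<open>U\<close> outside \<open>G\<close> are critical for
        \<open>h\<close>. They had to be left out for the coarea formula, and readmitting them only
        enlarges the integral.\<close>
      also have "\<dots> \<le> gradient_L1 (\<Phi> t ` U) (g t)"
        by (intro nn_integral_mono) (auto simp: indicator_def G_def)
      also have "\<dots> \<le> I t + ennreal (norm a * C t)"
        using C(2)[OF t, of a] by (simp add: g_def[abs_def] h_def)
      also have "\<dots> \<le> I t + ennreal e"
        by (intro add_left_mono ennreal_leI aC t)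
      finally show "(\<integral>\<^sup>+s. indicator {d<..} s * area t s \<partial>lborel) \<le> I t + ennreal e" .
    qed simp
    finally show "?h * (\<integral>\<^sup>+x. ennreal (f x - 2 * d) \<partial>lborel) \<le> ?c * (\<Sum>t\<in>T. I t) + ennreal e"
      by (simp only: average_add_const[OF T])
  qed
  \<comment> \<open>The margin \<open>d = 1 / real (Suc m)\<close> decreases to \<open>0\<close>, so
    the truncated functions increase to the positive part of \<open>f\<close>.\<close>
  define F where "F m x = ennreal (f x - 2 * (1 / real (Suc m)))" for m x
  have inc: "incseq F"
  proof (intro incseq_SucI le_funI)
    fix m x
    have "1 / real (Suc (Suc m)) \<le> 1 / real (Suc m)" by (simp add: frac_le)
    then show "F m x \<le> F (Suc m) x" unfolding F_def by (intro ennreal_leI) linarith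
  qed
  have "(SUP m. F m x) = ennreal (f x)" for x
  proof (rule LIMSEQ_unique[OF LIMSEQ_SUP])
    show "incseq (\<lambda>m. F m x)" using inc by (auto simp: incseq_def le_fun_def)
    have "(\<lambda>m. f x - 2 * (1 / real (Suc m))) \<longlonglongrightarrow> f x - 2 * 0"
      using LIMSEQ_inverse_real_of_nat by (intro tendsto_intros) (simp add: inverse_eq_divide)
    then show "(\<lambda>m. F m x) \<longlonglongrightarrow> ennreal (f x)"
      unfolding F_def by (intro tendsto_ennrealI) simp
  qed
  moreover have "(\<integral>\<^sup>+x. (SUP m. F m x) \<partial>lborel) = (SUP m. \<integral>\<^sup>+x. F m x \<partial>lborel)"
    by (rule nn_integral_monotone_convergence_SUP[OF inc]) (simp add: F_def[abs_def])
  ultimately have "?h * (\<integral>\<^sup>+x. ennreal (f x) \<partial>lborel) = (SUP m. ?h * (\<integral>\<^sup>+x. F m x \<partial>lborel))"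
    by (simp add: SUP_mult_left_ennreal)
  also have "\<dots> \<le> ?c * (\<Sum>t\<in>T. I t)"
    unfolding F_def by (intro SUP_least step) simp
  finally show ?thesis by (simp add: I_def U_def)
qed

lemma cheeger_le_sobolev:
  fixes M :: "(real^'n) set"
  assumes T: "finite T" "T \<noteq> {}" and diffeo: "\<And>t. t \<in> T \<Longrightarrow> compact_diffeo M (\<Phi> t)"
  shows "dynamic_cheeger M T \<Phi> \<le> dynamic_sobolev M T \<Phi>"
  unfolding dynamic_sobolev_def
proof (rule INF_greatest)
  fix f assume "f \<in> test_functions M"
  then have f: "smooth_on f UNIV" "\<exists>x. f x \<noteq> 0" "compact (closure {x. f x \<noteq> 0})" "closure {x. f x \<noteq> 0} \<subseteq> interior M"
    by (auto simp: test_functions_def)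
  let ?h = "dynamic_cheeger M T \<Phi>" and ?P = "\<lambda>t. inv_into M (\<Phi> t)"
  let ?c = "1 / of_nat (card T) :: ennreal"
  let ?K = "closure {x. f x \<noteq> 0}"
  let ?I = "\<lambda>t. L1_norm_on (\<Phi> t ` M) (gradient_within (\<Phi> t ` M) (pushforward M (\<Phi> t) f))"
  let ?J = "\<lambda>t S. gradient_L1 (\<Phi> t ` S) (\<lambda>y. f (?P t y))"
  have contf: "continuous_on UNIV f" by (rule smooth_on_imp_continuous_on[OF f(1)])
  have [measurable]: "f \<in> borel_measurable borel" by (rule borel_measurable_continuous_onI[OF contf])
  have fK: "x \<in> ?K" if "f x \<noteq> 0" for x using that closure_subset[of "{x. f x \<noteq> 0}"] by blast
  have KM: "?K \<subseteq> M" using f(4) interior_subset by blast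
  have norm: "L1_norm_on M f = (\<integral>\<^sup>+x. ennreal \<bar>f x\<bar> \<partial>lborel)"
    unfolding L1_norm_on_def using fK KM by (intro nn_integral_cong) (force simp: indicator_def)
  have pos: "?h * (\<integral>\<^sup>+x. ennreal (f x) \<partial>lborel) \<le> ?c * (\<Sum>t\<in>T. ?J t {x. f x > 0})"
    by (rule cheeger_mult_positive_part_le[OF T diffeo f(1,3,4)]) (use fK in auto)
  have sm': "smooth_on (\<lambda>x. - f x) UNIV" by (rule smooth_on_minus[OF open_UNIV f(1)])
  have "?h * (\<integral>\<^sup>+x. ennreal (- f x) \<partial>lborel) \<le> ?c *
    (\<Sum>t\<in>T. gradient_L1 (\<Phi> t ` {x. - f x > 0}) (\<lambda>y. - f (?P t y)))"
    by (rule cheeger_mult_positive_part_le[OF T diffeo sm' f(3,4)]) (use fK in auto)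
  also have "(\<Sum>t\<in>T. gradient_L1 (\<Phi> t ` {x. - f x > 0}) (\<lambda>y. - f (?P t y)))
     = (\<Sum>t\<in>T. ?J t {x. f x < 0})"
  proof (intro sum.cong refl nn_integral_cong)
    fix t y assume t: "t \<in> T"
    interpret compact_diffeo M "\<Phi> t" by (rule diffeo[OF t])
    have sub: "{x. f x < 0} \<subseteq> N" using fK f(4) by force
    have smN: "smooth_on (\<lambda>y. f (?P t y)) (\<Phi> t ` N)"
      by (rule smooth_transport) (auto intro: smooth_on_subset[OF f(1)])
    show "ennreal (norm (grad (\<lambda>y. - f (?P t y)) y)) * indicator (\<Phi> t ` {x. - f x > 0}) y
       = ennreal (norm (grad (\<lambda>y. f (?P t y)) y)) * indicator (\<Phi> t ` {x. f x < 0}) y"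
    proof (cases "y \<in> \<Phi> t ` {x. f x < 0}")
      case True
      then have "y \<in> \<Phi> t ` N" using sub by blast
      then have "((\<lambda>y. - f (?P t y)) has_derivative (\<lambda>v. - (grad (\<lambda>y. f (?P t y)) y \<bullet> v))) (at y)"
        by (intro has_derivative_minus has_derivative_grad smooth_on_differentiable[OF smN])
      moreover have "(\<lambda>v. - (grad (\<lambda>y. f (?P t y)) y \<bullet> v)) = (\<bullet>) (- grad (\<lambda>y. f (?P t y)) y)"
        by (simp add: fun_eq_iff)
      ultimately have "grad (\<lambda>y. - f (?P t y)) y = - grad (\<lambda>y. f (?P t y)) y"
        by (intro grad_eqI) simp
      then show ?thesis by simp
    qed simp
  qed
  finally have neg: "?h * (\<integral>\<^sup>+x. ennreal (- f x) \<partial>lborel) \<le> ?c * (\<Sum>t\<in>T. ?J t {x. f x < 0})" .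
  \<comment> \<open>The regions \<open>{f > 0}\<close> and \<open>{f < 0}\<close> have disjoint
    images, so their gradient integrals add up to at most the integral over the whole image.\<close>
  have J: "?J t {x. f x > 0} + ?J t {x. f x < 0} \<le> ?I t" if t: "t \<in> T" for t
  proof -
    interpret compact_diffeo M "\<Phi> t" by (rule diffeo[OF t])
    have subs: "{x. f x > 0} \<subseteq> N" "{x. f x < 0} \<subseteq> N" using fK f(4) by force+
    have opens: "open {x. f x > 0}" "open {x. f x < 0}"
      by (intro open_Collect_less continuous_intros contf)+
    have smN: "smooth_on (\<lambda>y. f (?P t y)) (\<Phi> t ` N)"
      by (rule smooth_transport) (auto intro: smooth_on_subset[OF f(1)])
    have meas: "(\<lambda>y. ennreal (norm (grad (\<lambda>y. f (?P t y)) y)) * indicator (\<Phi> t ` S) y) \<in> borel_measurable borel"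
      if S: "open S" "S \<subseteq> N" for S
      by (rule borel_measurable_norm_grad[OF open_image[OF S] smooth_on_subset[OF smN image_mono[OF S(2)]]])
    have dis: "\<Phi> t ` {x. f x > 0} \<inter> \<Phi> t ` {x. f x < 0} = {}"
    proof (rule ccontr)
      assume "\<not> ?thesis"
      then obtain x x' where x: "f x > 0" "f x' < 0" "\<Phi> t x = \<Phi> t x'" by auto
      then have "x = x'" using subs P_\<Phi> by (metis mem_Collect_eq subsetD)
      then show False using x by simp
    qed
    have "?J t {x. f x > 0} + ?J t {x. f x < 0} = (\<integral>\<^sup>+y. ennreal (norm (grad (\<lambda>y. f (?P t y)) y)) * indicator (\<Phi> t ` {x. f x > 0}) y
        + ennreal (norm (grad (\<lambda>y. f (?P t y)) y)) * indicator (\<Phi> t ` {x. f x < 0}) y \<partial>lborel)"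
      using meas[OF opens(1) subs(1)] meas[OF opens(2) subs(2)] by (intro nn_integral_add[symmetric]) auto
    also have "\<dots> \<le> gradient_L1 (\<Phi> t ` N) (\<lambda>y. f (?P t y))"
    proof (intro nn_integral_mono)
      fix y
      have "y \<in> \<Phi> t ` N" if "y \<in> \<Phi> t ` {x. f x > 0} \<or> y \<in> \<Phi> t ` {x. f x < 0}" using that subs by blast
      then show "ennreal (norm (grad (\<lambda>y. f (?P t y)) y)) * indicator (\<Phi> t ` {x. f x > 0}) y
        + ennreal (norm (grad (\<lambda>y. f (?P t y)) y)) * indicator (\<Phi> t ` {x. f x < 0}) y
        \<le> ennreal (norm (grad (\<lambda>y. f (?P t y)) y)) * indicator (\<Phi> t ` N) y"
        using dis by (cases "y \<in> \<Phi> t ` {x. f x > 0}"; cases "y \<in> \<Phi> t ` {x. f x < 0}") auto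
    qed
    finally show ?thesis by (simp add: L1_norm_gradient_pushforward)
  qed
  have "?h * L1_norm_on M f = ?h * (\<integral>\<^sup>+x. ennreal (f x) + ennreal (- f x) \<partial>lborel)"
    unfolding norm by (intro arg_cong[where f = "(*) ?h"] nn_integral_cong) (auto simp: abs_if ennreal_neg)
  also have "\<dots> = ?h * (\<integral>\<^sup>+x. ennreal (f x) \<partial>lborel) + ?h * (\<integral>\<^sup>+x. ennreal (- f x) \<partial>lborel)"
    by (subst nn_integral_add) (auto simp: distrib_left)
  also have "\<dots> \<le> ?c * (\<Sum>t\<in>T. ?J t {x. f x > 0}) + ?c * (\<Sum>t\<in>T. ?J t {x. f x < 0})"
    by (rule add_mono[OF pos neg])
  also have "\<dots> = ?c * (\<Sum>t\<in>T. ?J t {x. f x > 0} + ?J t {x. f x < 0})"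
    by (simp add: distrib_left sum.distrib)
  also have "\<dots> \<le> ?c * (\<Sum>t\<in>T. ?I t)"
    by (intro mult_left_mono sum_mono J) auto
  finally have main: "?h * L1_norm_on M f \<le> ?c * (\<Sum>t\<in>T. ?I t)" .
  \<comment> \<open>Dividing by the norm is an equivalence only if it is neither \<open>0\<close>
    nor infinite. It is positive because \<open>f\<close> is nonzero on a nonempty open set, and
    finite because \<open>f\<close> is bounded with compact support.\<close>
  have "L1_norm_on M f \<noteq> 0"
  proof
    assume "L1_norm_on M f = 0"
    then have "AE x in lborel. ennreal \<bar>f x\<bar> = 0"
      unfolding norm by (subst (asm) nn_integral_0_iff_AE) auto
    then have ae: "AE x in lborel. x \<notin> {x. f x \<noteq> 0}" by (rule eventually_mono) simp
    have op: "open {x. f x \<noteq> 0}" by (intro open_Collect_neq continuous_intros contf)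
    have "emeasure lborel {x. f x \<noteq> 0} = 0"
      using ae op by (subst (asm) AE_iff_measurable[of "{x. f x \<noteq> 0}"]) auto
    then show False using emeasure_lborel_open_neq_0[OF op] f(2) by auto
  qed
  moreover have "L1_norm_on M f \<noteq> \<infinity>"
  proof -
    have "compact (f ` ?K)" by (intro compact_continuous_image f(3) continuous_on_subset[OF contf]) auto
    then obtain b where b: "\<And>x. x \<in> ?K \<Longrightarrow> \<bar>f x\<bar> \<le> b"
      using compact_imp_bounded[of "f ` ?K"] unfolding bounded_iff by auto
    have "(\<integral>\<^sup>+x. ennreal \<bar>f x\<bar> \<partial>lborel) \<le> (\<integral>\<^sup>+x. ennreal b * indicator ?K x \<partial>lborel)"
      using b fK by (intro nn_integral_mono) (force simp: indicator_def intro: ennreal_leI)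
    also have "\<dots> = ennreal b * emeasure lborel ?K" by (rule nn_integral_cmult_indicator) simp
    also have "\<dots> < \<infinity>"
      using emeasure_bounded_finite[OF compact_imp_bounded[OF f(3)]] by (simp add: ennreal_mult_less_top)
    finally show ?thesis by (simp add: norm)
  qed
  ultimately show "?h \<le> ?c * (\<Sum>t\<in>T. ?I t) / L1_norm_on M f"
    using main by (subst ennreal_le_divide_iff)
qed

theorem theorem1:
  fixes M :: "(real^'n) set" and t\<^sub>F :: real and T :: "real set"
    and \<Phi> :: "real \<Rightarrow> real^'n \<Rightarrow> real^'n"
  assumes "compact M" and "frontier M \<noteq> {}" and "smooth_boundary M"
    and "t\<^sub>F > 0"
    and "finite T" and "T \<subseteq> {0..t\<^sub>F}" and "0 \<in> T" and "card T > 1"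
    and "\<And>t. t \<in> T \<Longrightarrow> smooth_diffeo_onto_image M (\<Phi> t)"
    and "\<And>x. x \<in> M \<Longrightarrow> \<Phi> 0 x = x"
  shows "dynamic_cheeger M T \<Phi> = dynamic_sobolev M T \<Phi>"
proof -
  have T: "finite T" "T \<noteq> {}" using assms by auto
  have diffeo: "compact_diffeo M (\<Phi> t)" if "t \<in> T" for t
    using assms that by unfold_locales auto
  show ?thesis
    by (intro antisym cheeger_le_sobolev sobolev_le_cheeger T diffeo)
qed

end
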